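(* Let $g_0(t)=e^{-\pi t^2}$, $t\in\mathbb{R}$, and for $a>0$ let $\Lambda(a)=a\mathbb{Z}\times a\mathbb{Z}$. Let $A(a)$ and $B(a)$ denote the (best possible) lower and upper frame bounds of the Gabor system $\mathcal{G}(g_0,\Lambda(a))$. There exist constants $0<c<C<\infty$ such that for each $a\in(1/2,1)$ $$c\,(1-a^2)\le A(a)\le C\,(1-a^2)$$ and $$c<B(a)<C.$$
   Context: For $\lambda=(x,\xi)\in\mathbb{R}^2$ the time-frequency shift $\pi_\lambda$ acts on $f\in L^2(\mathbb{R})$ by $\pi_\lambda f(t)=e^{2\pi i\xi t}f(t-x)$. For $g\in L^2(\mathbb{R})$ and a lattice $\Lambda\subset\mathbb{R}^2$, the Gabor system is $\mathcal{G}(g,\Lambda)=\{\pi_\lambda g:\lambda\in\Lambda\}$. It is a frame if there are constants $A,B>0$ such that for all $f\in L^2(\mathbb{R})$ $$A\|f\|^2_{L^2(\mathbb{R})}\le\sum_{\lambda\in\Lambda}|\langle f,\pi_\lambda g\rangle_{L^2(\mathbb{R})}|^2\le B\|f\|^2_{L^2(\mathbb{R})}.$$ The lower frame bound is the largest possible $A$ and the upper frame bound is the smallest possible $B$ in this inequality. *)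

theory Defs
  imports "HOL-Analysis.Analysis"
begin

text \<open>
  Square-integrable functions stand for the elements of $L^2(R)$: every class contains a
  Borel representative, and inner products, norms and frame inequalities do not change when
  a function is modified on a null set.
\<close>

definition L2_real :: "(real \<Rightarrow> complex) set" where
  "L2_real = {f \<in> borel_measurable lborel. integrable lborel (\<lambda>t. (cmod (f t))\<^sup>2)}"

definition l2_inner :: "(real \<Rightarrow> complex) \<Rightarrow> (real \<Rightarrow> complex) \<Rightarrow> complex" where
  "l2_inner f g = (LINT t|lborel. f t * cnj (g t))"

definition l2_norm :: "(real \<Rightarrow> complex) \<Rightarrow> real" where
  "l2_norm f = sqrt (LINT t|lborel. (cmod (f t))\<^sup>2)"

definition tf_shift :: "real \<times> real \<Rightarrow> (real \<Rightarrow> complex) \<Rightarrow> real \<Rightarrow> complex" where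
  "tf_shift = (\<lambda>(x, \<xi>) f t. exp (2 * of_real pi * \<i> * of_real \<xi> * of_real t) * f (t - x))"

text \<open>
  The sum over the index set is taken in the extended nonnegative reals, where it always
  exists, so that divergence counts as the value infinity and not as 0.
\<close>

definition frame_sum :: "(real \<Rightarrow> complex) \<Rightarrow> (real \<times> real) set \<Rightarrow> (real \<Rightarrow> complex) \<Rightarrow> ennreal" where
  "frame_sum g \<Lambda> f = (\<Sum>\<^sub>\<infinity>l\<in>\<Lambda>. ennreal ((cmod (l2_inner f (tf_shift l g)))\<^sup>2))"

definition is_lower_bound :: "(real \<Rightarrow> complex) \<Rightarrow> (real \<times> real) set \<Rightarrow> real \<Rightarrow> bool" where
  "is_lower_bound g \<Lambda> A \<longleftrightarrow>
     A > 0 \<and> (\<forall>f\<in>L2_real. ennreal (A * (l2_norm f)\<^sup>2) \<le> frame_sum g \<Lambda> f)"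

definition is_upper_bound :: "(real \<Rightarrow> complex) \<Rightarrow> (real \<times> real) set \<Rightarrow> real \<Rightarrow> bool" where
  "is_upper_bound g \<Lambda> B \<longleftrightarrow>
     B > 0 \<and> (\<forall>f\<in>L2_real. frame_sum g \<Lambda> f \<le> ennreal (B * (l2_norm f)\<^sup>2))"

definition gabor_frame :: "(real \<Rightarrow> complex) \<Rightarrow> (real \<times> real) set \<Rightarrow> bool" where
  "gabor_frame g \<Lambda> \<longleftrightarrow> (\<exists>A B. is_lower_bound g \<Lambda> A \<and> is_upper_bound g \<Lambda> B)"

text \<open>
  The following two numbers are meaningful when the Gabor system is a frame; in that case the
  extrema exist because the bounds are closed conditions on $A$ and $B$.
\<close>

definition lower_frame_bound :: "(real \<Rightarrow> complex) \<Rightarrow> (real \<times> real) set \<Rightarrow> real" where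
  "lower_frame_bound g \<Lambda> = (GREATEST A. is_lower_bound g \<Lambda> A)"

definition upper_frame_bound :: "(real \<Rightarrow> complex) \<Rightarrow> (real \<times> real) set \<Rightarrow> real" where
  "upper_frame_bound g \<Lambda> = (LEAST B. is_upper_bound g \<Lambda> B)"

definition gaussian :: "real \<Rightarrow> complex" where
  "gaussian t = of_real (exp (- pi * t\<^sup>2))"

definition square_lattice :: "real \<Rightarrow> (real \<times> real) set" where
  "square_lattice a = range (\<lambda>m::int. a * of_int m) \<times> range (\<lambda>n::int. a * of_int n)"

end

theory Submission
  imports Defs
begin

text \<open>
  Parseval's identity in the modulation variable turns the frame sum into an integral over
  $t \<in> [0, 1/a)$ of the sums $\<Sum>_m |\<Sum>_k c_k g_0(t + k/a - am)|^2$ with $c_k = f(t + k/a)$, so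
  the frame bounds are governed by these infinite Gaussian matrices, uniformly in $t$.
  The upper bound is Schur's test. For the lower bound the matrix has an explicit left inverse:
  up to Gaussian factors it is of Vandermonde type with nodes $e^{2\<pi> m}$, and the required
  dual sequence consists of the tails of the theta series
  $\<Sum>_n (-1)^n e^{-\<pi> n(n-1)} x^n$, which vanishes at all these nodes. Its entries are bounded by
  $C e^{-\<pi>(1-a^2) j^2}$, so Schur's test bounds its norm by a multiple of $(1-a^2)^{-1/2}$.
  That this order is sharp is seen from $c_k = (-1)^k e^{-\<pi>(a^{-2}-1)k^2}$ for $t$ near $a/2$,
  where the sums are values of a theta function close to its zeros.
\<close>

section \<open>Sums over the integers\<close>

text \<open>The spacings a and 1/a have product 1, so the mixed term of the Gaussian exponent is 2
  pi k m whatever a is; hence the nodes. If Theta denotes the theta series, its tails are the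
  coefficients of Theta(x)/(x - 1): one zero is divided out, and the quotient vanishes at every node
  except x = 1. That is the whole biorthogonality. The difficulty is the growing factor e^{pi (a m -
  t)^2} that has to be carried along. Centring at the integer nearest to t/a costs up to |j| + 1/4
  in the exponent, but the tails decay like e^{-pi (j^2 + |j|)}, and the extra |j| pays for the
  rounding; (1 - a^2) j^2 is left. Gaussian lattice sums matter only up to their order in the width,
  so they are dominated by the profile 1/(1 + x^2), whose sums telescope. For sharpness a single
  fibre is a null set, so the test function spreads the sequence over a window of fibres of length a
  (1 - a^2)/4, short enough to move the theta argument away from its zero by no more than the order
  that the damping causes anyway.\<close>

abbreviation zcount :: "int measure" where
  "zcount \<equiv> count_space UNIV"

text \<open>Sums over the integers are integrals against counting measure throughout, so that
  Tonelli, Fubini and Cauchy-Schwarz apply directly. This splitting is the bridge to one-sided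
  series, where telescoping and geometric sums live.\<close>

lemma nn_integral_zcount_split:
  fixes f :: "int \<Rightarrow> ennreal"
  shows "(\<integral>\<^sup>+j. f j \<partial>zcount) = (\<Sum>n. f (int n)) + (\<Sum>n. f (- int (Suc n)))"
proof -
  have b1: "bij_betw int UNIV {0..}"
    by (auto simp: bij_betw_def inj_on_def image_iff intro: zero_le_imp_eq_int)
  have b2: "bij_betw (\<lambda>n. - int (Suc n)) UNIV {..<0}"
  proof (rule bij_betwI[where g="\<lambda>j. nat (- j - 1)"])
  qed auto
  have "(\<integral>\<^sup>+j. f j \<partial>zcount) = (\<integral>\<^sup>+j. f j * indicator {0..} j + f j * indicator {..<0} j \<partial>zcount)"
    by (intro nn_integral_cong) (auto split: split_indicator)
  also have "\<dots> = (\<integral>\<^sup>+j. f j \<partial>count_space {0..}) + (\<integral>\<^sup>+j. f j \<partial>count_space {..<0})"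
    by (subst nn_integral_add) (auto simp: nn_integral_count_space_indicator)
  also have "\<dots> = (\<Sum>n. f (int n)) + (\<Sum>n. f (- int (Suc n)))"
    unfolding nn_integral_bij_count_space[OF b1, symmetric] nn_integral_bij_count_space[OF b2, symmetric]
    by (simp add: nn_integral_count_space_nat)
  finally show ?thesis .
qed

text \<open>Comparison with a telescoping series: for y = x + s the term 1/(1 + y^2) is at most
  2/((1 + x)(1 + y)), a multiple of a difference of consecutive \<open>u n\<close>. What matters is
  the growth 1/s as s tends to 0: with s of order sqrt(1 - a^2) it produces the order of both
  estimates of the lower frame bound.\<close>

lemma nn_integral_zcount_cauchy_le:
  fixes s :: real
  assumes s: "s > 0"
  shows "(\<integral>\<^sup>+j. ennreal (1 / (1 + (s * of_int j)\<^sup>2)) \<partial>zcount) \<le> ennreal (1 + 4 / s)"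
proof -
  define u where "u n = 1 / (1 + s * real n)" for n
  define b where "b n = 1 / (1 + (s * real n)\<^sup>2)" for n
  have "u \<longlonglongrightarrow> 0"
    unfolding u_def using s
    by (intro tendsto_divide_0[OF tendsto_const] filterlim_at_top_imp_at_infinity
        filterlim_tendsto_add_at_top[OF tendsto_const]
        filterlim_tendsto_pos_mult_at_top[OF tendsto_const] filterlim_real_sequentially)
  then have "(\<lambda>n. u n - u (Suc n)) sums (u 0 - 0)"
    by (rule telescope_sums')
  then have "(\<lambda>n. 2 / s * (u n - u (Suc n))) sums (2 / s * (u 0 - 0))"
    by (rule sums_mult)
  then have tel: "(\<lambda>n. 2 / s * (u n - u (Suc n))) sums (2 / s)"
    by (simp add: u_def)
  have b_le: "b (Suc n) \<le> 2 / s * (u n - u (Suc n))" for n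
  proof -
    define x where "x = s * real n"
    define y where "y = s * real (Suc n)"
    have xy: "y = x + s" "x \<ge> 0" "y > 0"
      using s by (auto simp: x_def y_def algebra_simps add_pos_nonneg)
    have "(1 + x) * (1 + y) \<le> (1 + y) * (1 + y)"
      using xy s by (intro mult_right_mono) auto
    also have "\<dots> \<le> 2 * (1 + y\<^sup>2)"
      using sum_squares_bound[of 1 y] by (simp add: power2_eq_square algebra_simps)
    finally have "2 / (2 * (1 + y\<^sup>2)) \<le> 2 / ((1 + x) * (1 + y))"
      using xy s by (intro divide_left_mono mult_pos_pos add_pos_nonneg) auto
    then have "1 / (1 + y\<^sup>2) \<le> 2 / ((1 + x) * (1 + y))"
      by (subst (asm) nonzero_divide_mult_cancel_left) simp_all
    also have "\<dots> = 2 / s * (1 / (1 + x) - 1 / (1 + y))"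
    proof -
      have "1 + x \<noteq> 0" "1 + y \<noteq> 0" using xy by auto
      then show ?thesis using s xy(1) by (simp add: field_simps)
    qed
    finally show ?thesis by (simp add: b_def u_def x_def y_def)
  qed
  have tail: "(\<Sum>n. ennreal (b (Suc n))) \<le> ennreal (2 / s)"
  proof -
    have "(\<Sum>n. ennreal (b (Suc n))) \<le> (\<Sum>n. ennreal (2 / s * (u n - u (Suc n))))"
      by (intro suminf_le ennreal_leI b_le) auto
    also have "\<dots> = ennreal (2 / s)"
    proof (rule suminf_ennreal_eq[OF _ tel])
      fix n
      have "0 \<le> b (Suc n)" by (simp add: b_def)
      with b_le[of n] show "0 \<le> 2 / s * (u n - u (Suc n))" by linarith
    qed
    finally show ?thesis .
  qed
  have "(\<integral>\<^sup>+j. ennreal (1 / (1 + (s * of_int j)\<^sup>2)) \<partial>zcount)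
      = (\<Sum>n. ennreal (b n)) + (\<Sum>n. ennreal (b (Suc n)))"
    unfolding nn_integral_zcount_split b_def
    by (intro arg_cong2[where f="(+)"] arg_cong[where f=suminf] ext)
       (auto simp: power2_eq_square algebra_simps)
  also have "(\<Sum>n. ennreal (b n)) = ennreal (b 0) + (\<Sum>n. ennreal (b (Suc n)))"
    using suminf_offset[of "\<lambda>n. ennreal (b n)" 1] by simp
  also have "ennreal (b 0) + (\<Sum>n. ennreal (b (Suc n))) + (\<Sum>n. ennreal (b (Suc n)))
      \<le> ennreal 1 + ennreal (2 / s) + ennreal (2 / s)"
    by (intro add_mono tail) (simp add: b_def)
  also have "\<dots> = ennreal (1 + 4 / s)"
    using s by (simp flip: ennreal_plus add: ennreal_1[symmetric] del: ennreal_1)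
  finally show ?thesis .
qed

text \<open>After centring at the integer nearest to x/d, the remaining offset \<delta> is at most
  1/2 in absolute value, and then |j + \<delta>| is at least |j|/2 for every integer j. Halving the
  scale turns 4/s into 8/d, uniformly in x.\<close>

lemma nn_integral_zcount_shifted_cauchy_le:
  fixes x d :: real
  assumes d: "d > 0"
  shows "(\<integral>\<^sup>+k. ennreal (1 / (1 + (x + d * of_int k)\<^sup>2)) \<partial>zcount) \<le> ennreal (1 + 8 / d)"
proof -
  define r where "r = round (x / d)"
  have bij: "bij_betw (\<lambda>j. j - r) UNIV UNIV"
    by (rule bij_betwI[where g="\<lambda>j. j + r"]) auto
  have "(\<integral>\<^sup>+k. ennreal (1 / (1 + (x + d * of_int k)\<^sup>2)) \<partial>zcount)
      = (\<integral>\<^sup>+j. ennreal (1 / (1 + (x + d * of_int (j - r))\<^sup>2)) \<partial>zcount)"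
    by (rule nn_integral_bij_count_space[OF bij, symmetric])
  also have "\<dots> \<le> (\<integral>\<^sup>+j. ennreal (1 / (1 + (d / 2 * of_int j)\<^sup>2)) \<partial>zcount)"
  proof (intro nn_integral_mono ennreal_leI)
    fix j :: int
    define \<delta> where "\<delta> = x / d - of_int r"
    have \<delta>: "\<bar>\<delta>\<bar> \<le> 1 / 2"
      using of_int_round_abs_le[of "x / d"] by (simp add: \<delta>_def r_def abs_minus_commute)
    have eq: "x + d * of_int (j - r) = d * (of_int j + \<delta>)"
      using d by (simp add: \<delta>_def field_simps)
    have "\<bar>real_of_int j\<bar> / 2 \<le> \<bar>real_of_int j + \<delta>\<bar>"
    proof (cases "j = 0")
      case False
      then have "\<bar>real_of_int j\<bar> \<ge> 1" by linarith
      then show ?thesis using \<delta> by linarith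
    qed simp
    then have "\<bar>d / 2 * of_int j\<bar> \<le> \<bar>d * (of_int j + \<delta>)\<bar>"
      using d by (simp add: abs_mult)
    then have "(d / 2 * of_int j)\<^sup>2 \<le> (d * (of_int j + \<delta>))\<^sup>2"
      by (rule abs_le_square_iff[THEN iffD1])
    then show "1 / (1 + (x + d * of_int (j - r))\<^sup>2) \<le> 1 / (1 + (d / 2 * of_int j)\<^sup>2)"
      unfolding eq by (intro divide_left_mono) (auto intro!: mult_pos_pos add_pos_nonneg)
  qed
  also have "\<dots> \<le> ennreal (1 + 8 / d)"
    using nn_integral_zcount_cauchy_le[of "d / 2"] d by simp
  finally show ?thesis .
qed

lemma exp_neg_le_inverse:
  fixes u :: real assumes "0 \<le> u"
  shows "exp (- u) \<le> 1 / (1 + u)"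
  using exp_ge_add_one_self[of u] assms by (simp add: exp_minus field_simps)

text \<open>Serves the sharpness estimate, where the square of a linearly growing factor meets a
  Gaussian; the product is again dominated by a summable profile.\<close>

lemma mult_exp_neg_le_inverse:
  fixes u :: real assumes "0 \<le> u"
  shows "u * exp (- u) \<le> 2 / (1 + u)"
proof -
  have "1 + u + u\<^sup>2 / 2 \<le> exp u"
    using exp_lower_Taylor_quadratic[OF assms] by simp
  then have "u * (1 + u) \<le> 2 * exp u"
    using assms by (simp add: power2_eq_square algebra_simps)
  then show ?thesis
    using assms by (simp add: exp_minus field_simps)
qed

lemma gauss_le_cauchy:
  fixes x :: real
  shows "exp (- (pi * x\<^sup>2)) \<le> 1 / (1 + x\<^sup>2)"
proof -
  have "x\<^sup>2 * 1 \<le> x\<^sup>2 * pi"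
    using pi_gt3 by (intro mult_left_mono) auto
  then have "exp (- (pi * x\<^sup>2)) \<le> exp (- x\<^sup>2)" by (simp add: mult.commute)
  also have "\<dots> \<le> 1 / (1 + x\<^sup>2)" by (rule exp_neg_le_inverse) simp
  finally show ?thesis .
qed

text \<open>Cauchy-Schwarz in each row for the splitting K = sqrt K * sqrt K, followed by an
  exchange of the two sums. With values in \<open>ennreal\<close> both steps are valid for arbitrary
  u, divergent sums included.\<close>

lemma schur_test:
  fixes K :: "int \<Rightarrow> int \<Rightarrow> real" and u :: "int \<Rightarrow> ennreal"
  assumes nonneg: "\<And>m k. 0 \<le> K m k"
    and rows: "\<And>m. (\<integral>\<^sup>+k. ennreal (K m k) \<partial>zcount) \<le> ennreal R"
    and cols: "\<And>k. (\<integral>\<^sup>+m. ennreal (K m k) \<partial>zcount) \<le> ennreal S"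
  shows "(\<integral>\<^sup>+m. (\<integral>\<^sup>+k. ennreal (K m k) * u k \<partial>zcount)\<^sup>2 \<partial>zcount)
           \<le> ennreal R * ennreal S * (\<integral>\<^sup>+k. (u k)\<^sup>2 \<partial>zcount)"
proof -
  have sq: "(ennreal (sqrt (K m k)))\<^sup>2 = ennreal (K m k)" for m k
    using nonneg by (simp add: ennreal_power)
  have row: "(\<integral>\<^sup>+k. ennreal (K m k) * u k \<partial>zcount)\<^sup>2
      \<le> ennreal R * (\<integral>\<^sup>+k. ennreal (K m k) * (u k)\<^sup>2 \<partial>zcount)" for m
  proof -
    have "(\<integral>\<^sup>+k. ennreal (K m k) * u k \<partial>zcount)
        = (\<integral>\<^sup>+k. ennreal (sqrt (K m k)) * (ennreal (sqrt (K m k)) * u k) \<partial>zcount)"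
      by (simp add: sq[symmetric] power2_eq_square mult.assoc)
    then have "(\<integral>\<^sup>+k. ennreal (K m k) * u k \<partial>zcount)\<^sup>2
        \<le> (\<integral>\<^sup>+k. (ennreal (sqrt (K m k)))\<^sup>2 \<partial>zcount)
          * (\<integral>\<^sup>+k. (ennreal (sqrt (K m k)) * u k)\<^sup>2 \<partial>zcount)"
      using Cauchy_Schwarz_nn_integral[of "\<lambda>k. ennreal (sqrt (K m k))" zcount
          "\<lambda>k. ennreal (sqrt (K m k)) * u k"] by simp
    also have "\<dots> = (\<integral>\<^sup>+k. ennreal (K m k) \<partial>zcount) * (\<integral>\<^sup>+k. ennreal (K m k) * (u k)\<^sup>2 \<partial>zcount)"
      by (simp add: sq power_mult_distrib)
    also have "\<dots> \<le> ennreal R * (\<integral>\<^sup>+k. ennreal (K m k) * (u k)\<^sup>2 \<partial>zcount)"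
      by (intro mult_right_mono rows) auto
    finally show ?thesis .
  qed
  have "(\<integral>\<^sup>+m. (\<integral>\<^sup>+k. ennreal (K m k) * u k \<partial>zcount)\<^sup>2 \<partial>zcount)
      \<le> (\<integral>\<^sup>+m. ennreal R * (\<integral>\<^sup>+k. ennreal (K m k) * (u k)\<^sup>2 \<partial>zcount) \<partial>zcount)"
    by (intro nn_integral_mono row)
  also have "\<dots> = ennreal R * (\<integral>\<^sup>+k. (\<integral>\<^sup>+m. ennreal (K m k) * (u k)\<^sup>2 \<partial>zcount) \<partial>zcount)"
    by (subst nn_integral_cmult, simp, subst nn_integral_count_space_nn_integral) simp_all
  also have "\<dots> = ennreal R * (\<integral>\<^sup>+k. (\<integral>\<^sup>+m. ennreal (K m k) \<partial>zcount) * (u k)\<^sup>2 \<partial>zcount)"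
    by (simp add: nn_integral_multc)
  also have "\<dots> \<le> ennreal R * (\<integral>\<^sup>+k. ennreal S * (u k)\<^sup>2 \<partial>zcount)"
    by (intro mult_left_mono nn_integral_mono mult_right_mono cols) auto
  also have "\<dots> = ennreal R * ennreal S * (\<integral>\<^sup>+k. (u k)\<^sup>2 \<partial>zcount)"
    by (simp add: nn_integral_cmult mult.assoc)
  finally show ?thesis .
qed

section \<open>The dual sequence\<close>

lemma sigma_finite_zcount: "sigma_finite_measure zcount"
  by (rule sigma_finite_measure_count_space_countable) simp

lemma integrable_zcountI:
  fixes f :: "int \<Rightarrow> 'a::{banach, second_countable_topology}"
  assumes d: "d > 0" and C: "0 \<le> C"
    and bound: "\<And>j. norm (f j) \<le> C / (1 + (x + d * of_int j)\<^sup>2)"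
  shows "integrable zcount f"
proof (rule integrableI_bounded)
  have "(\<integral>\<^sup>+j. ennreal (norm (f j)) \<partial>zcount)
      \<le> (\<integral>\<^sup>+j. ennreal C * ennreal (1 / (1 + (x + d * of_int j)\<^sup>2)) \<partial>zcount)"
    using bound C by (intro nn_integral_mono) (simp flip: ennreal_mult' add: ennreal_leI)
  also have "\<dots> = ennreal C * (\<integral>\<^sup>+j. ennreal (1 / (1 + (x + d * of_int j)\<^sup>2)) \<partial>zcount)"
    by (simp add: nn_integral_cmult)
  also have "\<dots> \<le> ennreal C * ennreal (1 + 8 / d)"
    by (intro mult_left_mono nn_integral_zcount_shifted_cauchy_le d) simp
  also have "\<dots> < \<infinity>" by (simp add: ennreal_mult_less_top)
  finally show "(\<integral>\<^sup>+j. ennreal (norm (f j)) \<partial>zcount) < \<infinity>" .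
qed simp

lemma integrable_zcount_imp_summable:
  fixes f :: "int \<Rightarrow> real"
  assumes "integrable zcount f"
  shows "summable (\<lambda>n. norm (f (int n)))"
proof (rule summable_suminf_not_top)
  have "(\<Sum>n. ennreal (norm (f (int n)))) \<le> (\<integral>\<^sup>+j. ennreal (norm (f j)) \<partial>zcount)"
    unfolding nn_integral_zcount_split by simp
  also have "\<dots> < \<infinity>" using assms by (simp add: integrable_iff_bounded)
  finally show "(\<Sum>n. ennreal (norm (f (int n)))) \<noteq> top" by simp
qed simp

lemma integral_zcount_shift:
  fixes f :: "int \<Rightarrow> 'a::{banach, second_countable_topology}"
  shows "(\<integral>j. f (j + r) \<partial>zcount) = (\<integral>j. f j \<partial>zcount)"
  by (rule integral_bij_count_space, rule bij_betwI[where g="\<lambda>j. j - r"]) auto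

lemma integrable_zcount_shift:
  fixes f :: "int \<Rightarrow> 'a::{banach, second_countable_topology}"
  shows "integrable zcount (\<lambda>j. f (j + r)) \<longleftrightarrow> integrable zcount f"
  by (rule integrable_bij_count_space, rule bij_betwI[where g="\<lambda>j. j - r"]) auto

lemma integral_zcount_swap:
  fixes f :: "int \<Rightarrow> int \<Rightarrow> 'a::{banach, second_countable_topology}"
  assumes "(\<integral>\<^sup>+x. (\<integral>\<^sup>+y. ennreal (norm (f x y)) \<partial>zcount) \<partial>zcount) < \<infinity>"
  shows "(\<integral>x. (\<integral>y. f x y \<partial>zcount) \<partial>zcount) = (\<integral>y. (\<integral>x. f x y \<partial>zcount) \<partial>zcount)"
proof -
  interpret pair_sigma_finite zcount zcount
    using sigma_finite_zcount by (simp add: pair_sigma_finite_def)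
  have cs: "zcount \<Otimes>\<^sub>M zcount = count_space (UNIV \<times> UNIV)"
    by (rule pair_measure_countable) auto
  have meas: "h \<in> borel_measurable (zcount \<Otimes>\<^sub>M zcount)" for h :: "int \<times> int \<Rightarrow> 'b::topological_space"
    unfolding cs by simp
  have "(\<integral>\<^sup>+x. (\<integral>\<^sup>+y. ennreal (norm (f x y)) \<partial>zcount) \<partial>zcount)
      = (\<integral>\<^sup>+z. ennreal (norm (case_prod f z)) \<partial>(zcount \<Otimes>\<^sub>M zcount))"
    using sigma_finite_measure.nn_integral_fst[OF sigma_finite_zcount meas, of "\<lambda>z. ennreal (norm (case_prod f z))"] by simp
  with assms have "integrable (zcount \<Otimes>\<^sub>M zcount) (case_prod f)"
    by (intro integrableI_bounded meas) simp
  then show ?thesis by (rule Fubini_integral[symmetric])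
qed

lemma suminf_ennreal_split_head:
  fixes e :: "nat \<Rightarrow> ennreal"
  shows "suminf e = e 0 + (\<Sum>n. e (Suc n))"
  using suminf_offset[of e 1] by simp

lemma integral_zcount_single:
  fixes f :: "int \<Rightarrow> 'a::{banach, second_countable_topology}"
  shows "(\<integral>j. (if j = k then f j else 0) \<partial>zcount) = f k"
proof -
  have eq: "{a. a \<in> UNIV \<and> (if a = k then f a else 0) \<noteq> 0} = (if f k = 0 then {} else {k})"
    by auto
  show ?thesis
    by (subst lebesgue_integral_count_space_finite_support) (unfold eq, auto)
qed

section \<open>Theta coefficients and their tails\<close>

definition theta_coeff :: "int \<Rightarrow> real" where
  "theta_coeff n = (if even n then 1 else - 1) * exp (- pi * (of_int n * (of_int n - 1)))"

text \<open>The Laurent coefficients of D(x) = Theta(x)/(x - 1): the recurrence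
  \<open>dual_coeff_rec\<close> is (x - 1) D(x) = Theta(x) read coefficientwise. Starting the tail
  at j + 1 makes the sequence even in j.\<close>

definition dual_coeff :: "int \<Rightarrow> real" where
  "dual_coeff j = (\<Sum>i. theta_coeff (j + 1 + int i))"

lemma theta_coeff_reflect: "theta_coeff (1 - n) = - theta_coeff n"
  by (simp add: theta_coeff_def algebra_simps)

text \<open>Completing the square: - n(n - 1) + 2kn = (k + 1/2)^2 - (n - (k + 1/2))^2.\<close>

lemma theta_coeff_exp_le:
  "\<bar>theta_coeff n * exp (2 * pi * of_int k * of_int n)\<bar>
     \<le> exp (pi * (of_int k + 1/2)\<^sup>2) / (1 + (- (of_int k + 1/2) + 1 * of_int n)\<^sup>2)"
proof -
  have "\<bar>theta_coeff n * exp (2 * pi * of_int k * of_int n)\<bar>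
      = exp (pi * (of_int k + 1/2)\<^sup>2) * exp (- (pi * (- (of_int k + 1/2) + 1 * of_int n)\<^sup>2))"
    by (simp add: theta_coeff_def abs_mult flip: exp_add) (simp add: power2_eq_square algebra_simps)
  also have "\<dots> \<le> exp (pi * (of_int k + 1/2)\<^sup>2) * (1 / (1 + (- (of_int k + 1/2) + 1 * of_int n)\<^sup>2))"
    by (intro mult_left_mono gauss_le_cauchy) simp
  finally show ?thesis by simp
qed

lemma integrable_theta_coeff_exp:
  "integrable zcount (\<lambda>n. theta_coeff n * exp (2 * pi * of_int k * of_int n))"
  by (rule integrable_zcountI[where d=1 and C="exp (pi * (of_int k + 1/2)\<^sup>2)" and x="- (of_int k + 1/2)"])
     (use theta_coeff_exp_le in \<open>auto simp del: abs_mult\<close>)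

lemma summable_theta_coeff: "summable (\<lambda>i. theta_coeff (j + int i))"
proof -
  have "integrable zcount theta_coeff"
    using integrable_theta_coeff_exp[of 0] by simp
  then have "integrable zcount (\<lambda>n. theta_coeff (n + j))"
    by (simp add: integrable_zcount_shift)
  from integrable_zcount_imp_summable[OF this] show ?thesis
    by (subst add.commute) (rule summable_norm_cancel)
qed

lemma dual_coeff_rec: "dual_coeff (j - 1) = theta_coeff j + dual_coeff j"
  using suminf_split_head[OF summable_theta_coeff[of j]]
  by (simp add: dual_coeff_def algebra_simps)

text \<open>The full theta sum at x = 1 cancels under n -> 1 - n, so a tail is also minus the
  complementary head; this is why the tails are small at negative j too, although they then contain
  the largest theta coefficients. The induction extracts it from the recurrence and the
  reflection.\<close>

lemma dual_coeff_minus: "dual_coeff (- j) = dual_coeff j"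
proof (induction j rule: int_induct[where k=0])
  case (step1 i)
  have "dual_coeff (- (i + 1)) = theta_coeff (- i) + dual_coeff (- i)"
    using dual_coeff_rec[of "- i"] by simp
  moreover have "dual_coeff i = theta_coeff (i + 1) + dual_coeff (i + 1)"
    using dual_coeff_rec[of "i + 1"] by simp
  moreover have "theta_coeff (- i) = - theta_coeff (i + 1)"
    using theta_coeff_reflect[of "i + 1"] by simp
  ultimately show ?case using step1 by simp
next
  case (step2 i)
  have "dual_coeff (- i) = theta_coeff (1 - i) + dual_coeff (- (i - 1))"
    using dual_coeff_rec[of "1 - i"] by simp
  moreover have "dual_coeff (i - 1) = theta_coeff i + dual_coeff i"
    by (rule dual_coeff_rec)
  ultimately show ?case using step2 theta_coeff_reflect[of i] by simp
qed simp

lemma exp_minus_2pi_le: "exp (- (2 * pi)) \<le> 1 / 7"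
proof -
  have "exp (- (2 * pi)) \<le> 1 / (1 + 2 * pi)" by (rule exp_neg_le_inverse) simp
  also have "\<dots> \<le> 1 / 7" using pi_gt3 by (intro divide_left_mono) auto
  finally show ?thesis .
qed

lemma exp_minus_2pi_power_le: "exp (- (2 * pi * real i)) \<le> (1 / 7) ^ i"
proof -
  have "exp (- (2 * pi * real i)) = exp (- (2 * pi)) ^ i"
    by (simp flip: exp_of_nat_mult add: algebra_simps)
  also have "\<dots> \<le> (1 / 7) ^ i" by (intro power_mono exp_minus_2pi_le) simp
  finally show ?thesis .
qed

text \<open>The tail is dominated by its leading term, of size e^{-pi j(j + 1)}; the further terms
  decay at least geometrically with ratio e^{-2 pi} <= 1/7, which gives 7/6 = 1/(1 - 1/7). The
  linear part |j| of the exponent must be kept: it later compensates for rounding t/a to an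
  integer.\<close>

lemma dual_coeff_bound: "\<bar>dual_coeff j\<bar> \<le> 7 / 6 * exp (- pi * ((of_int j)\<^sup>2 + \<bar>of_int j\<bar>))"
proof -
  have pos: "\<bar>dual_coeff j\<bar> \<le> 7 / 6 * exp (- pi * ((of_int j)\<^sup>2 + of_int j))" if j: "0 \<le> j" for j
  proof -
    let ?E = "exp (- pi * ((of_int j)\<^sup>2 + of_int j))"
    have le: "norm (theta_coeff (j + 1 + int i)) \<le> ?E * (1 / 7) ^ i" for i
    proof -
      have "real i \<le> real i * real i"
        by (cases i) (auto simp: algebra_simps)
      moreover have "0 \<le> of_int j * real i" using j by simp
      ultimately have "(of_int j)\<^sup>2 + of_int j + 2 * real i
          \<le> (of_int j + 1 + real i) * (of_int j + 1 + real i - 1)"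
        by (simp add: power2_eq_square algebra_simps)
      then have "exp (- pi * ((of_int j + 1 + real i) * (of_int j + 1 + real i - 1)))
          \<le> exp (- pi * ((of_int j)\<^sup>2 + of_int j + 2 * real i))"
        by simp
      also have "\<dots> = ?E * exp (- (2 * pi * real i))"
        by (simp flip: exp_add add: algebra_simps)
      also have "\<dots> \<le> ?E * (1 / 7) ^ i"
        by (intro mult_left_mono exp_minus_2pi_power_le) simp
      finally show ?thesis by (simp add: theta_coeff_def abs_mult)
    qed
    have sm: "summable (\<lambda>i. ?E * (1 / 7 :: real) ^ i)"
      by (intro summable_mult summable_geometric) simp
    have "\<bar>dual_coeff j\<bar> \<le> (\<Sum>i. ?E * (1 / 7) ^ i)"
      unfolding dual_coeff_def
      using norm_suminf_le[OF le sm] by simp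
    also have "\<dots> = ?E * (\<Sum>i. (1 / 7) ^ i)"
      by (intro suminf_mult summable_geometric) simp
    also have "\<dots> = 7 / 6 * ?E"
      by (simp add: suminf_geometric)
    finally show ?thesis .
  qed
  show ?thesis
  proof (cases "0 \<le> j")
    case True then show ?thesis using pos[of j] by simp
  next
    case False then show ?thesis using pos[of "- j"] by (simp add: dual_coeff_minus)
  qed
qed

lemma integrable_dual_coeff_exp:
  "integrable zcount (\<lambda>j. dual_coeff j * exp (2 * pi * of_int k * of_int j))"
proof (rule integrable_zcountI[where d=1 and C="7 / 6 * exp (pi * (of_int k)\<^sup>2)" and x="- of_int k"])
  fix j :: int
  have "norm (dual_coeff j * exp (2 * pi * of_int k * of_int j))
      \<le> 7 / 6 * exp (- pi * ((of_int j)\<^sup>2 + \<bar>of_int j\<bar>)) * exp (2 * pi * of_int k * of_int j)"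
    using dual_coeff_bound[of j] by (simp add: abs_mult)
  also have "\<dots> \<le> 7 / 6 * exp (- pi * (of_int j)\<^sup>2) * exp (2 * pi * of_int k * of_int j)"
    by (intro mult_left_mono mult_right_mono) auto
  also have "\<dots> = 7 / 6 * exp (pi * (of_int k)\<^sup>2) * exp (- (pi * (- of_int k + 1 * of_int j)\<^sup>2))"
    by (simp flip: exp_add) (simp add: power2_eq_square algebra_simps)
  also have "\<dots> \<le> 7 / 6 * exp (pi * (of_int k)\<^sup>2) * (1 / (1 + (- of_int k + 1 * of_int j)\<^sup>2))"
    by (intro mult_left_mono gauss_le_cauchy) simp
  finally show "norm (dual_coeff j * exp (2 * pi * of_int k * of_int j))
      \<le> 7 / 6 * exp (pi * (of_int k)\<^sup>2) / (1 + (- of_int k + 1 * of_int j)\<^sup>2)"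
    by simp
qed auto

text \<open>The reflection n -> 2k + 1 - n fixes the centre k + 1/2 of the completed square and
  changes the parity of n, so the terms cancel in pairs: Theta has a zero at e^{2 pi k}.\<close>

lemma integral_theta_coeff_exp:
  "(\<integral>n. theta_coeff n * exp (2 * pi * of_int k * of_int n) \<partial>zcount) = 0"
proof -
  let ?f = "\<lambda>n. theta_coeff n * exp (2 * pi * of_int k * of_int n)"
  have refl: "?f (2 * k + 1 - n) = - ?f n" for n
    by (simp add: theta_coeff_def flip: exp_add) (simp add: power2_eq_square algebra_simps)
  have "(\<integral>n. ?f n \<partial>zcount) = (\<integral>n. ?f (2 * k + 1 - n) \<partial>zcount)"
    by (rule integral_bij_count_space[symmetric], rule bij_betwI[where g="\<lambda>n. 2 * k + 1 - n"]) auto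
  also have "\<dots> = - (\<integral>n. ?f n \<partial>zcount)"
    unfolding refl by simp
  finally show ?thesis by simp
qed

text \<open>Multiplying by the node x = e^{2 pi k} shifts the index by one, and the recurrence turns
  this into (x - 1) D(x) = Theta(x) = 0. For nonzero k the factor x - 1 can be cancelled.\<close>

lemma integral_dual_coeff_exp_eq_0:
  assumes "k \<noteq> 0"
  shows "(\<integral>j. dual_coeff j * exp (2 * pi * of_int k * of_int j) \<partial>zcount) = 0"
proof -
  let ?S = "\<integral>j. dual_coeff j * exp (2 * pi * of_int k * of_int j) \<partial>zcount"
  have "exp (2 * pi * of_int k) * ?S
      = (\<integral>j. exp (2 * pi * of_int k) * (dual_coeff j * exp (2 * pi * of_int k * of_int j)) \<partial>zcount)"
    by simp
  also have "\<dots> = (\<integral>j. dual_coeff ((j + 1) - 1) * exp (2 * pi * of_int k * of_int (j + 1)) \<partial>zcount)"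
    by (intro Bochner_Integration.integral_cong) (auto simp: exp_add algebra_simps)
  also have "\<dots> = (\<integral>j. dual_coeff (j - 1) * exp (2 * pi * of_int k * of_int j) \<partial>zcount)"
    by (rule integral_zcount_shift)
  also have "\<dots> = (\<integral>j. theta_coeff j * exp (2 * pi * of_int k * of_int j)
      + dual_coeff j * exp (2 * pi * of_int k * of_int j) \<partial>zcount)"
    by (simp add: dual_coeff_rec algebra_simps)
  also have "\<dots> = ?S"
    by (subst Bochner_Integration.integral_add)
       (simp_all add: integrable_theta_coeff_exp integrable_dual_coeff_exp integral_theta_coeff_exp)
  finally have "(exp (2 * pi * of_int k) - 1) * ?S = 0" by (simp add: algebra_simps)
  moreover have "exp (2 * pi * of_int k) \<noteq> 1" using assms by simp
  ultimately show ?thesis by simp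
qed

definition dual_const :: real where
  "dual_const = (\<integral>j. dual_coeff j \<partial>zcount)"

text \<open>The value D(1) at the zero that was divided out must not vanish, since it is the
  diagonal of the left inverse. It is dominated by the central coefficient:
  \<open>dual_coeff 0\<close> is at most -1 + 1/6, and all others together contribute at most 7/18
  in absolute value.\<close>

lemma dual_const_neg: "dual_const < 0"
proof -
  have int: "integrable zcount dual_coeff"
    using integrable_dual_coeff_exp[of 0] by simp
  let ?r = "\<lambda>j. if j = 0 then 0 else dual_coeff j"
  have int_r: "integrable zcount ?r"
    by (rule Bochner_Integration.integrable_bound[OF int]) auto
  have "dual_const = (\<integral>j. (if j = 0 then dual_coeff j else 0) + ?r j \<partial>zcount)"
    unfolding dual_const_def by (intro Bochner_Integration.integral_cong) auto
  also have "\<dots> = (\<integral>j. (if j = 0 then dual_coeff j else 0) \<partial>zcount) + (\<integral>j. ?r j \<partial>zcount)"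
    by (intro Bochner_Integration.integral_add int_r Bochner_Integration.integrable_bound[OF int]) auto
  also have "(\<integral>j. (if j = 0 then dual_coeff j else 0) \<partial>zcount) = dual_coeff 0"
    by (rule integral_zcount_single)
  finally have split: "dual_const = dual_coeff 0 + (\<integral>j. ?r j \<partial>zcount)" .
  have term_le: "\<bar>dual_coeff j\<bar> \<le> 7 / 6 * (1 / 7) ^ n" if "\<bar>j\<bar> = int n" "n \<noteq> 0" for j n
  proof -
    have "\<bar>real_of_int j\<bar> = real n" using that by linarith
    then have sq: "(real_of_int j)\<^sup>2 = (real n)\<^sup>2" by (metis power2_abs)
    have "real n \<le> (real n)\<^sup>2" using that(2) by (simp add: power2_eq_square)
    then have "exp (- pi * ((of_int j)\<^sup>2 + \<bar>of_int j\<bar>)) \<le> exp (- (2 * pi * real n))"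
      using \<open>\<bar>real_of_int j\<bar> = real n\<close> sq by simp
    also have "\<dots> \<le> (1 / 7) ^ n" by (rule exp_minus_2pi_power_le)
    finally show ?thesis using dual_coeff_bound[of j] by linarith
  qed
  \<comment> \<open>For |j| = n >= 1 the exponent satisfies j^2 + |j| >= 2n, so each half line is
    dominated by a geometric series with total (7/6)(1/6).\<close>
  have geo: "(\<Sum>n. ennreal (7 / 6 * (1 / 7) ^ Suc n)) = ennreal (7 / 36)"
  proof (rule suminf_ennreal_eq)
    have "(\<lambda>n. 1 / 6 * (1 / 7 :: real) ^ n) sums (1 / 6 * (1 / (1 - 1 / 7)))"
      by (intro sums_mult geometric_sums) simp
    then show "(\<lambda>n. 7 / 6 * (1 / 7 :: real) ^ Suc n) sums (7 / 36)" by simp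
  qed simp
  have "ennreal \<bar>\<integral>j. ?r j \<partial>zcount\<bar> \<le> (\<integral>\<^sup>+j. ennreal \<bar>?r j\<bar> \<partial>zcount)"
    using integral_norm_bound_ennreal[OF int_r] by simp
  also have "\<dots> = (\<Sum>n. ennreal \<bar>?r (int (Suc n))\<bar>) + (\<Sum>n. ennreal \<bar>?r (- int (Suc n))\<bar>)"
    unfolding nn_integral_zcount_split
    by (subst suminf_ennreal_split_head[of "\<lambda>n. ennreal \<bar>?r (int n)\<bar>"]) simp
  also have "\<dots> \<le> (\<Sum>n. ennreal (7 / 6 * (1 / 7) ^ Suc n)) + (\<Sum>n. ennreal (7 / 6 * (1 / 7) ^ Suc n))"
  proof (intro add_mono suminf_le ennreal_leI)
    fix n
    show "\<bar>?r (int (Suc n))\<bar> \<le> 7 / 6 * (1 / 7) ^ Suc n"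
      using term_le[of "int (Suc n)" "Suc n"] by simp
    show "\<bar>?r (- int (Suc n))\<bar> \<le> 7 / 6 * (1 / 7) ^ Suc n"
      using term_le[of "- int (Suc n)" "Suc n"] by simp
  qed auto
  also have "\<dots> = ennreal (7 / 18)"
    unfolding geo by (simp flip: ennreal_plus)
  finally have "\<bar>\<integral>j. ?r j \<partial>zcount\<bar> \<le> 7 / 18" by simp
  moreover have "dual_coeff 0 = - 1 + dual_coeff 1"
    using dual_coeff_rec[of 1] by (simp add: theta_coeff_def)
  moreover have "\<bar>dual_coeff 1\<bar> \<le> 1 / 6" using term_le[of 1 1] by simp
  ultimately show ?thesis using split by linarith
qed

section \<open>Discrete frame inequalities on a fibre\<close>

text \<open>A Bochner integral that does not converge has the value 0, for which the bound is
  trivial. Upper estimates of samples therefore hold for every coefficient sequence.\<close>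

lemma norm_integral_le_nn_integral:
  fixes f :: "'b \<Rightarrow> 'a::{banach, second_countable_topology}"
  shows "ennreal (norm (\<integral>x. f x \<partial>M)) \<le> (\<integral>\<^sup>+x. ennreal (norm (f x)) \<partial>M)"
  by (cases "integrable M f") (auto simp: not_integrable_integral_eq intro: integral_norm_bound_ennreal)

lemma cmod_gaussian: "cmod (gaussian x) = exp (- (pi * x\<^sup>2))"
  by (simp add: gaussian_def)

lemma gaussian_samples_le:
  assumes "d > 0"
  shows "(\<integral>\<^sup>+k. ennreal (cmod (gaussian (x + d * of_int k))) \<partial>zcount) \<le> ennreal (1 + 8 / d)"
proof -
  have "(\<integral>\<^sup>+k. ennreal (cmod (gaussian (x + d * of_int k))) \<partial>zcount)
      \<le> (\<integral>\<^sup>+k. ennreal (1 / (1 + (x + d * of_int k)\<^sup>2)) \<partial>zcount)"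
    unfolding cmod_gaussian by (intro nn_integral_mono ennreal_leI gauss_le_cauchy)
  also have "\<dots> \<le> ennreal (1 + 8 / d)"
    by (rule nn_integral_zcount_shifted_cauchy_le[OF assms])
  finally show ?thesis .
qed

lemma gaussian_row_le:
  assumes "0 < a" "a \<le> 1"
  shows "(\<integral>\<^sup>+k. ennreal (cmod (gaussian (t + of_int k / a - a * of_int m))) \<partial>zcount) \<le> ennreal 9"
proof -
  have "(\<integral>\<^sup>+k. ennreal (cmod (gaussian (t + of_int k / a - a * of_int m))) \<partial>zcount)
      = (\<integral>\<^sup>+k. ennreal (cmod (gaussian ((t - a * of_int m) + (1 / a) * of_int k))) \<partial>zcount)"
    by (simp add: algebra_simps)
  also have "\<dots> \<le> ennreal (1 + 8 / (1 / a))"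
    using assms by (intro gaussian_samples_le) simp
  also have "\<dots> \<le> ennreal 9"
    using assms by (intro ennreal_leI) simp
  finally show ?thesis .
qed

lemma gaussian_column_le:
  assumes "1 / 2 < a"
  shows "(\<integral>\<^sup>+m. ennreal (cmod (gaussian (t + of_int k / a - a * of_int m))) \<partial>zcount) \<le> ennreal 17"
proof -
  have "(\<integral>\<^sup>+m. ennreal (cmod (gaussian (t + of_int k / a - a * of_int m))) \<partial>zcount)
      = (\<integral>\<^sup>+m. ennreal (cmod (gaussian (- (t + of_int k / a) + a * of_int m))) \<partial>zcount)"
    by (simp add: gaussian_def power2_eq_square algebra_simps)
  also have "\<dots> \<le> ennreal (1 + 8 / a)"
    using assms by (intro gaussian_samples_le) simp
  also have "\<dots> \<le> ennreal 17"
    using assms by (intro ennreal_leI) (simp add: field_simps)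
  finally show ?thesis .
qed

definition fibre_sample :: "real \<Rightarrow> real \<Rightarrow> (int \<Rightarrow> complex) \<Rightarrow> int \<Rightarrow> complex" where
  "fibre_sample a t c m = (\<integral>k. c k * gaussian (t + of_int k / a - a * of_int m) \<partial>zcount)"

text \<open>The constant 153 = 9 * 17 is the product of the row bound 1 + 8a <= 9 and the column
  bound 1 + 8/a <= 17.\<close>

lemma fibre_sample_upper:
  assumes a: "1 / 2 < a" "a \<le> 1"
  shows "(\<integral>\<^sup>+m. ennreal ((cmod (fibre_sample a t c m))\<^sup>2) \<partial>zcount)
           \<le> ennreal 153 * (\<integral>\<^sup>+k. ennreal ((cmod (c k))\<^sup>2) \<partial>zcount)"
proof -
  let ?K = "\<lambda>m k. cmod (gaussian (t + of_int k / a - a * of_int m))"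
  have "(\<integral>\<^sup>+m. ennreal ((cmod (fibre_sample a t c m))\<^sup>2) \<partial>zcount)
      \<le> (\<integral>\<^sup>+m. (\<integral>\<^sup>+k. ennreal (?K m k) * ennreal (cmod (c k)) \<partial>zcount)\<^sup>2 \<partial>zcount)"
  proof (rule nn_integral_mono)
    fix m
    have "ennreal (cmod (fibre_sample a t c m))
        \<le> (\<integral>\<^sup>+k. ennreal (?K m k) * ennreal (cmod (c k)) \<partial>zcount)"
      unfolding fibre_sample_def
      by (rule order_trans[OF norm_integral_le_nn_integral])
         (simp add: norm_mult mult.commute flip: ennreal_mult)
    then show "ennreal ((cmod (fibre_sample a t c m))\<^sup>2)
        \<le> (\<integral>\<^sup>+k. ennreal (?K m k) * ennreal (cmod (c k)) \<partial>zcount)\<^sup>2"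
      by (simp flip: ennreal_power add: power_mono)
  qed
  also have "\<dots> \<le> ennreal 9 * ennreal 17 * (\<integral>\<^sup>+k. (ennreal (cmod (c k)))\<^sup>2 \<partial>zcount)"
    by (intro schur_test gaussian_row_le gaussian_column_le) (use a in auto)
  also have "ennreal 9 * ennreal 17 = ennreal 153"
    by (simp flip: ennreal_mult)
  finally show ?thesis by (simp add: ennreal_power)
qed

text \<open>
  The dual samples are re-centred at the lattice point nearest to \<open>t\<close>, which is what keeps
  them bounded by a Gaussian of width $(1 - a^2)^{-1/2}$ uniformly in \<open>t\<close>.
\<close>

definition dual_kernel :: "real \<Rightarrow> real \<Rightarrow> int \<Rightarrow> real" where
  "dual_kernel a t m = dual_coeff (m - round (t / a)) * exp (pi * (a * of_int m - t)\<^sup>2)"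

text \<open>The factor e^{pi (am - t)^2} in the kernel cancels the part of the Gaussian exponent
  that is quadratic in m, and what depends on m in the remainder is e^{2 pi l m}. The sum is thus D
  evaluated at the node e^{2 pi l}, up to the factor \<open>E\<close>, which collects everything
  free of m and equals 1 for l = 0.\<close>

lemma dual_kernel_biorthogonal:
  assumes a: "0 < a"
  shows "(\<integral>m. dual_kernel a t m * exp (- (pi * (t + of_int l / a - a * of_int m)\<^sup>2)) \<partial>zcount)
           = (if l = 0 then dual_const else 0)"
proof -
  define r where "r = round (t / a)"
  define E where "E = exp (2 * pi * of_int l * of_int r - pi * (of_int l / a)\<^sup>2 - 2 * pi * of_int l * t / a)"
  let ?f = "\<lambda>m. dual_kernel a t m * exp (- (pi * (t + of_int l / a - a * of_int m)\<^sup>2))"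
  have "?f (j + r) = E * (dual_coeff j * exp (2 * pi * of_int l * of_int j))" for j
  proof -
    have "exp (pi * (a * of_int (j + r) - t)\<^sup>2) * exp (- (pi * (t + of_int l / a - a * of_int (j + r))\<^sup>2))
        = E * exp (2 * pi * of_int l * of_int j)"
      unfolding E_def using a
      by (simp flip: exp_add) (simp add: power2_eq_square field_simps)
    then show ?thesis
      by (simp add: dual_kernel_def r_def)
  qed
  then have "(\<integral>m. ?f m \<partial>zcount) = (\<integral>j. E * (dual_coeff j * exp (2 * pi * of_int l * of_int j)) \<partial>zcount)"
    by (subst integral_zcount_shift[of ?f r, symmetric]) simp
  also have "\<dots> = E * (\<integral>j. dual_coeff j * exp (2 * pi * of_int l * of_int j) \<partial>zcount)"
    by simp
  also have "\<dots> = (if l = 0 then dual_const else 0)"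
  proof (cases "l = 0")
    case True
    then have "E = 1" by (simp add: E_def)
    with True show ?thesis by (simp add: dual_const_def)
  next
    case False
    then show ?thesis by (simp add: integral_dual_coeff_exp_eq_0)
  qed
  finally show ?thesis .
qed

text \<open>7/6 comes from \<open>dual_coeff_bound\<close>; e^{pi/4} is the bounded part of the loss
  by rounding, whose offset has square at most 1/4.\<close>

definition dual_amp :: real where
  "dual_amp = 7 / 6 * exp (pi / 4)"

lemma dual_amp_pos: "dual_amp > 0"
  by (simp add: dual_amp_def)

text \<open>With x = m - round(t/a) and rounding error \<delta>, the growing factor has exponent pi
  a^2 (x + \<delta>)^2, and (x + \<delta>)^2 <= x^2 + |x| + 1/4. The decay e^{-pi (x^2 + |x|)} of
  the tails absorbs x^2 and |x| alike, so the factor a^2 < 1 leaves a net gain of e^{-pi (1 - a^2)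
  x^2}.\<close>

lemma dual_kernel_bound:
  assumes a: "0 < a" "a < 1"
  shows "\<bar>dual_kernel a t m\<bar>
           \<le> dual_amp * (1 / (1 + (sqrt (1 - a\<^sup>2) * of_int (m - round (t / a)))\<^sup>2))"
proof -
  define j where "j = m - round (t / a)"
  define x where "x = real_of_int j"
  define \<delta> where "\<delta> = of_int (round (t / a)) - t / a"
  have a2: "a\<^sup>2 < 1" using a by (simp add: power2_less_1_iff abs_if)
  have \<delta>: "\<bar>\<delta>\<bar> \<le> 1 / 2"
    unfolding \<delta>_def by (rule of_int_round_abs_le)
  have am: "a * of_int m - t = a * (x + \<delta>)"
    using a by (simp add: x_def j_def \<delta>_def field_simps)
  have "\<bar>2 * x * \<delta>\<bar> \<le> \<bar>x\<bar>"
    using mult_left_mono[OF \<delta>, of "2 * \<bar>x\<bar>"] by (simp add: abs_mult)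
  moreover have "\<delta>\<^sup>2 \<le> 1 / 4"
    using power_mono[OF \<delta>, of 2] by (simp add: power2_eq_square)
  ultimately have sq: "(x + \<delta>)\<^sup>2 \<le> x\<^sup>2 + \<bar>x\<bar> + 1 / 4"
    by (simp add: power2_eq_square algebra_simps)
  have "(a * (x + \<delta>))\<^sup>2 \<le> a\<^sup>2 * (x\<^sup>2 + \<bar>x\<bar> + 1 / 4)"
    unfolding power_mult_distrib by (intro mult_left_mono sq) simp
  also have "\<dots> \<le> x\<^sup>2 + \<bar>x\<bar> + 1 / 4 - (1 - a\<^sup>2) * x\<^sup>2"
  proof -
    have "a\<^sup>2 * (\<bar>x\<bar> + 1 / 4) \<le> 1 * (\<bar>x\<bar> + 1 / 4)"
      using a2 by (intro mult_right_mono) auto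
    then show ?thesis by (simp add: algebra_simps)
  qed
  finally have ex: "(a * (x + \<delta>))\<^sup>2 \<le> x\<^sup>2 + \<bar>x\<bar> + 1 / 4 - (1 - a\<^sup>2) * x\<^sup>2" .
  have "\<bar>dual_kernel a t m\<bar> = \<bar>dual_coeff j\<bar> * exp (pi * (a * (x + \<delta>))\<^sup>2)"
    by (simp add: dual_kernel_def j_def am abs_mult)
  also have "\<dots> \<le> 7 / 6 * exp (- pi * (x\<^sup>2 + \<bar>x\<bar>))
      * exp (pi * (x\<^sup>2 + \<bar>x\<bar> + 1 / 4 - (1 - a\<^sup>2) * x\<^sup>2))"
    using dual_coeff_bound[of j] ex unfolding x_def by (intro mult_mono) auto
  also have "\<dots> = dual_amp * exp (- (pi * (sqrt (1 - a\<^sup>2) * x)\<^sup>2))"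
    using a2 by (simp add: dual_amp_def power_mult_distrib flip: exp_add) (simp add: algebra_simps)
  also have "\<dots> \<le> dual_amp * (1 / (1 + (sqrt (1 - a\<^sup>2) * x)\<^sup>2))"
    by (intro mult_left_mono gauss_le_cauchy) (simp add: dual_amp_def)
  finally show ?thesis by (simp add: x_def j_def)
qed

lemma nn_integral_zcount_inj_le:
  assumes "inj \<phi>"
  shows "(\<integral>\<^sup>+k. f (\<phi> k) \<partial>zcount) \<le> (\<integral>\<^sup>+j. f j \<partial>zcount)"
proof -
  have "(\<integral>\<^sup>+k. f (\<phi> k) \<partial>zcount) = (\<integral>\<^sup>+j. f j \<partial>count_space (range \<phi>))"
    by (rule nn_integral_bij_count_space) (simp add: bij_betw_def assms)
  also have "\<dots> = (\<integral>\<^sup>+j. f j * indicator (range \<phi>) j \<partial>zcount)"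
    by (simp add: nn_integral_count_space_indicator)
  also have "\<dots> \<le> (\<integral>\<^sup>+j. f j \<partial>zcount)"
    by (intro nn_integral_mono) (auto split: split_indicator)
  finally show ?thesis .
qed

lemma dual_profile_sum_le:
  assumes a: "0 < a" "a < 1"
  shows "(\<integral>\<^sup>+j. ennreal (dual_amp * (1 / (1 + (sqrt (1 - a\<^sup>2) * of_int j)\<^sup>2))) \<partial>zcount)
           \<le> ennreal (5 * dual_amp / sqrt (1 - a\<^sup>2))"
proof -
  define s where "s = sqrt (1 - a\<^sup>2)"
  have s: "0 < s" "s \<le> 1"
    using a by (auto simp: s_def power2_less_1_iff abs_if)
  have "(\<integral>\<^sup>+j. ennreal (dual_amp * (1 / (1 + (s * of_int j)\<^sup>2))) \<partial>zcount)
      = (\<integral>\<^sup>+j. ennreal dual_amp * ennreal (1 / (1 + (s * of_int j)\<^sup>2)) \<partial>zcount)"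
    using dual_amp_pos by (subst ennreal_mult) auto
  also have "\<dots> = ennreal dual_amp * (\<integral>\<^sup>+j. ennreal (1 / (1 + (s * of_int j)\<^sup>2)) \<partial>zcount)"
    by (rule nn_integral_cmult) simp
  also have "\<dots> \<le> ennreal dual_amp * ennreal (1 + 4 / s)"
    by (intro mult_left_mono nn_integral_zcount_cauchy_le s) simp
  also have "\<dots> = ennreal (dual_amp * (1 + 4 / s))"
    using dual_amp_pos s by (subst ennreal_mult) auto
  also have "\<dots> \<le> ennreal (5 * dual_amp / s)"
  proof (rule ennreal_leI)
    have "1 + 4 / s \<le> 5 / s" using s by (simp add: field_simps)
    then show "dual_amp * (1 + 4 / s) \<le> 5 * dual_amp / s"
      using mult_left_mono[of "1 + 4 / s" "5 / s" dual_amp] dual_amp_pos by simp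
  qed
  finally show ?thesis by (simp add: s_def)
qed

lemma dual_kernel_row_le:
  assumes a: "0 < a" "a < 1"
  shows "(\<integral>\<^sup>+m. ennreal \<bar>dual_kernel a t m\<bar> \<partial>zcount) \<le> ennreal (5 * dual_amp / sqrt (1 - a\<^sup>2))"
proof -
  let ?F = "\<lambda>j. ennreal (dual_amp * (1 / (1 + (sqrt (1 - a\<^sup>2) * of_int j)\<^sup>2)))"
  have "(\<integral>\<^sup>+m. ennreal \<bar>dual_kernel a t m\<bar> \<partial>zcount) \<le> (\<integral>\<^sup>+m. ?F (m - round (t / a)) \<partial>zcount)"
    by (intro nn_integral_mono ennreal_leI dual_kernel_bound a)
  also have "\<dots> \<le> (\<integral>\<^sup>+j. ?F j \<partial>zcount)"
    by (rule nn_integral_zcount_inj_le) (simp add: inj_def)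
  also have "\<dots> \<le> ennreal (5 * dual_amp / sqrt (1 - a\<^sup>2))"
    by (rule dual_profile_sum_le[OF a])
  finally show ?thesis .
qed

text \<open>Before rounding, the centres for consecutive k lie 1/a^2 >= 1 apart, so after rounding
  they are distinct. The sum over k is then a subsum of the profile over all integers, and the
  columns obey the same bound as the rows. This is where the density of the lattice enters.\<close>

lemma dual_kernel_column_le:
  assumes a: "0 < a" "a < 1"
  shows "(\<integral>\<^sup>+k. ennreal \<bar>dual_kernel a (t + of_int k / a) m\<bar> \<partial>zcount)
           \<le> ennreal (5 * dual_amp / sqrt (1 - a\<^sup>2))"
proof -
  let ?F = "\<lambda>j. ennreal (dual_amp * (1 / (1 + (sqrt (1 - a\<^sup>2) * of_int j)\<^sup>2)))"
  have less: "round ((t + of_int k / a) / a) < round ((t + of_int l / a) / a)" if "k < l" for k l :: int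
  proof -
    have "1 * 1 \<le> (of_int l - of_int k) * (1 / a\<^sup>2)"
      using that a by (intro mult_mono) (auto simp: power_le_one)
    moreover have "(t + of_int l / a) / a = (t + of_int k / a) / a + (of_int l - of_int k) * (1 / a\<^sup>2)"
      using a by (simp add: field_simps power2_eq_square)
    ultimately have "(t + of_int k / a) / a + 1 \<le> (t + of_int l / a) / a"
      by linarith
    then show ?thesis
      unfolding round_def by linarith
  qed
  have "(\<integral>\<^sup>+k. ennreal \<bar>dual_kernel a (t + of_int k / a) m\<bar> \<partial>zcount)
      \<le> (\<integral>\<^sup>+k. ?F (m - round ((t + of_int k / a) / a)) \<partial>zcount)"
    by (intro nn_integral_mono ennreal_leI dual_kernel_bound a)
  also have "\<dots> \<le> (\<integral>\<^sup>+j. ?F j \<partial>zcount)"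
  proof (rule nn_integral_zcount_inj_le, rule injI)
    fix k l assume "m - round ((t + of_int k / a) / a) = m - round ((t + of_int l / a) / a)"
    then show "k = l" using less[of k l] less[of l k] by (cases k l rule: linorder_cases) auto
  qed
  also have "\<dots> \<le> ennreal (5 * dual_amp / sqrt (1 - a\<^sup>2))"
    by (rule dual_profile_sum_le[OF a])
  finally show ?thesis .
qed

text \<open>The k-th row of the left inverse is the dual kernel at the shifted base point t + k/a:
  seen from there, the l-th column of the Gaussian matrix has offset l - k. Exchanging the sums is
  justified because a square-summable c is bounded, while the Gaussian rows and the dual kernel are
  absolutely summable.\<close>

lemma fibre_sample_reconstruction:
  assumes a: "0 < a" "a < 1" and fin: "(\<integral>\<^sup>+k. ennreal ((cmod (c k))\<^sup>2) \<partial>zcount) < \<infinity>"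
  shows "(\<integral>m. of_real (dual_kernel a (t + of_int k / a) m) * fibre_sample a t c m \<partial>zcount)
           = of_real dual_const * c k"
proof -
  let ?B = "\<lambda>m. dual_kernel a (t + of_int k / a) m"
  let ?f = "\<lambda>m l. of_real (?B m) * (c l * gaussian (t + of_int l / a - a * of_int m))"
  obtain X where X: "(\<integral>\<^sup>+k. ennreal ((cmod (c k))\<^sup>2) \<partial>zcount) = ennreal X" "0 \<le> X"
    using fin by (cases "\<integral>\<^sup>+k. ennreal ((cmod (c k))\<^sup>2) \<partial>zcount") auto
  have c_le: "cmod (c l) \<le> sqrt X" for l
  proof -
    have "ennreal ((cmod (c l))\<^sup>2) \<le> ennreal X"
      unfolding X(1)[symmetric] by (rule nn_integral_ge_point) simp
    then show ?thesis using X(2) by (simp add: real_le_rsqrt)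
  qed
  have "(\<integral>\<^sup>+m. (\<integral>\<^sup>+l. ennreal (cmod (?f m l)) \<partial>zcount) \<partial>zcount)
      \<le> (\<integral>\<^sup>+m. ennreal \<bar>?B m\<bar> * (ennreal (sqrt X) * ennreal 9) \<partial>zcount)"
  proof (rule nn_integral_mono)
    fix m
    have "(\<integral>\<^sup>+l. ennreal (cmod (?f m l)) \<partial>zcount)
        \<le> (\<integral>\<^sup>+l. ennreal \<bar>?B m\<bar> * (ennreal (sqrt X)
            * ennreal (cmod (gaussian (t + of_int l / a - a * of_int m)))) \<partial>zcount)"
      by (intro nn_integral_mono)
         (auto simp: norm_mult X(2) c_le simp flip: ennreal_mult intro!: ennreal_leI mult_left_mono mult_right_mono)
    also have "\<dots> = ennreal \<bar>?B m\<bar> * (ennreal (sqrt X)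
        * (\<integral>\<^sup>+l. ennreal (cmod (gaussian (t + of_int l / a - a * of_int m))) \<partial>zcount))"
      by (simp add: nn_integral_cmult)
    also have "\<dots> \<le> ennreal \<bar>?B m\<bar> * (ennreal (sqrt X) * ennreal 9)"
      by (intro mult_left_mono gaussian_row_le) (use a in auto)
    finally show "(\<integral>\<^sup>+l. ennreal (cmod (?f m l)) \<partial>zcount)
        \<le> ennreal \<bar>?B m\<bar> * (ennreal (sqrt X) * ennreal 9)" .
  qed
  also have "\<dots> = (\<integral>\<^sup>+m. ennreal \<bar>?B m\<bar> \<partial>zcount) * (ennreal (sqrt X) * ennreal 9)"
    by (simp add: nn_integral_multc)
  also have "\<dots> < \<infinity>"
    using le_less_trans[OF dual_kernel_row_le[OF a, of "t + of_int k / a"] ennreal_less_top]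
    by (simp add: ennreal_mult_less_top)
  finally have fin': "(\<integral>\<^sup>+m. (\<integral>\<^sup>+l. ennreal (cmod (?f m l)) \<partial>zcount) \<partial>zcount) < \<infinity>" .
  have "(\<integral>m. of_real (?B m) * fibre_sample a t c m \<partial>zcount)
      = (\<integral>m. (\<integral>l. ?f m l \<partial>zcount) \<partial>zcount)"
    by (simp add: fibre_sample_def)
  also have "\<dots> = (\<integral>l. (\<integral>m. ?f m l \<partial>zcount) \<partial>zcount)"
    by (rule integral_zcount_swap[OF fin'])
  also have "\<dots> = (\<integral>l. (if l = k then of_real dual_const * c l else 0) \<partial>zcount)"
  proof (intro Bochner_Integration.integral_cong refl)
    fix l
    have "(\<integral>m. ?f m l \<partial>zcount) = (\<integral>m. c l * of_real (?B m
        * exp (- (pi * ((t + of_int k / a) + of_int (l - k) / a - a * of_int m)\<^sup>2))) \<partial>zcount)"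
      by (intro Bochner_Integration.integral_cong refl) (simp add: gaussian_def diff_divide_distrib)
    also have "\<dots> = c l * of_real (\<integral>m. ?B m
        * exp (- (pi * ((t + of_int k / a) + of_int (l - k) / a - a * of_int m)\<^sup>2)) \<partial>zcount)"
      by (simp only: integral_mult_right_zero integral_complex_of_real)
    also have "\<dots> = c l * of_real (if l - k = 0 then dual_const else 0)"
      by (simp only: dual_kernel_biorthogonal[OF a(1)])
    finally show "(\<integral>m. ?f m l \<partial>zcount) = (if l = k then of_real dual_const * c l else 0)"
      by simp
  qed
  also have "\<dots> = of_real dual_const * c k"
    by (rule integral_zcount_single)
  finally show ?thesis .
qed

text \<open>By Schur's test the left inverse has squared norm at most (5
  \<open>dual_amp\<close>)^2/(1 - a^2), up to the diagonal factor \<open>dual_const\<close>. The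
  inequality is kept multiplied out, so that no quotients of extended reals occur.\<close>

lemma fibre_sample_lower:
  assumes a: "0 < a" "a < 1" and fin: "(\<integral>\<^sup>+k. ennreal ((cmod (c k))\<^sup>2) \<partial>zcount) < \<infinity>"
  shows "ennreal (dual_const\<^sup>2 * (1 - a\<^sup>2)) * (\<integral>\<^sup>+k. ennreal ((cmod (c k))\<^sup>2) \<partial>zcount)
           \<le> ennreal (25 * dual_amp\<^sup>2) * (\<integral>\<^sup>+m. ennreal ((cmod (fibre_sample a t c m))\<^sup>2) \<partial>zcount)"
proof -
  define s where "s = sqrt (1 - a\<^sup>2)"
  have s: "0 < s" "s\<^sup>2 = 1 - a\<^sup>2"
    using a by (auto simp: s_def power2_less_1_iff abs_if power_le_one)
  let ?K = "\<lambda>k m. \<bar>dual_kernel a (t + of_int k / a) m\<bar>"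
  let ?H = "\<integral>\<^sup>+m. ennreal ((cmod (fibre_sample a t c m))\<^sup>2) \<partial>zcount"
  have "ennreal (dual_const\<^sup>2) * (\<integral>\<^sup>+k. ennreal ((cmod (c k))\<^sup>2) \<partial>zcount)
      = (\<integral>\<^sup>+k. ennreal ((cmod (of_real dual_const * c k))\<^sup>2) \<partial>zcount)"
    by (simp add: norm_mult power_mult_distrib ennreal_mult nn_integral_cmult)
  also have "\<dots> \<le> (\<integral>\<^sup>+k. (\<integral>\<^sup>+m. ennreal (?K k m) * ennreal (cmod (fibre_sample a t c m)) \<partial>zcount)\<^sup>2 \<partial>zcount)"
  proof (rule nn_integral_mono)
    fix k
    have "ennreal (cmod (of_real dual_const * c k))
        \<le> (\<integral>\<^sup>+m. ennreal (?K k m) * ennreal (cmod (fibre_sample a t c m)) \<partial>zcount)"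
      unfolding fibre_sample_reconstruction[OF a fin, symmetric, where t=t]
      by (rule order_trans[OF norm_integral_le_nn_integral])
         (simp add: norm_mult flip: ennreal_mult)
    then show "ennreal ((cmod (of_real dual_const * c k))\<^sup>2)
        \<le> (\<integral>\<^sup>+m. ennreal (?K k m) * ennreal (cmod (fibre_sample a t c m)) \<partial>zcount)\<^sup>2"
      using power_mono[of "ennreal (cmod (of_real dual_const * c k))" _ 2] by (simp add: ennreal_power)
  qed
  also have "\<dots> \<le> ennreal (5 * dual_amp / s) * ennreal (5 * dual_amp / s)
      * (\<integral>\<^sup>+m. (ennreal (cmod (fibre_sample a t c m)))\<^sup>2 \<partial>zcount)"
    unfolding s_def by (intro schur_test dual_kernel_row_le dual_kernel_column_le a) auto
  also have "\<dots> = ennreal (25 * dual_amp\<^sup>2 / s\<^sup>2) * ?H"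
    using s dual_amp_pos by (simp add: ennreal_power power2_eq_square flip: ennreal_mult)
  finally have le: "ennreal (dual_const\<^sup>2) * (\<integral>\<^sup>+k. ennreal ((cmod (c k))\<^sup>2) \<partial>zcount)
      \<le> ennreal (25 * dual_amp\<^sup>2 / s\<^sup>2) * ?H" .
  have "ennreal (dual_const\<^sup>2 * (1 - a\<^sup>2)) * (\<integral>\<^sup>+k. ennreal ((cmod (c k))\<^sup>2) \<partial>zcount)
      = ennreal (s\<^sup>2) * (ennreal (dual_const\<^sup>2) * (\<integral>\<^sup>+k. ennreal ((cmod (c k))\<^sup>2) \<partial>zcount))"
    by (simp add: s(2)[symmetric] ennreal_mult mult_ac)
  also have "\<dots> \<le> ennreal (s\<^sup>2) * (ennreal (25 * dual_amp\<^sup>2 / s\<^sup>2) * ?H)"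
    by (intro mult_left_mono le) simp
  also have "\<dots> = ennreal (25 * dual_amp\<^sup>2) * ?H"
    using s(1) by (simp add: mult.assoc[symmetric] flip: ennreal_mult)
  finally show ?thesis .
qed

section \<open>A nearly extremal sequence\<close>

text \<open>A Lipschitz bound whose constant decays in x and y, so that it can be summed over
  translates. The two profiles make it symmetric; the proof works with the point closer to 0, where
  the Gaussian is larger.\<close>

lemma gauss_lipschitz:
  fixes x y \<tau> :: real
  assumes \<tau>: "\<tau> \<ge> 1"
  shows "\<bar>exp (- (pi * \<tau> * x\<^sup>2)) - exp (- (pi * \<tau> * y\<^sup>2))\<bar>
           \<le> 2 * pi * \<tau> * \<bar>x - y\<bar> * (1 / (1 + x\<^sup>2) + 1 / (1 + y\<^sup>2))"
proof -
  have main: "\<bar>exp (- (pi * \<tau> * x\<^sup>2)) - exp (- (pi * \<tau> * y\<^sup>2))\<bar>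
      \<le> 2 * pi * \<tau> * \<bar>x - y\<bar> * (1 / (1 + x\<^sup>2))"
    if le: "\<bar>x\<bar> \<le> \<bar>y\<bar>" for x y :: real
  proof -
    have sq: "x\<^sup>2 \<le> y\<^sup>2" using le by (simp add: abs_le_square_iff)
    \<comment> \<open>Three powers of 1/(1 + x^2) are secured: one pays for the factor 1 + x^2 that
      bounds y^2 - x^2, and one survives as the summable profile.\<close>
    have gx: "exp (- (pi * \<tau> * x\<^sup>2)) \<le> exp (- (3 * x\<^sup>2))"
    proof -
      have "3 * 1 \<le> pi * \<tau>" using pi_gt3 \<tau> by (intro mult_mono) auto
      then have "3 * x\<^sup>2 \<le> pi * \<tau> * x\<^sup>2" by (intro mult_right_mono) auto
      then show ?thesis by simp
    qed
    have cub: "exp (- (3 * x\<^sup>2)) \<le> (1 / (1 + x\<^sup>2)) ^ 3"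
    proof -
      have "exp (- (3 * x\<^sup>2)) = exp (- (x\<^sup>2)) ^ 3"
        by (simp flip: exp_of_nat_mult)
      also have "\<dots> \<le> (1 / (1 + x\<^sup>2)) ^ 3"
        by (intro power_mono exp_neg_le_inverse) auto
      finally show ?thesis .
    qed
    have pos: "1 + x\<^sup>2 \<ge> 1" by simp
    show ?thesis
    proof (cases "\<bar>x - y\<bar> \<le> 1")
      case True
      have "exp (- (pi * \<tau> * x\<^sup>2)) - exp (- (pi * \<tau> * y\<^sup>2))
          = exp (- (pi * \<tau> * x\<^sup>2)) * (1 - exp (- (pi * \<tau> * (y\<^sup>2 - x\<^sup>2))))"
        by (simp add: right_diff_distrib flip: exp_add) 
      also have "\<dots> \<le> exp (- (pi * \<tau> * x\<^sup>2)) * (pi * \<tau> * (y\<^sup>2 - x\<^sup>2))"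
        using exp_ge_add_one_self[of "- (pi * \<tau> * (y\<^sup>2 - x\<^sup>2))"] by (intro mult_left_mono) auto
      also have "\<dots> \<le> (1 / (1 + x\<^sup>2)) ^ 3 * (pi * \<tau> * (\<bar>x - y\<bar> * (2 * (1 + x\<^sup>2))))"
      proof (intro mult_mono)
        show "exp (- (pi * \<tau> * x\<^sup>2)) \<le> (1 / (1 + x\<^sup>2)) ^ 3" using gx cub by linarith
        have "y\<^sup>2 - x\<^sup>2 = (y - x) * (y + x)" by (simp add: power2_eq_square algebra_simps)
        also have "\<dots> \<le> \<bar>x - y\<bar> * \<bar>y + x\<bar>"
          by (metis abs_ge_self abs_minus_commute abs_mult)
        also have "\<dots> \<le> \<bar>x - y\<bar> * (2 * (1 + x\<^sup>2))"
        proof (intro mult_left_mono)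
          have "2 * \<bar>x\<bar> \<le> 1 + x\<^sup>2" using sum_squares_bound[of 1 "\<bar>x\<bar>"] by simp
          moreover have "\<bar>y + x\<bar> \<le> \<bar>x - y\<bar> + 2 * \<bar>x\<bar>" by arith
          moreover have "A \<le> 2 * (1 + x\<^sup>2)"
            if "A \<le> B + C" "B \<le> 1" "C \<le> 1 + x\<^sup>2" for A B C
            using that zero_le_power2[of x] unfolding distrib_left by linarith
          ultimately show "\<bar>y + x\<bar> \<le> 2 * (1 + x\<^sup>2)" using True by blast
        qed simp
        finally show "y\<^sup>2 - x\<^sup>2 \<le> \<bar>x - y\<bar> * (2 * (1 + x\<^sup>2))" .
      qed (use \<tau> sq in auto)
      also have "\<dots> = 2 * pi * \<tau> * \<bar>x - y\<bar> * (1 / (1 + x\<^sup>2))\<^sup>2"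
      proof -
        have "(1 / w) ^ 3 * (p * (q * (2 * w))) = 2 * p * q * (1 / w)\<^sup>2" if "w \<noteq> 0" for w p q :: real
          using that by (simp add: power2_eq_square power3_eq_cube)
        from this[of "1 + x\<^sup>2" "pi * \<tau>" "\<bar>x - y\<bar>"] pos show ?thesis by (simp add: mult.assoc)
      qed
      also have "\<dots> \<le> 2 * pi * \<tau> * \<bar>x - y\<bar> * (1 / (1 + x\<^sup>2))"
        using pos \<tau> by (intro mult_left_mono) (simp_all add: power2_eq_square mult_le_one divide_le_eq)
      moreover have "exp (- (pi * \<tau> * y\<^sup>2)) \<le> exp (- (pi * \<tau> * x\<^sup>2))"
        using sq \<tau> by simp
      ultimately show ?thesis by linarith
    next
      case False
      \<comment> \<open>At distance more than 1 the factor 2 pi \<tau> |x - y| exceeds 1, so the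
        larger Gaussian alone is a sufficient bound.\<close>
      have "\<bar>exp (- (pi * \<tau> * x\<^sup>2)) - exp (- (pi * \<tau> * y\<^sup>2))\<bar> \<le> exp (- (pi * \<tau> * x\<^sup>2))"
        using sq \<tau> by (simp add: abs_le_iff)
      also have "\<dots> \<le> (1 / (1 + x\<^sup>2)) ^ 3" using gx cub by linarith
      also have "\<dots> \<le> (1 / (1 + x\<^sup>2)) ^ 1"
      proof (rule power_decreasing)
        show "1 / (1 + x\<^sup>2) \<le> 1" using pos by (subst divide_le_eq_1_pos) linarith+
      qed auto
      also have "\<dots> \<le> (2 * pi * \<tau> * \<bar>x - y\<bar>) * (1 / (1 + x\<^sup>2)) ^ 1"
      proof -
        have "1 * 1 * 1 * 1 \<le> 2 * pi * \<tau> * \<bar>x - y\<bar>"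
          using pi_gt3 \<tau> False by (intro mult_mono) auto
        from mult_right_mono[OF this, of "(1 / (1 + x\<^sup>2)) ^ 1"] show ?thesis by simp
      qed
      finally show ?thesis by simp
    qed
  qed
  show ?thesis
  proof (cases "\<bar>x\<bar> \<le> \<bar>y\<bar>")
    case True
    have "2 * pi * \<tau> * \<bar>x - y\<bar> * (1 / (1 + x\<^sup>2)) \<le> 2 * pi * \<tau> * \<bar>x - y\<bar> * (1 / (1 + x\<^sup>2) + 1 / (1 + y\<^sup>2))"
      using \<tau> by (intro mult_left_mono) auto
    with main[OF True] show ?thesis by linarith
  next
    case False
    then have *: "\<bar>y\<bar> \<le> \<bar>x\<bar>" by simp
    have "2 * pi * \<tau> * \<bar>y - x\<bar> * (1 / (1 + y\<^sup>2)) \<le> 2 * pi * \<tau> * \<bar>y - x\<bar> * (1 / (1 + x\<^sup>2) + 1 / (1 + y\<^sup>2))"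
      using \<tau> by (intro mult_left_mono) auto
    with main[OF *] show ?thesis by (simp add: abs_minus_commute)
  qed
qed

section \<open>An alternating theta function and its zeros\<close>

definition alternating :: "int \<Rightarrow> real" where
  "alternating k = (if even k then 1 else - 1)"

definition alternating_theta :: "real \<Rightarrow> real \<Rightarrow> real" where
  "alternating_theta \<tau> z = (\<integral>k. alternating k * exp (- (pi * \<tau> * (of_int k - z)\<^sup>2)) \<partial>zcount)"

lemma abs_alternating [simp]: "\<bar>alternating k\<bar> = 1"
  by (simp add: alternating_def)

lemma integrable_alternating_theta:
  assumes "\<tau> \<ge> 1"
  shows "integrable zcount (\<lambda>k. alternating k * exp (- (pi * \<tau> * (of_int k - z)\<^sup>2)))"
proof (rule integrable_zcountI[where d=1 and C=1 and x="- z"])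
  fix k
  have "exp (- (pi * \<tau> * (of_int k - z)\<^sup>2)) \<le> exp (- (pi * 1 * (of_int k - z)\<^sup>2))"
    using assms by (simp add: mult_right_mono)
  also have "\<dots> \<le> 1 / (1 + (of_int k - z)\<^sup>2)"
    using gauss_le_cauchy[of "of_int k - z"] by simp
  finally show "norm (alternating k * exp (- (pi * \<tau> * (of_int k - z)\<^sup>2)))
      \<le> 1 / (1 + (- z + 1 * of_int k)\<^sup>2)"
    by (simp add: abs_mult)
qed auto

text \<open>The reflection k -> 2n + 1 - k preserves the distance to n + 1/2 and changes the parity
  of k.\<close>

lemma alternating_theta_half: "alternating_theta \<tau> (of_int n + 1 / 2) = 0"
proof -
  let ?f = "\<lambda>k. alternating k * exp (- (pi * \<tau> * (of_int k - (of_int n + 1 / 2))\<^sup>2))"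
  have refl: "?f (2 * n + 1 - k) = - ?f k" for k
    by (simp add: alternating_def power2_eq_square algebra_simps)
  have "(\<integral>k. ?f k \<partial>zcount) = (\<integral>k. ?f (2 * n + 1 - k) \<partial>zcount)"
    by (rule integral_bij_count_space[symmetric], rule bij_betwI[where g="\<lambda>k. 2 * n + 1 - k"]) auto
  also have "\<dots> = - (\<integral>k. ?f k \<partial>zcount)"
    unfolding refl by simp
  finally show ?thesis by (simp add: alternating_theta_def)
qed

text \<open>Linear vanishing at each half-integer, by summing the termwise Lipschitz bound against
  the zero: 36 = 2 * (9 + 9), where 9 bounds each of the two profile sums with unit spacing.\<close>

lemma alternating_theta_bound:
  assumes \<tau>: "\<tau> \<ge> 1"
  shows "\<bar>alternating_theta \<tau> z\<bar> \<le> 36 * pi * \<tau> * \<bar>z - (of_int n + 1 / 2)\<bar>"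
proof -
  define w where "w = real_of_int n + 1 / 2"
  let ?f = "\<lambda>z k. alternating k * exp (- (pi * \<tau> * (of_int k - z)\<^sup>2))"
  define D where "D = 2 * pi * \<tau> * \<bar>z - w\<bar>"
  let ?q = "\<lambda>z k. 1 / (1 + (- z + 1 * real_of_int k)\<^sup>2)"
  have D: "0 \<le> D" using \<tau> by (simp add: D_def)
  have "alternating_theta \<tau> z = alternating_theta \<tau> z - alternating_theta \<tau> w"
    by (simp add: w_def alternating_theta_half)
  also have "\<dots> = (\<integral>k. ?f z k - ?f w k \<partial>zcount)"
    unfolding alternating_theta_def
    by (rule Bochner_Integration.integral_diff[symmetric]) (rule integrable_alternating_theta[OF \<tau>])+
  finally have "ennreal \<bar>alternating_theta \<tau> z\<bar> \<le> (\<integral>\<^sup>+k. ennreal \<bar>?f z k - ?f w k\<bar> \<partial>zcount)"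
    using norm_integral_le_nn_integral[of zcount "\<lambda>k. ?f z k - ?f w k"] by simp
  also have "\<dots> \<le> (\<integral>\<^sup>+k. ennreal D * (ennreal (?q z k) + ennreal (?q w k)) \<partial>zcount)"
  proof (rule nn_integral_mono)
    fix k
    have "\<bar>?f z k - ?f w k\<bar> = \<bar>exp (- (pi * \<tau> * (of_int k - z)\<^sup>2)) - exp (- (pi * \<tau> * (of_int k - w)\<^sup>2))\<bar>"
      by (auto simp: alternating_def)
    also have "\<dots> \<le> D * (?q z k + ?q w k)"
      using gauss_lipschitz[OF \<tau>, of "of_int k - z" "of_int k - w"]
      by (simp add: D_def abs_minus_commute)
    finally show "ennreal \<bar>?f z k - ?f w k\<bar> \<le> ennreal D * (ennreal (?q z k) + ennreal (?q w k))"
      using D by (simp add: ennreal_leI flip: ennreal_plus ennreal_mult)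
  qed
  also have "\<dots> = ennreal D * ((\<integral>\<^sup>+k. ennreal (?q z k) \<partial>zcount) + (\<integral>\<^sup>+k. ennreal (?q w k) \<partial>zcount))"
    by (subst nn_integral_cmult, simp, subst nn_integral_add) simp_all
  also have "\<dots> \<le> ennreal D * (ennreal (1 + 8 / 1) + ennreal (1 + 8 / 1))"
    by (intro mult_left_mono add_mono nn_integral_zcount_shifted_cauchy_le) auto
  also have "\<dots> = ennreal (18 * D)"
    using D by (simp add: ennreal_mult mult.commute)
  finally have "\<bar>alternating_theta \<tau> z\<bar> \<le> 18 * D"
    using D by (subst (asm) ennreal_le_iff) auto
  then show ?thesis by (simp add: w_def D_def)
qed

text \<open>
  At the critical density the alternating sequence annihilates every sample on the fibre
  through $t = 1/2$; damping it at the scale $(1 - a^2)^{-1/2}$ keeps the samples small.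
\<close>

definition damped_alternating :: "real \<Rightarrow> int \<Rightarrow> real" where
  "damped_alternating a k = alternating k * exp (- (pi * (1 / a\<^sup>2 - 1) * (of_int k)\<^sup>2))"

text \<open>Damping and sampling contribute (1/a^2 - 1) + 1/a^2 = \<tau> to the coefficient of k^2.
  Completing the square in k leaves the theta function at (m - s)/\<tau>, close to the half-integer
  m - 1/2 when \<tau> is close to 1 and s to 1/2, times a Gaussian in m - s whose rate a^2 -
  1/\<tau> is of order 1 - a^2.\<close>

lemma fibre_sample_damped_alternating:
  assumes a: "0 < a" "a < 1"
  defines "\<tau> \<equiv> 2 / a\<^sup>2 - 1"
  shows "fibre_sample a (a * s) (\<lambda>k. of_real (damped_alternating a k)) m
           = of_real (exp (- (pi * (a\<^sup>2 - 1 / \<tau>) * (of_int m - s)\<^sup>2))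
               * alternating_theta \<tau> ((of_int m - s) / \<tau>))"
proof -
  define y where "y = of_int m - s"
  have "a\<^sup>2 < 1" using a by (simp add: power2_less_1_iff abs_if)
  then have \<tau>: "\<tau> > 0" using a by (simp add: \<tau>_def field_simps)
  have "complex_of_real (damped_alternating a k) * gaussian (a * s + of_int k / a - a * of_int m)
      = of_real (exp (- (pi * (a\<^sup>2 - 1 / \<tau>) * y\<^sup>2))
          * (alternating k * exp (- (pi * \<tau> * (of_int k - y / \<tau>)\<^sup>2))))" for k
  proof -
    have e1: "a * s + of_int k / a - a * of_int m = of_int k / a - a * y"
      by (simp add: y_def algebra_simps)
    have "pi * (1 / a\<^sup>2 - 1) * (of_int k)\<^sup>2 + pi * (of_int k / a - a * y)\<^sup>2
        = pi * (\<tau> * (of_int k)\<^sup>2 - 2 * of_int k * y + a\<^sup>2 * y\<^sup>2)"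
      using a(1) unfolding \<tau>_def by (simp add: power2_eq_square field_simps)
    also have "\<dots> = pi * (a\<^sup>2 - 1 / \<tau>) * y\<^sup>2 + pi * \<tau> * (of_int k - y / \<tau>)\<^sup>2"
      using \<tau> by (simp add: power2_eq_square field_simps)
    finally have "exp (- (pi * (1 / a\<^sup>2 - 1) * (of_int k)\<^sup>2)) * exp (- (pi * (of_int k / a - a * y)\<^sup>2))
        = exp (- (pi * (a\<^sup>2 - 1 / \<tau>) * y\<^sup>2)) * exp (- (pi * \<tau> * (of_int k - y / \<tau>)\<^sup>2))"
      by (simp flip: exp_add)
    then show ?thesis
      unfolding e1 damped_alternating_def gaussian_def
      by (simp flip: of_real_mult add: mult_ac)
  qed
  then show ?thesis
    unfolding fibre_sample_def alternating_theta_def y_def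
    by (simp only: integral_complex_of_real integral_mult_right_zero)
qed

text \<open>Two effects combine. The theta argument misses its zero by at most a multiple of e|y|,
  with e = 1 - a^2 and y = m - s, so the squared sample carries e^2 y^2; the Gaussian restricts y to
  the scale e^{-1/2}. Together they give height e and width e^{-1/2} in m.\<close>

lemma fibre_sample_damped_alternating_le:
  assumes a: "1 / 2 < a" "a < 1" and s: "1 / 2 \<le> s" "s \<le> 1 / 2 + (1 - a\<^sup>2) / 4"
  defines "d \<equiv> sqrt ((1 - a\<^sup>2) / 8)"
  shows "(cmod (fibre_sample a (a * s) (\<lambda>k. of_real (damped_alternating a k)) m))\<^sup>2
           \<le> 144 * (252 * pi)\<^sup>2 * (1 - a\<^sup>2) * (1 / (1 + (- d / 2 + d * of_int m)\<^sup>2))"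
proof -
  define e where "e = 1 - a\<^sup>2"
  define \<tau> where "\<tau> = 2 / a\<^sup>2 - 1"
  define y where "y = of_int m - s"
  define b where "b = real_of_int m - 1 / 2"
  have "(1 / 2)\<^sup>2 < a\<^sup>2" using a by (intro power_strict_mono) auto
  moreover have "a\<^sup>2 < 1" using a by (simp add: power2_less_1_iff abs_if)
  ultimately have a2: "1 / 4 < a\<^sup>2" "a\<^sup>2 < 1" by (auto simp: power2_eq_square)
  have e: "0 < e" "e < 3 / 4" using a2 by (auto simp: e_def)
  have \<tau>1: "\<tau> \<ge> 1" using a2 a unfolding \<tau>_def by (simp add: field_simps)
  have "2 / a\<^sup>2 \<le> 2 / (1 / 4)" using a2 by (intro divide_left_mono) auto
  then have \<tau>7: "\<tau> \<le> 7" by (simp add: \<tau>_def)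
  have inv: "1 / \<tau> = a\<^sup>2 / (2 - a\<^sup>2)"
    using a2 a unfolding \<tau>_def by (simp add: field_simps)
  have inv1: "1 - 1 / \<tau> \<le> 2 * e" "0 \<le> 1 - 1 / \<tau>"
  proof -
    have "1 - 1 / \<tau> = 2 * e / (2 - a\<^sup>2)"
      unfolding inv e_def using a2 by (simp add: field_simps)
    also have "\<dots> \<le> 2 * e / 1" using a2 e by (intro divide_left_mono) auto
    finally show "1 - 1 / \<tau> \<le> 2 * e" by simp
    show "0 \<le> 1 - 1 / \<tau>" using \<tau>1 by simp
  qed
  have inv2: "e / 8 \<le> a\<^sup>2 - 1 / \<tau>"
  proof -
    have "a\<^sup>2 - 1 / \<tau> = a\<^sup>2 * e / (2 - a\<^sup>2)"
      unfolding inv e_def using a2 by (simp add: field_simps)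
    moreover have "(1 / 4) * e / 2 \<le> a\<^sup>2 * e / (2 - a\<^sup>2)"
      using a2 e by (intro frac_le mult_right_mono mult_nonneg_nonneg) auto
    ultimately show ?thesis by simp
  qed
  have b: "1 / 2 \<le> \<bar>b\<bar>" unfolding b_def by (cases "m \<le> 0") auto
  have se: "0 \<le> s - 1 / 2" "s - 1 / 2 \<le> e / 4"
    using s unfolding e_def by linarith+
  have yb: "\<bar>b\<bar> / 2 \<le> \<bar>y\<bar>"
  proof -
    have "\<bar>b\<bar> \<le> \<bar>b - (s - 1 / 2)\<bar> + \<bar>s - 1 / 2\<bar>" by arith
    moreover have "\<bar>s - 1 / 2\<bar> \<le> 1 / 4" using se e by linarith
    moreover have "y = b - (s - 1 / 2)" by (simp add: y_def b_def)
    ultimately show ?thesis using b by linarith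
  qed
  \<comment> \<open>The scaling by 1/\<tau> displaces the half-integer b = m - 1/2 by at most 2e|b|,
    and the window for s by at most e/4 <= e|b|/2 because |b| >= 1/2. Finally |b| <= 2|y| expresses
    the total through y.\<close>
  have dist: "\<bar>y / \<tau> - (of_int (m - 1) + 1 / 2)\<bar> \<le> 6 * e * \<bar>y\<bar>"
  proof -
    have "y / \<tau> - (of_int (m - 1) + 1 / 2) = - (b * (1 - 1 / \<tau>)) - (s - 1 / 2) * (1 / \<tau>)"
      using \<tau>1 by (simp add: y_def b_def field_simps)
    also have "\<bar>\<dots>\<bar> \<le> \<bar>b\<bar> * (1 - 1 / \<tau>) + (s - 1 / 2) * (1 / \<tau>)"
      using inv1(2) s(1) \<tau>1
      by (intro order_trans[OF abs_triangle_ineq4]) (simp add: abs_mult)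
    also have "\<dots> \<le> \<bar>b\<bar> * (2 * e) + (e / 4) * 1"
      using inv1 se \<tau>1 e by (intro add_mono mult_mono) auto
    also have "\<dots> \<le> \<bar>b\<bar> * (3 * e)"
      using mult_right_mono[OF b, of e] e by simp
    also have "\<dots> \<le> (2 * \<bar>y\<bar>) * (3 * e)"
      using yb e by (intro mult_right_mono) auto
    finally show ?thesis by (simp add: mult_ac)
  qed
  have "\<bar>alternating_theta \<tau> (y / \<tau>)\<bar> \<le> 36 * pi * \<tau> * (6 * e * \<bar>y\<bar>)"
    by (rule order_trans[OF alternating_theta_bound[OF \<tau>1, of "y / \<tau>" "m - 1"]
          mult_left_mono[OF dist]]) (use \<tau>1 in simp)
  also have "\<dots> \<le> 36 * pi * 7 * (6 * e * \<bar>y\<bar>)"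
    using \<tau>7 e by (intro mult_right_mono mult_left_mono) auto
  \<comment> \<open>The constant 252 = 36 * 7 combines the Lipschitz constant of the theta function
    with \<tau> <= 7, which follows from a^2 > 1/4.\<close>
  finally have th: "\<bar>alternating_theta \<tau> (y / \<tau>)\<bar> \<le> 252 * pi * 6 * e * \<bar>y\<bar>" by simp
  \<comment> \<open>The variable in which the squared sample becomes e times a multiple of u e^{-u}:
    squaring the Gaussian gives at least the rate 2 pi e/8 >= e/2, and 36 e^2 y^2 = 72 e u.\<close>
  define u where "u = e * y\<^sup>2 / 2"
  have u0: "0 \<le> u" using e by (simp add: u_def)
  have ex: "(exp (- (pi * (a\<^sup>2 - 1 / \<tau>) * y\<^sup>2)))\<^sup>2 \<le> exp (- u)"
  proof -
    have "2 * (e / 8) * y\<^sup>2 \<le> pi * (a\<^sup>2 - 1 / \<tau>) * y\<^sup>2"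
      using pi_gt3 inv2 e by (intro mult_right_mono mult_mono) auto
    then show ?thesis by (simp add: u_def mult_ac flip: exp_of_nat_mult)
  qed
  have "(cmod (fibre_sample a (a * s) (\<lambda>k. of_real (damped_alternating a k)) m))\<^sup>2
      = (exp (- (pi * (a\<^sup>2 - 1 / \<tau>) * y\<^sup>2)))\<^sup>2 * (alternating_theta \<tau> (y / \<tau>))\<^sup>2"
    using fibre_sample_damped_alternating[of a s m] a
    by (simp add: \<tau>_def[symmetric] y_def[symmetric] power_mult_distrib norm_mult del: of_real_mult)
  also have "\<dots> \<le> exp (- u) * (252 * pi * 6 * e * \<bar>y\<bar>)\<^sup>2"
    using ex th by (intro mult_mono abs_le_square_iff[THEN iffD1]) auto
  also have "\<dots> = 72 * (252 * pi)\<^sup>2 * e * (u * exp (- u))"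
    by (simp add: u_def power_mult_distrib) (simp add: power2_eq_square)
  also have "\<dots> \<le> 72 * (252 * pi)\<^sup>2 * e * (2 / (1 + u))"
    using e by (intro mult_left_mono mult_exp_neg_le_inverse u0) auto
  also have "\<dots> \<le> 72 * (252 * pi)\<^sup>2 * e * (2 / (1 + (d * b)\<^sup>2))"
  proof -
    have "(\<bar>b\<bar> / 2)\<^sup>2 \<le> \<bar>y\<bar>\<^sup>2" by (intro power_mono yb) auto
    then have "e / 2 * (b\<^sup>2 / 4) \<le> e / 2 * y\<^sup>2"
      using e by (intro mult_left_mono) (auto simp: power_divide)
    then have "(d * b)\<^sup>2 \<le> u"
      using e by (simp add: d_def e_def[symmetric] u_def power_mult_distrib)
    then have "2 / (1 + u) \<le> 2 / (1 + (d * b)\<^sup>2)"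
      using u0 by (intro divide_left_mono) (auto intro!: mult_pos_pos add_pos_nonneg)
    then show ?thesis using e by (intro mult_left_mono) auto
  qed
  also have "d * b = - d / 2 + d * of_int m"
    by (simp add: b_def algebra_simps)
  finally show ?thesis by (simp add: e_def)
qed

lemma fibre_sample_damped_alternating_sum_le:
  assumes a: "1 / 2 < a" "a < 1" and s: "1 / 2 \<le> s" "s \<le> 1 / 2 + (1 - a\<^sup>2) / 4"
  shows "(\<integral>\<^sup>+m. ennreal ((cmod (fibre_sample a (a * s) (\<lambda>k. of_real (damped_alternating a k)) m))\<^sup>2) \<partial>zcount)
           \<le> ennreal (3600 * (252 * pi)\<^sup>2 * sqrt (1 - a\<^sup>2))"
proof -
  define e where "e = 1 - a\<^sup>2"
  define d where "d = sqrt (e / 8)"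
  let ?C = "144 * (252 * pi)\<^sup>2 * e"
  have "a\<^sup>2 < 1" using a by (simp add: power2_less_1_iff abs_if)
  then have e: "0 < e" "e \<le> 1" by (auto simp: e_def)
  then have d: "0 < d" by (simp add: d_def)
  have "(\<integral>\<^sup>+m. ennreal ((cmod (fibre_sample a (a * s) (\<lambda>k. of_real (damped_alternating a k)) m))\<^sup>2) \<partial>zcount)
      \<le> (\<integral>\<^sup>+m. ennreal ?C * ennreal (1 / (1 + (- d / 2 + d * of_int m)\<^sup>2)) \<partial>zcount)"
    using fibre_sample_damped_alternating_le[OF a s] e
    by (intro nn_integral_mono) (simp add: d_def e_def ennreal_leI flip: ennreal_mult)
  also have "\<dots> = ennreal ?C * (\<integral>\<^sup>+m. ennreal (1 / (1 + (- d / 2 + d * of_int m)\<^sup>2)) \<partial>zcount)"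
    by (rule nn_integral_cmult) simp
  also have "\<dots> \<le> ennreal ?C * ennreal (1 + 8 / d)"
    by (intro mult_left_mono nn_integral_zcount_shifted_cauchy_le d) simp
  also have "\<dots> = ennreal (?C * (1 + 8 / d))"
    using e d by (simp add: ennreal_mult)
  also have "\<dots> \<le> ennreal (3600 * (252 * pi)\<^sup>2 * sqrt e)"
  proof (rule ennreal_leI)
    have se: "0 < sqrt e" "sqrt e \<le> 1" "sqrt e * sqrt e = e" using e by auto
    \<comment> \<open>From sqrt 8 <= 3. It gives 8/d <= 24/sqrt e, hence 1 + 8/d <= 25/sqrt e and
      the constant 3600 = 144 * 25.\<close>
    have "sqrt e / 3 \<le> d"
      unfolding d_def real_sqrt_divide
      using e real_sqrt_le_mono[of 8 9] by (intro divide_left_mono) auto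
    then have "8 / d \<le> 8 / (sqrt e / 3)"
      using se d by (intro divide_left_mono) auto
    moreover have "1 \<le> 1 / sqrt e" using se by simp
    ultimately have "1 + 8 / d \<le> 25 / sqrt e" by simp
    then have "?C * (1 + 8 / d) \<le> ?C * (25 / sqrt e)"
      using e by (intro mult_left_mono) auto
    also have "\<dots> = 3600 * (252 * pi)\<^sup>2 * (e / sqrt e)" by simp
    also have "e / sqrt e = sqrt e" using se by (simp add: field_simps)
    finally show "?C * (1 + 8 / d) \<le> 3600 * (252 * pi)\<^sup>2 * sqrt e" .
  qed
  finally show ?thesis by (simp add: e_def)
qed

lemma damped_alternating_square:
  "(damped_alternating a k)\<^sup>2 = exp (- (2 * pi * (1 / a\<^sup>2 - 1) * (of_int k)\<^sup>2))"
proof -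
  have "(alternating k)\<^sup>2 = 1" by (simp add: alternating_def)
  then show ?thesis
    by (simp add: damped_alternating_def power_mult_distrib flip: exp_of_nat_mult)
qed

text \<open>The damping is bounded below on a range of length (1 - a^2)^{-1/2}. Since the sampled
  energy is only of order (1 - a^2)^{1/2}, the quotient of the two has the order 1 - a^2 that is to
  be shown optimal.\<close>

lemma damped_alternating_norm_ge:
  assumes a: "1 / 2 < a" "a < 1"
  shows "ennreal (exp (- (8 * pi)) / sqrt (1 - a\<^sup>2)) \<le> (\<integral>\<^sup>+k. ennreal ((damped_alternating a k)\<^sup>2) \<partial>zcount)"
proof -
  define e where "e = 1 - a\<^sup>2"
  \<comment> \<open>There are N + 1 >= 1/sqrt e integers in {0..N}, and for each of them (1/a^2 - 1)
    k^2 <= 4 e k^2 <= 4, so that the weight is at least e^{-8 pi}.\<close>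
  define N where "N = \<lfloor>1 / sqrt e\<rfloor>"
  have "(1 / 2)\<^sup>2 < a\<^sup>2" using a by (intro power_strict_mono) auto
  moreover have "a\<^sup>2 < 1" using a by (simp add: power2_less_1_iff abs_if)
  ultimately have a2: "1 / 4 < a\<^sup>2" "a\<^sup>2 < 1" by (auto simp: power2_eq_square)
  have e: "0 < e" using a2 by (auto simp: e_def)
  have ea: "1 / a\<^sup>2 - 1 \<le> 4 * e"
  proof -
    have "1 / a\<^sup>2 - 1 = e / a\<^sup>2" using a by (simp add: e_def field_simps)
    also have "\<dots> \<le> e / (1 / 4)" using a2 e by (intro divide_left_mono) auto
    finally show ?thesis by simp
  qed
  have N0: "0 \<le> N" using e by (simp add: N_def)
  have "exp (- (8 * pi)) / sqrt e \<le> exp (- (8 * pi)) * real (card {0..N})"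
  proof -
    have "1 / sqrt e \<le> real_of_int N + 1" unfolding N_def by linarith
    also have "\<dots> = real (card {0..N})" using N0 by simp
    finally show ?thesis
      using mult_left_mono[of "1 / sqrt e" "real (card {0..N})" "exp (- (8 * pi))"] by simp
  qed
  then have "ennreal (exp (- (8 * pi)) / sqrt e) \<le> ennreal (exp (- (8 * pi)) * real (card {0..N}))"
    by (rule ennreal_leI)
  also have "\<dots> = ennreal (exp (- (8 * pi))) * of_nat (card {0..N})"
    by (simp add: ennreal_mult ennreal_of_nat_eq_real_of_nat)
  also have "\<dots> = (\<integral>\<^sup>+k. ennreal (exp (- (8 * pi))) * indicator {0..N} k \<partial>zcount)"
    by (simp add: nn_integral_cmult_indicator emeasure_count_space)
  also have "\<dots> \<le> (\<integral>\<^sup>+k. ennreal ((damped_alternating a k)\<^sup>2) \<partial>zcount)"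
  proof (rule nn_integral_mono)
    fix k
    show "ennreal (exp (- (8 * pi))) * indicator {0..N} k \<le> ennreal ((damped_alternating a k)\<^sup>2)"
    proof (cases "k \<in> {0..N}")
      case True
      then have "real_of_int k \<le> 1 / sqrt e" unfolding N_def by (auto simp: le_floor_iff)
      then have "(real_of_int k)\<^sup>2 \<le> (1 / sqrt e)\<^sup>2" using True by (intro power_mono) auto
      then have "e * (real_of_int k)\<^sup>2 \<le> 1" using e by (simp add: power_divide field_simps)
      moreover have "(1 / a\<^sup>2 - 1) * (real_of_int k)\<^sup>2 \<le> 4 * e * (real_of_int k)\<^sup>2"
        using ea by (intro mult_right_mono) auto
      ultimately have "(1 / a\<^sup>2 - 1) * (real_of_int k)\<^sup>2 \<le> 4" by linarith
      then have "2 * pi * ((1 / a\<^sup>2 - 1) * (real_of_int k)\<^sup>2) \<le> 2 * pi * 4"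
        by (intro mult_left_mono) auto
      then show ?thesis using True by (simp add: damped_alternating_square ennreal_leI mult.assoc)
    qed simp
  qed
  finally show ?thesis by (simp add: e_def)
qed

lemma damped_alternating_norm_finite:
  assumes a: "0 < a" "a < 1"
  shows "(\<integral>\<^sup>+k. ennreal ((damped_alternating a k)\<^sup>2) \<partial>zcount) < \<infinity>"
proof -
  define q where "q = 2 * pi * (1 / a\<^sup>2 - 1)"
  have "a\<^sup>2 < 1" using a by (simp add: power2_less_1_iff abs_if)
  then have q: "0 < q" using a by (simp add: q_def)
  have "(\<integral>\<^sup>+k. ennreal ((damped_alternating a k)\<^sup>2) \<partial>zcount)
      \<le> (\<integral>\<^sup>+k. ennreal (1 / (1 + (sqrt q * of_int k)\<^sup>2)) \<partial>zcount)"
  proof (intro nn_integral_mono ennreal_leI)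
    fix k
    show "(damped_alternating a k)\<^sup>2 \<le> 1 / (1 + (sqrt q * of_int k)\<^sup>2)"
      unfolding damped_alternating_square q_def[symmetric]
      using exp_neg_le_inverse[of "q * (of_int k)\<^sup>2"] q by (simp add: power_mult_distrib)
  qed
  also have "\<dots> \<le> ennreal (1 + 4 / sqrt q)"
    using q by (intro nn_integral_zcount_cauchy_le) simp
  also have "\<dots> < \<infinity>" by simp
  finally show ?thesis .
qed

section \<open>Parseval identity for Fourier series\<close>

text \<open>Links counting-measure integrals with suprema of finite partial sums, the form in which
  both the unordered sum of the frame inequality and the Bessel inequality are available.\<close>

lemma nn_integral_count_space_SUP:
  fixes f :: "'a \<Rightarrow> ennreal"
  assumes A: "countable A" "infinite A"
  shows "(\<integral>\<^sup>+x. f x \<partial>count_space A) = (SUP F\<in>{F. finite F \<and> F \<subseteq> A}. sum f F)"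
proof (rule antisym)
  let ?e = "from_nat_into A"
  note bij = bij_betw_from_nat_into[OF A]
  have inj: "inj_on ?e S" for S using bij by (auto simp: bij_betw_def inj_on_def)
  have "(\<integral>\<^sup>+x. f x \<partial>count_space A) = (\<Sum>i. f (?e i))"
    by (simp add: nn_integral_bij_count_space[OF bij, symmetric] nn_integral_count_space_nat)
  also have "\<dots> = (SUP n. \<Sum>i<n. f (?e i))"
    by (rule suminf_eq_SUP)
  also have "\<dots> \<le> (SUP F\<in>{F. finite F \<and> F \<subseteq> A}. sum f F)"
  proof (rule SUP_least)
    fix n
    have "(\<Sum>i<n. f (?e i)) = sum f (?e ` {..<n})"
      by (simp add: sum.reindex[OF inj] comp_def)
    also have "\<dots> \<le> (SUP F\<in>{F. finite F \<and> F \<subseteq> A}. sum f F)"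
      using A by (intro SUP_upper) (auto simp: from_nat_into infinite_imp_nonempty)
    finally show "(\<Sum>i<n. f (?e i)) \<le> (SUP F\<in>{F. finite F \<and> F \<subseteq> A}. sum f F)" .
  qed
  finally show "(\<integral>\<^sup>+x. f x \<partial>count_space A) \<le> (SUP F\<in>{F. finite F \<and> F \<subseteq> A}. sum f F)" .
next
  show "(SUP F\<in>{F. finite F \<and> F \<subseteq> A}. sum f F) \<le> (\<integral>\<^sup>+x. f x \<partial>count_space A)"
  proof (rule SUP_least, clarify)
    fix F assume F: "finite F" "F \<subseteq> A"
    have "sum f F = (\<integral>\<^sup>+x. f x \<partial>count_space F)"
      by (rule nn_integral_count_space_finite[OF F(1), symmetric])
    also have "\<dots> = (\<integral>\<^sup>+x. f x * indicator F x \<partial>count_space A)"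
      using F(2) by (auto simp: nn_integral_count_space_indicator Int_absorb1 indicator_inter_arith[symmetric]
          mult.assoc intro!: nn_integral_cong split: split_indicator)
    also have "\<dots> \<le> (\<integral>\<^sup>+x. f x \<partial>count_space A)"
      by (intro nn_integral_mono) (auto split: split_indicator)
    finally show "sum f F \<le> (\<integral>\<^sup>+x. f x \<partial>count_space A)" .
  qed
qed

lemma infsum_ennreal_eq_nn_integral:
  fixes f :: "'a \<Rightarrow> ennreal"
  assumes A: "countable A" "infinite A"
  shows "infsum f A = (\<integral>\<^sup>+x. f x \<partial>count_space A)"
  unfolding nn_integral_count_space_SUP[OF A] by (rule nonneg_infsum_complete) simp

section \<open>Characters on one period\<close>

abbreviation period :: "real \<Rightarrow> real measure" where
  "period L \<equiv> restrict_space lborel {0..<L}"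

definition fchar :: "real \<Rightarrow> int \<Rightarrow> real \<Rightarrow> complex" where
  "fchar L n t = cis (2 * pi * of_int n * t / L)"

lemma norm_fchar [simp]: "norm (fchar L n t) = 1"
  by (simp add: fchar_def)

lemma fchar_0 [simp]: "fchar L 0 t = 1"
  by (simp add: fchar_def)

lemma fchar_mult: "fchar L n t * fchar L m t = fchar L (n + m) t"
  by (simp add: fchar_def cis_mult add_divide_distrib algebra_simps)

lemma fchar_cnj: "cnj (fchar L n t) = fchar L (- n) t"
  by (simp add: fchar_def cis_cnj)

lemma continuous_on_fchar [continuous_intros]: "continuous_on S (fchar L n)"
  by (cases "L = 0") (auto simp: fchar_def[abs_def] intro!: continuous_intros)

lemma measurable_period [measurable (raw)]:
  "f \<in> borel_measurable borel \<Longrightarrow> f \<in> borel_measurable (period L)"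
  by (rule measurable_restrict_space1) simp

lemma measurable_fchar [measurable]: "fchar L n \<in> borel_measurable borel"
  by (rule borel_measurable_continuous_onI) (rule continuous_on_fchar)

lemma finite_measure_period: "finite_measure (period L)"
  by (rule finite_measureI, cases "0 \<le> L") (simp_all add: space_restrict_space emeasure_restrict_space)

lemma integral_fchar:
  assumes L: "L > 0"
  shows "(\<integral>t. fchar L n t \<partial>period L) = (if n = 0 then of_real L else 0)"
proof -
  \<comment> \<open>The end point L is a null set; adding it gives the closed interval of the
    fundamental theorem of calculus.\<close>
  have "(\<integral>t. fchar L n t \<partial>period L) = (\<integral>t. indicator {0..L} t *\<^sub>R fchar L n t \<partial>lborel)"
    unfolding integral_restrict_space[of "{0..<L}" lborel, simplified]
    using AE_lborel_singleton[of L]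
    by (intro integral_cong_AE) (auto split: split_indicator elim!: eventually_mono)
  also have "\<dots> = (if n = 0 then of_real L else 0)"
  proof (cases "n = 0")
    case True
    have "((\<lambda>t. complex_of_real t) has_vector_derivative fchar L n t) (at t within {0..L})" for t
      unfolding True by (auto intro!: derivative_eq_intros)
    from integral_FTC_atLeastAtMost[OF _ this continuous_on_fchar] L True show ?thesis by simp
  next
    case False
    let ?F = "\<lambda>t. of_real (L / (2 * pi * of_int n)) * - \<i> * fchar L n t"
    have "((\<lambda>z. of_real (L / (2 * pi * of_int n)) * - \<i> * exp (\<i> * of_real (2 * pi * of_int n / L) * z))
        has_field_derivative fchar L n t) (at (complex_of_real t))" for t
      using False L by (auto intro!: derivative_eq_intros simp: fchar_def cis_conv_exp field_simps)
    from has_vector_derivative_real_field[OF this]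
    have "(?F has_vector_derivative fchar L n t) (at t within {0..L})" for t
      by (simp add: fchar_def cis_conv_exp mult.assoc)
    from integral_FTC_atLeastAtMost[OF _ this continuous_on_fchar]
    have "(\<integral>t. indicator {0..L} t *\<^sub>R fchar L n t \<partial>lborel) = ?F L - ?F 0"
      using L by simp
    also have "fchar L n L = 1"
      using L cis_multiple_2pi[of "of_int n"] by (simp add: fchar_def mult.commute mult.left_commute)
    then have "?F L - ?F 0 = 0" by (simp add: fchar_def)
    finally show ?thesis using False by simp
  qed
  finally show ?thesis .
qed

section \<open>Density of the trigonometric polynomials\<close>

inductive trig_poly :: "real \<Rightarrow> (real \<Rightarrow> complex) \<Rightarrow> bool" for L where
  char: "trig_poly L (\<lambda>t. c * fchar L n t)"
| add: "trig_poly L p \<Longrightarrow> trig_poly L q \<Longrightarrow> trig_poly L (\<lambda>t. p t + q t)"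

lemma trig_poly_const: "trig_poly L (\<lambda>t. c)"
  using trig_poly.char[of L c 0] by simp

lemma trig_poly_cmult: "trig_poly L p \<Longrightarrow> trig_poly L (\<lambda>t. c * p t)"
proof (induction rule: trig_poly.induct)
  case (char d n)
  then show ?case using trig_poly.char[of L "c * d" n] by (simp add: mult.assoc)
next
  case (add p q)
  then show ?case using trig_poly.add[OF add.IH] by (simp add: distrib_left)
qed

lemma trig_poly_mult: "trig_poly L p \<Longrightarrow> trig_poly L q \<Longrightarrow> trig_poly L (\<lambda>t. p t * q t)"
proof (induction rule: trig_poly.induct)
  case (char c n)
  from char.prems have "trig_poly L (\<lambda>t. fchar L n t * q t)"
  proof (induction rule: trig_poly.induct)
    case (char d m)
    then show ?case using trig_poly.char[of L d "n + m"] by (simp add: fchar_mult[symmetric] mult_ac)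
  next
    case (add p q)
    then show ?case using trig_poly.add[OF add.IH] by (simp add: distrib_left)
  qed
  from trig_poly_cmult[OF this, of c] show ?case by (simp add: mult.assoc)
next
  case (add p q')
  then show ?case using trig_poly.add[OF add.IH(1)[OF add.prems] add.IH(2)[OF add.prems]]
    by (simp add: distrib_right)
qed

lemma trig_poly_measurable [measurable_dest]: "trig_poly L p \<Longrightarrow> p \<in> borel_measurable borel"
  by (induction rule: trig_poly.induct) measurable

lemma trig_poly_normal_form:
  "trig_poly L p \<Longrightarrow> \<exists>F c. finite F \<and> p = (\<lambda>t. \<Sum>n\<in>F. c n * fchar L n t)"
proof (induction rule: trig_poly.induct)
  case (char c n)
  show ?case by (rule exI[of _ "{n}"], rule exI[of _ "\<lambda>_. c"]) simp
next
  case (add p q)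
  then obtain F c G d where *: "finite F" "p = (\<lambda>t. \<Sum>n\<in>F. c n * fchar L n t)"
      "finite G" "q = (\<lambda>t. \<Sum>n\<in>G. d n * fchar L n t)" by blast
  let ?c = "\<lambda>n. (if n \<in> F then c n else 0) + (if n \<in> G then d n else 0)"
  have "p t + q t = (\<Sum>n\<in>F \<union> G. ?c n * fchar L n t)" for t
  proof -
    have "p t = (\<Sum>n\<in>F \<union> G. (if n \<in> F then c n else 0) * fchar L n t)"
      unfolding * using * by (intro sum.mono_neutral_cong_left) auto
    moreover have "q t = (\<Sum>n\<in>F \<union> G. (if n \<in> G then d n else 0) * fchar L n t)"
      unfolding * using * by (intro sum.mono_neutral_cong_left) auto
    ultimately show ?thesis by (simp add: sum.distrib distrib_right)
  qed
  then show ?case using * by (intro exI[of _ "F \<union> G"] exI[of _ ?c]) auto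
qed

text \<open>Translates Stone-Weierstrass on the circle into Fourier language: a real linear
  functional of z is a combination of z and its conjugate, which on the circle are the characters of
  index 1 and -1. Products stay within the class.\<close>

lemma trig_poly_real_polynomial:
  assumes "real_polynomial_function g"
  shows "trig_poly L (\<lambda>t. of_real (g (fchar L 1 t)))"
  using assms
proof (induction rule: real_polynomial_function.induct)
  case (linear f)
  have f: "f z = Re z * f 1 + Im z * f \<i>" for z
  proof -
    have "z = Re z *\<^sub>R 1 + Im z *\<^sub>R \<i>" by (simp add: complex_eq_iff)
    then have "f z = f (Re z *\<^sub>R 1 + Im z *\<^sub>R \<i>)" by simp
    also have "\<dots> = Re z * f 1 + Im z * f \<i>"
      using bounded_linear.linear[OF linear] by (simp only: linear_add linear_scale) simp
    finally show ?thesis .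
  qed
  have "trig_poly L (\<lambda>t. (of_real (f 1) / 2 + of_real (f \<i>) / (2 * \<i>)) * fchar L 1 t
      + (of_real (f 1) / 2 - of_real (f \<i>) / (2 * \<i>)) * fchar L (- 1) t)"
    by (intro trig_poly.intros)
  also have "(\<lambda>t. (of_real (f 1) / 2 + of_real (f \<i>) / (2 * \<i>)) * fchar L 1 t
      + (of_real (f 1) / 2 - of_real (f \<i>) / (2 * \<i>)) * fchar L (- 1) t)
      = (\<lambda>t. complex_of_real (f (fchar L 1 t)))"
    by (subst f) (auto simp: fun_eq_iff complex_eq_iff fchar_def field_simps)
  finally show ?case .
next
  case (const c)
  show ?case by (rule trig_poly_const)
next
  case (add f g)
  then show ?case using trig_poly.add[OF add.IH] by simp
next
  case (mult f g)
  then show ?case using trig_poly_mult[OF mult.IH] by simp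
qed

definition l2_dist :: "real \<Rightarrow> (real \<Rightarrow> complex) \<Rightarrow> (real \<Rightarrow> complex) \<Rightarrow> ennreal" where
  "l2_dist L f g = (\<integral>\<^sup>+t. ennreal ((cmod (f t - g t))\<^sup>2) \<partial>period L)"

definition trig_approx :: "real \<Rightarrow> (real \<Rightarrow> complex) \<Rightarrow> bool" where
  "trig_approx L f \<longleftrightarrow> (\<forall>\<epsilon>>0. \<exists>p. trig_poly L p \<and> l2_dist L f p \<le> ennreal \<epsilon>)"

lemma cmod_add_square_le: "(cmod (x + y))\<^sup>2 \<le> 2 * (cmod x)\<^sup>2 + 2 * (cmod y)\<^sup>2"
proof -
  have "(cmod (x + y))\<^sup>2 \<le> (cmod x + cmod y)\<^sup>2"
    by (intro power_mono norm_triangle_ineq) simp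
  also have "\<dots> \<le> 2 * (cmod x)\<^sup>2 + 2 * (cmod y)\<^sup>2"
    using sum_squares_bound[of "cmod x" "cmod y"] by (simp add: power2_sum)
  finally show ?thesis .
qed

lemma nn_integral_cmod_add_square_le:
  assumes [measurable]: "f \<in> borel_measurable borel" "g \<in> borel_measurable borel"
  shows "(\<integral>\<^sup>+t. ennreal ((cmod (f t + g t))\<^sup>2) \<partial>period L)
    \<le> 2 * (\<integral>\<^sup>+t. ennreal ((cmod (f t))\<^sup>2) \<partial>period L) + 2 * (\<integral>\<^sup>+t. ennreal ((cmod (g t))\<^sup>2) \<partial>period L)"
proof -
  have "(\<integral>\<^sup>+t. ennreal ((cmod (f t + g t))\<^sup>2) \<partial>period L)
      \<le> (\<integral>\<^sup>+t. 2 * ennreal ((cmod (f t))\<^sup>2) + 2 * ennreal ((cmod (g t))\<^sup>2) \<partial>period L)"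
  proof (intro nn_integral_mono)
    fix t
    have "ennreal ((cmod (f t + g t))\<^sup>2) \<le> ennreal (2 * (cmod (f t))\<^sup>2 + 2 * (cmod (g t))\<^sup>2)"
      by (intro ennreal_leI cmod_add_square_le)
    also have "\<dots> = 2 * ennreal ((cmod (f t))\<^sup>2) + 2 * ennreal ((cmod (g t))\<^sup>2)"
      by (simp add: ennreal_mult)
    finally show "ennreal ((cmod (f t + g t))\<^sup>2)
        \<le> 2 * ennreal ((cmod (f t))\<^sup>2) + 2 * ennreal ((cmod (g t))\<^sup>2)" .
  qed
  also have "\<dots> = 2 * (\<integral>\<^sup>+t. ennreal ((cmod (f t))\<^sup>2) \<partial>period L)
      + 2 * (\<integral>\<^sup>+t. ennreal ((cmod (g t))\<^sup>2) \<partial>period L)"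
    by (subst nn_integral_add) (auto simp: nn_integral_cmult)
  finally show ?thesis .
qed

text \<open>\<open>l2_dist\<close> is the square of the distance; this accounts for the factors 2
  here and for the quarters of \<epsilon> in the approximation arguments.\<close>

lemma l2_dist_triangle:
  assumes [measurable]: "f \<in> borel_measurable borel" "g \<in> borel_measurable borel" "h \<in> borel_measurable borel"
  shows "l2_dist L f h \<le> 2 * l2_dist L f g + 2 * l2_dist L g h"
  using nn_integral_cmod_add_square_le[of "\<lambda>t. f t - g t" "\<lambda>t. g t - h t" L]
  by (simp add: l2_dist_def)

lemma trig_approx_limit:
  assumes [measurable]: "f \<in> borel_measurable borel"
    and ex: "\<And>\<epsilon>. \<epsilon> > 0 \<Longrightarrow> \<exists>g. g \<in> borel_measurable borel \<and> trig_approx L g \<and> l2_dist L f g \<le> ennreal \<epsilon>"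
  shows "trig_approx L f"
  unfolding trig_approx_def
proof (intro allI impI)
  fix \<epsilon> :: real assume \<epsilon>: "\<epsilon> > 0"
  then obtain g where g[measurable]: "g \<in> borel_measurable borel" and g2: "trig_approx L g"
      "l2_dist L f g \<le> ennreal (\<epsilon> / 4)"
    using ex[of "\<epsilon> / 4"] by auto
  obtain p where p: "trig_poly L p" "l2_dist L g p \<le> ennreal (\<epsilon> / 4)"
    using g2(1) \<epsilon> unfolding trig_approx_def by (metis divide_pos_pos zero_less_numeral)
  note [measurable] = trig_poly_measurable[OF p(1)]
  have "l2_dist L f p \<le> 2 * l2_dist L f g + 2 * l2_dist L g p"
    by (rule l2_dist_triangle) measurable
  also have "\<dots> \<le> 2 * ennreal (\<epsilon> / 4) + 2 * ennreal (\<epsilon> / 4)"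
    by (intro add_mono mult_left_mono g2 p) auto
  also have "\<dots> = ennreal \<epsilon>"
    using \<epsilon> by (simp add: mult_2 flip: ennreal_plus)
  finally show "\<exists>p. trig_poly L p \<and> l2_dist L f p \<le> ennreal \<epsilon>" using p by blast
qed

text \<open>The closure principle behind the density proof. It carries approximability from
  continuous functions to intervals, from finite to countable disjoint unions, and from simple
  functions to all of L^2.\<close>

lemma trig_approx_dominated:
  assumes [measurable]: "f \<in> borel_measurable borel" "\<And>i. s i \<in> borel_measurable borel"
      "b \<in> borel_measurable borel"
    and s: "\<And>i. trig_approx L (s i)"
    and lim: "AE t in period L. (\<lambda>i. s i t) \<longlonglongrightarrow> f t"
    and bound: "\<And>i. AE t in period L. cmod (f t - s i t) \<le> b t"
    and fin: "(\<integral>\<^sup>+t. ennreal ((b t)\<^sup>2) \<partial>period L) < \<infinity>"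
  shows "trig_approx L f"
proof (rule trig_approx_limit)
  fix \<epsilon> :: real assume "\<epsilon> > 0"
  have "(\<lambda>i. \<integral>\<^sup>+t. ennreal ((cmod (f t - s i t))\<^sup>2) \<partial>period L) \<longlonglongrightarrow> (\<integral>\<^sup>+t. 0 \<partial>period L)"
  proof (rule nn_integral_dominated_convergence[where w="\<lambda>t. ennreal ((b t)\<^sup>2)"])
    fix i show "AE t in period L. ennreal ((cmod (f t - s i t))\<^sup>2) \<le> ennreal ((b t)\<^sup>2)"
      using bound[of i] by eventually_elim (auto intro!: ennreal_leI power_mono)
  next
    show "AE t in period L. (\<lambda>i. ennreal ((cmod (f t - s i t))\<^sup>2)) \<longlonglongrightarrow> 0"
      using lim
    proof eventually_elim
      case (elim t)
      have "(\<lambda>i. (cmod (f t - s i t))\<^sup>2) \<longlonglongrightarrow> (cmod (f t - f t))\<^sup>2"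
        by (intro tendsto_intros elim)
      from tendsto_ennrealI[OF this] show ?case by simp
    qed
  qed (use fin in measurable)
  then have "(\<lambda>i. l2_dist L f (s i)) \<longlonglongrightarrow> 0" by (simp add: l2_dist_def)
  then have "eventually (\<lambda>i. l2_dist L f (s i) < ennreal \<epsilon>) sequentially"
    using \<open>\<epsilon> > 0\<close> by (intro order_tendstoD(2)) auto
  then obtain i where "l2_dist L f (s i) < ennreal \<epsilon>"
    by (auto simp: eventually_sequentially)
  then show "\<exists>g. g \<in> borel_measurable borel \<and> trig_approx L g \<and> l2_dist L f g \<le> ennreal \<epsilon>"
    using s[of i] by (intro exI[of _ "s i"]) (auto intro: less_imp_le)
qed measurable

lemma trig_poly_imp_approx: "trig_poly L p \<Longrightarrow> trig_approx L p"
  unfolding trig_approx_def by (intro allI impI exI[of _ p]) (simp add: l2_dist_def)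

lemma trig_approx_add:
  assumes [measurable]: "f \<in> borel_measurable borel" "g \<in> borel_measurable borel"
    and f: "trig_approx L f" and g: "trig_approx L g"
  shows "trig_approx L (\<lambda>t. f t + g t)"
  unfolding trig_approx_def
proof (intro allI impI)
  fix \<epsilon> :: real assume \<epsilon>: "\<epsilon> > 0"
  then have "\<epsilon> / 4 > 0" by simp
  with f g obtain p q where pq: "trig_poly L p" "l2_dist L f p \<le> ennreal (\<epsilon> / 4)"
      "trig_poly L q" "l2_dist L g q \<le> ennreal (\<epsilon> / 4)"
    unfolding trig_approx_def by blast
  note [measurable] = trig_poly_measurable[OF pq(1)] trig_poly_measurable[OF pq(3)]
  have "l2_dist L (\<lambda>t. f t + g t) (\<lambda>t. p t + q t) \<le> 2 * l2_dist L f p + 2 * l2_dist L g q"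
    using nn_integral_cmod_add_square_le[of "\<lambda>t. f t - p t" "\<lambda>t. g t - q t" L]
    by (simp add: l2_dist_def add_diff_add)
  also have "\<dots> \<le> 2 * ennreal (\<epsilon> / 4) + 2 * ennreal (\<epsilon> / 4)"
    by (intro add_mono mult_left_mono pq) auto
  also have "\<dots> = ennreal \<epsilon>"
    using \<epsilon> by (simp add: mult_2 flip: ennreal_plus)
  finally show "\<exists>p. trig_poly L p \<and> l2_dist L (\<lambda>t. f t + g t) p \<le> ennreal \<epsilon>"
    using trig_poly.add[OF pq(1,3)] by blast
qed

lemma trig_approx_cmult:
  assumes [measurable]: "f \<in> borel_measurable borel" and f: "trig_approx L f"
  shows "trig_approx L (\<lambda>t. c * f t)"
  unfolding trig_approx_def
proof (intro allI impI)
  fix \<epsilon> :: real assume \<epsilon>: "\<epsilon> > 0"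
  have c: "0 < (cmod c)\<^sup>2 + 1" by (simp add: add_nonneg_pos)
  with \<epsilon> have "\<epsilon> / ((cmod c)\<^sup>2 + 1) > 0" by simp
  with f obtain p where p: "trig_poly L p" "l2_dist L f p \<le> ennreal (\<epsilon> / ((cmod c)\<^sup>2 + 1))"
    unfolding trig_approx_def by blast
  note [measurable] = trig_poly_measurable[OF p(1)]
  have "l2_dist L (\<lambda>t. c * f t) (\<lambda>t. c * p t) = ennreal ((cmod c)\<^sup>2) * l2_dist L f p"
    unfolding l2_dist_def right_diff_distrib[symmetric] norm_mult power_mult_distrib
    by (subst ennreal_mult) (auto simp: nn_integral_cmult)
  also have "\<dots> \<le> ennreal ((cmod c)\<^sup>2) * ennreal (\<epsilon> / ((cmod c)\<^sup>2 + 1))"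
    by (intro mult_left_mono p) simp
  also have "\<dots> = ennreal ((cmod c)\<^sup>2 * (\<epsilon> / ((cmod c)\<^sup>2 + 1)))"
    using \<epsilon> c by (subst ennreal_mult) auto
  also have "\<dots> \<le> ennreal \<epsilon>"
  proof (rule ennreal_leI)
    have "(cmod c)\<^sup>2 * \<epsilon> \<le> \<epsilon> * ((cmod c)\<^sup>2 + 1)" using \<epsilon> by (simp add: algebra_simps)
    then show "(cmod c)\<^sup>2 * (\<epsilon> / ((cmod c)\<^sup>2 + 1)) \<le> \<epsilon>"
      using c by (simp add: divide_le_eq)
  qed
  finally show "\<exists>p. trig_poly L p \<and> l2_dist L (\<lambda>t. c * f t) p \<le> ennreal \<epsilon>"
    using trig_poly_cmult[OF p(1)] by blast
qed

lemma trig_approx_sum: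
  assumes "finite A" "\<And>i. i \<in> A \<Longrightarrow> f i \<in> borel_measurable borel" "\<And>i. i \<in> A \<Longrightarrow> trig_approx L (f i)"
  shows "trig_approx L (\<lambda>t. \<Sum>i\<in>A. f i t)"
  using assms
proof (induction rule: finite_induct)
  case empty
  show ?case using trig_poly_imp_approx[OF trig_poly_const[of L 0]] by simp
next
  case (insert x F)
  have "trig_approx L (\<lambda>t. f x t + (\<Sum>i\<in>F. f i t))"
    using insert by (intro trig_approx_add borel_measurable_sum) auto
  with insert(1,2) show ?case by simp
qed

lemma emeasure_period: "L > 0 \<Longrightarrow> emeasure (period L) {0..<L} = ennreal L"
  by (simp add: emeasure_restrict_space)

lemma AE_period_iff: "(AE t in period L. P t) \<longleftrightarrow> (AE t in lborel. t \<in> {0..<L} \<longrightarrow> P t)"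
  by (rule AE_restrict_space_iff) simp

lemma trig_approx_cong_AE:
  assumes "AE t in period L. f t = g t" "trig_approx L g"
  shows "trig_approx L f"
proof -
  have "l2_dist L f p = l2_dist L g p" for p
    unfolding l2_dist_def using assms(1) by (intro nn_integral_cong_AE) (auto elim: eventually_mono)
  with assms(2) show ?thesis by (simp add: trig_approx_def)
qed

lemma trig_approx_continuous:
  fixes F :: "complex \<Rightarrow> real"
  assumes L: "L > 0" and F: "continuous_on (sphere 0 1) F"
  shows "trig_approx L (\<lambda>t. of_real (F (fchar L 1 t)))"
  unfolding trig_approx_def
proof (intro allI impI)
  fix \<epsilon> :: real assume \<epsilon>: "\<epsilon> > 0"
  \<comment> \<open>A uniform error e has squared L^2 size L e^2 = \<epsilon> over one
    period.\<close>
  define e where "e = sqrt (\<epsilon> / L)"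
  have e: "e > 0" using \<epsilon> L by (simp add: e_def)
  obtain g where g: "real_polynomial_function g" "\<And>z. z \<in> sphere 0 1 \<Longrightarrow> \<bar>F z - g z\<bar> < e"
    using Stone_Weierstrass_real_polynomial_function[OF compact_sphere F e] by blast
  have "l2_dist L (\<lambda>t. of_real (F (fchar L 1 t))) (\<lambda>t. of_real (g (fchar L 1 t)))
      \<le> (\<integral>\<^sup>+t. ennreal (e\<^sup>2) \<partial>period L)"
    unfolding l2_dist_def
  proof (intro nn_integral_mono ennreal_leI power_mono)
    fix t
    have "\<bar>F (fchar L 1 t) - g (fchar L 1 t)\<bar> < e" by (rule g) simp
    then show "cmod (of_real (F (fchar L 1 t)) - of_real (g (fchar L 1 t))) \<le> e"
      by (simp flip: of_real_diff)
  qed simp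
  also have "\<dots> = ennreal \<epsilon>"
    using L \<epsilon> by (simp add: emeasure_period e_def flip: ennreal_mult)
  finally show "\<exists>p. trig_poly L p \<and> l2_dist L (\<lambda>t. of_real (F (fchar L 1 t))) p \<le> ennreal \<epsilon>"
    using trig_poly_real_polynomial[OF g(1)] by blast
qed

text \<open>An open arc is the part of the circle on one side of its chord. The affine function
  \<open>G\<close> measures the signed distance to that chord, and min 1 (i * max 0 G) is continuous
  on the circle and increases to the indicator of the arc.\<close>

lemma trig_approx_indicator_interval:
  assumes c: "0 < c" "c \<le> L"
  shows "trig_approx L (\<lambda>t. indicator {0<..<c} t)"
proof -
  have L: "L > 0" using c by simp
  define \<gamma> where "\<gamma> = 2 * pi * c / L"
  define G where "G z = Re z * cos (\<gamma> / 2) + Im z * sin (\<gamma> / 2) - cos (\<gamma> / 2)" for z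
  define s where "s i t = complex_of_real (min 1 (real i * max 0 (G (fchar L 1 t))))" for i t
  have cont: "continuous_on A (\<lambda>z. min 1 (real i * max 0 (G z)))" for A i
    unfolding G_def by (intro continuous_intros)
  \<comment> \<open>The factorised form shows the sign: both sines are positive exactly for 0 < t <
    c within the period, and beyond c the second one is not positive.\<close>
  have G_eq: "G (fchar L 1 t) = 2 * sin (pi * t / L) * sin (pi * (c - t) / L)" for t
  proof -
    have "G (fchar L 1 t) = cos (2 * pi * t / L - \<gamma> / 2) - cos (\<gamma> / 2)"
      by (simp add: G_def fchar_def cos_diff)
    also have "\<dots> = 2 * sin (pi * t / L) * sin (pi * (c - t) / L)"
    proof -
      have "(2 * pi * t / L - \<gamma> / 2 + \<gamma> / 2) / 2 = pi * t / L"
        "(\<gamma> / 2 - (2 * pi * t / L - \<gamma> / 2)) / 2 = pi * (c - t) / L"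
        by (simp_all add: \<gamma>_def algebra_simps diff_divide_distrib)
      then show ?thesis by (simp only: cos_diff_cos)
    qed
    finally show ?thesis .
  qed
  have G_pos: "G (fchar L 1 t) > 0" if "0 < t" "t < c" for t
  proof -
    have "0 < pi * t / L" "pi * t / L < pi" "0 < pi * (c - t) / L" "pi * (c - t) / L < pi"
      using that c L by (auto simp: divide_less_eq)
    then show ?thesis unfolding G_eq by (simp add: sin_gt_zero)
  qed
  have G_neg: "G (fchar L 1 t) \<le> 0" if "0 \<le> t" "t < L" "\<not> (0 < t \<and> t < c)" for t
  proof (cases "t = 0")
    case False
    then have "t \<ge> c" "t > 0" using that by auto
    then have "0 < pi * t / L" "pi * t / L < pi" "0 \<le> pi * (t - c) / L" "pi * (t - c) / L \<le> pi"
      using that c L by (auto simp: divide_less_eq divide_le_eq)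
    then have "0 \<le> sin (pi * t / L) * sin (pi * (t - c) / L)"
      by (intro mult_nonneg_nonneg sin_ge_zero) auto
    moreover have "sin (pi * (c - t) / L) = - sin (pi * (t - c) / L)"
      by (subst sin_minus[symmetric]) (simp add: algebra_simps diff_divide_distrib)
    ultimately show ?thesis unfolding G_eq by simp
  qed (simp add: G_eq)
  have meas: "s i \<in> borel_measurable borel" for i
    unfolding s_def[abs_def] G_def by measurable
  have dom: "AE t in period L. P t" if "\<And>t. 0 \<le> t \<Longrightarrow> t < L \<Longrightarrow> P t" for P
    using that by (intro AE_I2) (auto simp: space_restrict_space)
  show ?thesis
  proof (rule trig_approx_dominated[where s=s and b="\<lambda>_. 1"])
    show "trig_approx L (s i)" for i
      unfolding s_def[abs_def] by (rule trig_approx_continuous[OF L cont])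
    show "AE t in period L. (\<lambda>i. s i t) \<longlonglongrightarrow> indicator {0<..<c} t"
    proof (rule dom)
      fix t assume t: "0 \<le> t" "t < L"
      show "(\<lambda>i. s i t) \<longlonglongrightarrow> indicator {0<..<c} t"
      proof (cases "0 < t \<and> t < c")
        case True
        then have g: "G (fchar L 1 t) > 0" using G_pos by auto
        then obtain N :: nat where N: "1 < real N * G (fchar L 1 t)"
          using reals_Archimedean3 by blast
        have "eventually (\<lambda>i. s i t = 1) sequentially"
          using eventually_ge_at_top[of N]
        proof eventually_elim
          case (elim i)
          have "real N * G (fchar L 1 t) \<le> real i * G (fchar L 1 t)"
            using elim g by (intro mult_right_mono) auto
          with N have "1 \<le> real i * G (fchar L 1 t)" by linarith
          with g show ?case by (simp add: s_def min_absorb1)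
        qed
        with True show ?thesis by (auto intro: tendsto_eventually)
      next
        case False
        then have "G (fchar L 1 t) \<le> 0" using G_neg t by blast
        then have "s i t = 0" for i by (simp add: s_def max_absorb1)
        with False show ?thesis by auto
      qed
    qed
    show "AE t in period L. cmod (indicator {0<..<c} t - s i t) \<le> 1" for i
    proof (rule dom)
      fix t
      have "cmod (indicator {0<..<c} t - of_real r) \<le> 1" if "0 \<le> r" "r \<le> 1" for r
      proof -
        have "cmod (1 - of_real r) = \<bar>1 - r\<bar>"
          by (metis norm_of_real of_real_1 of_real_diff)
        with that show ?thesis by (cases "t \<in> {0<..<c}") auto
      qed
      from this[of "min 1 (real i * max 0 (G (fchar L 1 t)))"]
      show "cmod (indicator {0<..<c} t - s i t) \<le> 1"
        unfolding s_def by simp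
    qed
    show "(\<integral>\<^sup>+t. ennreal (1\<^sup>2) \<partial>period L) < \<infinity>"
      using L by (simp add: emeasure_period)
  qed (use meas in measurable)
qed

lemma trig_approx_zero: "trig_approx L (\<lambda>t. 0)"
  by (rule trig_poly_imp_approx[OF trig_poly_const])

text \<open>Induction over the Borel sets from the intersection-stable generator of half lines.
  Within one period a half line is an interval starting at 0, up to the null set {0}.\<close>

lemma trig_approx_indicator:
  assumes L: "L > 0" and A: "A \<in> sets borel"
  shows "trig_approx L (\<lambda>t. indicator A t)"
proof -
  have sets: "sets borel = sigma_sets UNIV (range (lessThan :: real \<Rightarrow> real set))"
    unfolding borel_Iio by simp
  have "Int_stable (range (lessThan :: real \<Rightarrow> real set))"
  proof (rule Int_stableI, clarify)
    fix a b :: real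
    show "{..<a} \<inter> {..<b} \<in> range lessThan"
      by (rule range_eqI[of _ _ "min a b"]) auto
  qed
  moreover have "range (lessThan :: real \<Rightarrow> real set) \<subseteq> Pow UNIV" by simp
  ultimately show ?thesis using A unfolding sets
  proof (induction rule: sigma_sets_induct_disjoint)
    case (basic A)
    then obtain c where A: "A = {..<c}" by auto
    show ?case
    proof (cases "0 < c")
      case True
      show ?thesis
      proof (rule trig_approx_cong_AE)
        show "trig_approx L (\<lambda>t. indicator {0<..<min c L} t)"
          using True L by (intro trig_approx_indicator_interval) auto
        show "AE t in period L. indicator A t = indicator {0<..<min c L} t"
          unfolding AE_period_iff using AE_lborel_singleton[of 0]
          by eventually_elim (auto simp: A indicator_def)
      qed
    next
      case False
      show ?thesis
        by (rule trig_approx_cong_AE[OF _ trig_approx_zero])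
           (use False in \<open>auto simp: AE_period_iff A indicator_def\<close>)
    qed
  next
    case empty
    show ?case using trig_approx_zero by simp
  next
    case (compl A)
    then have [measurable]: "A \<in> sets borel" unfolding sets by simp
    have "trig_approx L (\<lambda>t. 1 + (- 1) * indicator A t)"
      by (intro trig_approx_add trig_approx_cmult compl trig_poly_imp_approx trig_poly_const) measurable
    moreover have "(\<lambda>t. 1 + (- 1) * indicator A t) = (\<lambda>t. indicator (UNIV - A) t :: complex)"
      by (auto simp: fun_eq_iff indicator_def)
    ultimately show ?case by simp
  next
    case (union A)
    then have [measurable]: "A i \<in> sets borel" for i unfolding sets by auto
    define s :: "nat \<Rightarrow> real \<Rightarrow> complex" where "s n t = (\<Sum>i<n. indicator (A i) t)" for n t
    have s_eq: "s n t = indicator (\<Union>i<n. A i) t" for n t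
    proof -
      have "disjoint_family_on A {..<n}"
        using union(1) by (auto simp: disjoint_family_on_def)
      then show ?thesis unfolding s_def by (subst indicator_UN_disjoint) auto
    qed
    show ?case
    proof (rule trig_approx_dominated[where s=s and b="\<lambda>_. 1"])
      show "trig_approx L (s n)" for n
        unfolding s_def[abs_def] by (intro trig_approx_sum union) auto
      show "AE t in period L. (\<lambda>n. s n t) \<longlonglongrightarrow> indicator (\<Union>i. A i) t"
        unfolding s_eq by (intro AE_I2 LIMSEQ_indicator_UN)
      show "AE t in period L. cmod (indicator (\<Union>i. A i) t - s n t) \<le> 1" for n
        by (intro AE_I2) (auto simp: s_eq indicator_def)
      show "(\<integral>\<^sup>+t. ennreal (1\<^sup>2) \<partial>period L) < \<infinity>"
        using L by (simp add: emeasure_period)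
      show "s n \<in> borel_measurable borel" for n
        unfolding s_def[abs_def] by measurable
    qed measurable
  qed
qed

text \<open>Simple functions converge to h pointwise with |s| <= 2|h|, so 3|h| dominates the error
  and its square is integrable.\<close>

lemma trig_approx_L2:
  assumes L: "L > 0" and [measurable]: "h \<in> borel_measurable borel"
    and fin: "(\<integral>\<^sup>+t. ennreal ((cmod (h t))\<^sup>2) \<partial>period L) < \<infinity>"
  shows "trig_approx L h"
proof -
  obtain s where s: "\<And>i. simple_function borel (s i)" "\<And>t. (\<lambda>i. s i t) \<longlonglongrightarrow> h t"
      "\<And>i t. cmod (s i t) \<le> 2 * cmod (h t)"
    using borel_measurable_implies_sequence_metric[of h borel 0] by (auto simp: dist_norm)
  have s_meas: "s i \<in> borel_measurable borel" for i
    using s(1) by (rule borel_measurable_simple_function)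
  show ?thesis
  proof (rule trig_approx_dominated[where s=s and b="\<lambda>t. 3 * cmod (h t)"])
    show "trig_approx L (s i)" for i
    proof -
      have fin_i: "finite (range (s i))" using s(1)[of i] by (simp add: simple_function_def)
      have [measurable]: "s i -` {y} \<in> sets borel" for y
        using s(1)[of i] by (simp add: simple_function_def) (metis fin_i measurable_sets_borel s_meas
            borel_closed closed_singleton)
      have "s i = (\<lambda>t. \<Sum>y\<in>range (s i). y * indicator (s i -` {y}) t)"
      proof
        fix t
        have "(\<Sum>y\<in>range (s i). y * indicator (s i -` {y}) t) = (\<Sum>y\<in>{s i t}. y * indicator (s i -` {y}) t)"
          using fin_i by (intro sum.mono_neutral_right) (auto simp: indicator_def)
        then show "s i t = (\<Sum>y\<in>range (s i). y * indicator (s i -` {y}) t)" by simp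
      qed
      moreover have "trig_approx L (\<lambda>t. \<Sum>y\<in>range (s i). y * indicator (s i -` {y}) t)"
        using fin_i by (intro trig_approx_sum trig_approx_cmult trig_approx_indicator L) auto
      ultimately show ?thesis by simp
    qed
    show "AE t in period L. (\<lambda>i. s i t) \<longlonglongrightarrow> h t" using s(2) by simp
    show "AE t in period L. cmod (h t - s i t) \<le> 3 * cmod (h t)" for i
    proof (intro AE_I2)
      fix t show "cmod (h t - s i t) \<le> 3 * cmod (h t)"
        using norm_triangle_ineq4[of "h t" "s i t"] s(3)[of i t] by linarith
    qed
    have "(\<integral>\<^sup>+t. ennreal ((3 * cmod (h t))\<^sup>2) \<partial>period L)
        = 9 * (\<integral>\<^sup>+t. ennreal ((cmod (h t))\<^sup>2) \<partial>period L)"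
      by (simp add: power_mult_distrib ennreal_mult nn_integral_cmult)
    also have "\<dots> < \<infinity>" using fin by (simp add: ennreal_mult_less_top)
    finally show "(\<integral>\<^sup>+t. ennreal ((3 * cmod (h t))\<^sup>2) \<partial>period L) < \<infinity>" .
  qed (use s_meas in measurable)
qed

section \<open>Fourier coefficients and Parseval's identity\<close>

definition fourier_coeff :: "real \<Rightarrow> (real \<Rightarrow> complex) \<Rightarrow> int \<Rightarrow> complex" where
  "fourier_coeff L h n = (\<integral>t. h t * fchar L (- n) t \<partial>period L)"

lemma integrable_mult_L2:
  fixes f g :: "'a \<Rightarrow> complex"
  assumes [measurable]: "f \<in> borel_measurable M" "g \<in> borel_measurable M"
    and "integrable M (\<lambda>t. (cmod (f t))\<^sup>2)" "integrable M (\<lambda>t. (cmod (g t))\<^sup>2)"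
  shows "integrable M (\<lambda>t. f t * g t)"
proof (rule Bochner_Integration.integrable_bound)
  show "integrable M (\<lambda>t. (cmod (f t))\<^sup>2 + (cmod (g t))\<^sup>2)"
    using assms by simp
  show "AE t in M. norm (f t * g t) \<le> norm ((cmod (f t))\<^sup>2 + (cmod (g t))\<^sup>2)"
  proof (rule AE_I2)
    fix t
    have "2 * (cmod (f t) * cmod (g t)) \<le> (cmod (f t))\<^sup>2 + (cmod (g t))\<^sup>2"
      using sum_squares_bound[of "cmod (f t)" "cmod (g t)"] by simp
    moreover have "0 \<le> cmod (f t) * cmod (g t)" by simp
    ultimately have "cmod (f t) * cmod (g t) \<le> (cmod (f t))\<^sup>2 + (cmod (g t))\<^sup>2"
      by linarith
    then show "norm (f t * g t) \<le> norm ((cmod (f t))\<^sup>2 + (cmod (g t))\<^sup>2)"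
      by (simp add: norm_mult)
  qed
qed measurable

text \<open>Expansion by orthogonality and completion of the square in each c_n. One identity yields
  both halves of Parseval: the best choice of c gives Bessel's inequality, and dropping the last
  nonnegative sum bounds the approximation error from below for any c.\<close>

lemma fourier_distance:
  assumes L: "L > 0" and [measurable]: "h \<in> borel_measurable borel"
    and int: "integrable (period L) (\<lambda>t. (cmod (h t))\<^sup>2)" and F: "finite F"
  shows "(\<integral>t. (cmod (h t - (\<Sum>n\<in>F. c n * fchar L n t)))\<^sup>2 \<partial>period L)
    = (\<integral>t. (cmod (h t))\<^sup>2 \<partial>period L) - (\<Sum>n\<in>F. (cmod (fourier_coeff L h n))\<^sup>2) / L
      + L * (\<Sum>n\<in>F. (cmod (c n - fourier_coeff L h n / L))\<^sup>2)"
proof -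
  interpret finite_measure "period L" by (rule finite_measure_period)
  let ?p = "\<lambda>t. \<Sum>n\<in>F. c n * fchar L n t"
  let ?q = "\<lambda>t. \<Sum>n\<in>F. cnj (c n) * fchar L (- n) t"
  have q: "cnj (?p t) = ?q t" for t by (simp add: fchar_cnj)
  have int_char: "integrable (period L) (\<lambda>t. h t * fchar L n t)" for n
    by (rule integrable_mult_L2) (use int in simp_all)
  have int_c: "integrable (period L) (fchar L n)" for n
    by (rule integrable_const_bound[where B=1]) simp_all
  have sq: "complex_of_real ((cmod (h t - ?p t))\<^sup>2)
      = of_real ((cmod (h t))\<^sup>2) - h t * ?q t - cnj (h t * ?q t) + ?p t * ?q t" for t
    unfolding complex_norm_square q[symmetric] by (simp add: algebra_simps)
  have hq: "(\<integral>t. h t * ?q t \<partial>period L) = (\<Sum>n\<in>F. cnj (c n) * fourier_coeff L h n)"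
    and int_hq: "integrable (period L) (\<lambda>t. h t * ?q t)"
  proof -
    have eq: "h t * ?q t = (\<Sum>n\<in>F. cnj (c n) * (h t * fchar L (- n) t))" for t
      by (simp add: sum_distrib_left mult_ac)
    show "integrable (period L) (\<lambda>t. h t * ?q t)"
      unfolding eq by (intro Bochner_Integration.integrable_sum integrable_mult_right int_char)
    show "(\<integral>t. h t * ?q t \<partial>period L) = (\<Sum>n\<in>F. cnj (c n) * fourier_coeff L h n)"
      unfolding eq fourier_coeff_def
      by (subst Bochner_Integration.integral_sum) (auto intro!: int_char)
  qed
  have pq: "(\<integral>t. ?p t * ?q t \<partial>period L) = (\<Sum>n\<in>F. of_real (L * (cmod (c n))\<^sup>2))"
    and int_pq: "integrable (period L) (\<lambda>t. ?p t * ?q t)"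
  proof -
    have eq: "?p t * ?q t = (\<Sum>n\<in>F. \<Sum>m\<in>F. c n * cnj (c m) * fchar L (n - m) t)" for t
    proof -
      have "fchar L (n - m) t = fchar L n t * fchar L (- m) t" for n m
        by (simp add: fchar_mult)
      then show ?thesis by (simp add: sum_product mult_ac)
    qed
    show "integrable (period L) (\<lambda>t. ?p t * ?q t)"
      unfolding eq by (intro Bochner_Integration.integrable_sum integrable_mult_right int_c)
    have "(\<integral>t. ?p t * ?q t \<partial>period L)
        = (\<Sum>n\<in>F. \<Sum>m\<in>F. c n * cnj (c m) * (\<integral>t. fchar L (n - m) t \<partial>period L))"
      unfolding eq
      by (subst Bochner_Integration.integral_sum, intro Bochner_Integration.integrable_sum integrable_mult_right int_c,
          intro sum.cong refl, subst Bochner_Integration.integral_sum) (auto intro!: int_c)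
    also have "\<dots> = (\<Sum>n\<in>F. \<Sum>m\<in>F. if n = m then of_real L * (c n * cnj (c n)) else 0)"
      by (intro sum.cong refl) (simp add: integral_fchar[OF L] mult_ac)
    also have "\<dots> = (\<Sum>n\<in>F. of_real (L * (cmod (c n))\<^sup>2))"
      using F by (simp flip: complex_norm_square)
    finally show "(\<integral>t. ?p t * ?q t \<partial>period L) = (\<Sum>n\<in>F. of_real (L * (cmod (c n))\<^sup>2))" .
  qed
  have "complex_of_real (\<integral>t. (cmod (h t - ?p t))\<^sup>2 \<partial>period L)
      = (\<integral>t. of_real ((cmod (h t))\<^sup>2) - h t * ?q t - cnj (h t * ?q t) + ?p t * ?q t \<partial>period L)"
    unfolding sq[symmetric] by (rule integral_complex_of_real[symmetric])
  also have "\<dots> = of_real (\<integral>t. (cmod (h t))\<^sup>2 \<partial>period L)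
      - (\<Sum>n\<in>F. cnj (c n) * fourier_coeff L h n) - cnj (\<Sum>n\<in>F. cnj (c n) * fourier_coeff L h n)
      + (\<Sum>n\<in>F. of_real (L * (cmod (c n))\<^sup>2))"
  proof -
    have i1: "integrable (period L) (\<lambda>t. complex_of_real ((cmod (h t))\<^sup>2))"
      using int by (simp only: complex_of_real_integrable_eq)
    have i2: "integrable (period L) (\<lambda>t. cnj (h t * ?q t))"
      using int_hq by (rule integrable_cnj)
    show ?thesis
      using i1 i2 int_hq int_pq
      by (simp only: Bochner_Integration.integral_add Bochner_Integration.integral_diff
          Bochner_Integration.integrable_diff Bochner_Integration.integrable_add
          Bochner_Integration.integral_cnj hq pq integral_complex_of_real)
  qed
  also have "\<dots> = of_real ((\<integral>t. (cmod (h t))\<^sup>2 \<partial>period L) - (\<Sum>n\<in>F. (cmod (fourier_coeff L h n))\<^sup>2) / L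
      + L * (\<Sum>n\<in>F. (cmod (c n - fourier_coeff L h n / L))\<^sup>2))"
  proof -
    have "- (cnj x * y) - x * cnj y + of_real (L * (cmod x)\<^sup>2)
        = of_real (- ((cmod y)\<^sup>2 / L) + L * (cmod (x - y / L))\<^sup>2)" for x y :: complex
      using L
      by (simp only: of_real_add of_real_minus of_real_divide of_real_mult complex_norm_square
          complex_cnj_diff complex_cnj_divide complex_cnj_complex_of_real) (simp add: field_simps)
    then have "(\<Sum>n\<in>F. - (cnj (c n) * fourier_coeff L h n) - c n * cnj (fourier_coeff L h n)
          + of_real (L * (cmod (c n))\<^sup>2))
        = (\<Sum>n\<in>F. of_real (- ((cmod (fourier_coeff L h n))\<^sup>2 / L)
          + L * (cmod (c n - fourier_coeff L h n / L))\<^sup>2))"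
      by (intro sum.cong refl) blast
    then show ?thesis
      by (simp add: sum.distrib sum_subtractf sum_negf sum_divide_distrib sum_distrib_left algebra_simps)
  qed
  finally show ?thesis by (simp only: of_real_eq_iff)
qed

text \<open>The coefficients are integrals without a factor 1/L, so that they can coincide with
  inner products against time-frequency shifts; the price is the factor L on the right.\<close>

theorem parseval:
  assumes L: "L > 0" and [measurable]: "h \<in> borel_measurable borel"
    and fin: "(\<integral>\<^sup>+t. ennreal ((cmod (h t))\<^sup>2) \<partial>period L) < \<infinity>"
  shows "(\<integral>\<^sup>+n. ennreal ((cmod (fourier_coeff L h n))\<^sup>2) \<partial>zcount)
    = ennreal L * (\<integral>\<^sup>+t. ennreal ((cmod (h t))\<^sup>2) \<partial>period L)"
proof -
  define H where "H = (\<integral>t. (cmod (h t))\<^sup>2 \<partial>period L)"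
  let ?a = "\<lambda>n. (cmod (fourier_coeff L h n))\<^sup>2"
  have int: "integrable (period L) (\<lambda>t. (cmod (h t))\<^sup>2)"
    using fin by (intro integrableI_bounded) simp_all
  have H: "(\<integral>\<^sup>+t. ennreal ((cmod (h t))\<^sup>2) \<partial>period L) = ennreal H"
    unfolding H_def by (rule nn_integral_eq_integral[OF int]) simp
  have H0: "0 \<le> H" unfolding H_def by simp
  have S: "(\<integral>\<^sup>+n. ennreal (?a n) \<partial>zcount) = (SUP F\<in>{F. finite F \<and> F \<subseteq> UNIV}. \<Sum>n\<in>F. ennreal (?a n))"
    by (rule nn_integral_count_space_SUP) (auto simp: infinite_UNIV_int)
  have "(\<integral>\<^sup>+n. ennreal (?a n) \<partial>zcount) \<le> ennreal (L * H)"
    unfolding S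
  proof (rule SUP_least, clarify)
    fix F :: "int set" assume F: "finite F"
    \<comment> \<open>The coefficients are those of the orthogonal projection, for which the
      completed squares vanish.\<close>
    have "0 \<le> (\<integral>t. (cmod (h t - (\<Sum>n\<in>F. (fourier_coeff L h n / L) * fchar L n t)))\<^sup>2 \<partial>period L)"
      by simp
    also have "\<dots> = H - (\<Sum>n\<in>F. ?a n) / L"
      unfolding fourier_distance[OF L assms(2) int F] by (simp add: H_def)
    finally have "(\<Sum>n\<in>F. ?a n) \<le> L * H" using L by (simp add: field_simps)
    then show "(\<Sum>n\<in>F. ennreal (?a n)) \<le> ennreal (L * H)"
      by (simp add: ennreal_leI)
  qed
  moreover have "ennreal (L * H) \<le> (\<integral>\<^sup>+n. ennreal (?a n) \<partial>zcount)"
  proof (rule ennreal_le_epsilon)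
    fix e :: real assume e: "0 < e"
    then have "e / L > 0" using L by simp
    with trig_approx_L2[OF L assms(2) fin] obtain p where p: "trig_poly L p" "l2_dist L h p \<le> ennreal (e / L)"
      unfolding trig_approx_def by blast
    obtain F c where F: "finite F" and p_eq: "p = (\<lambda>t. \<Sum>n\<in>F. c n * fchar L n t)"
      using trig_poly_normal_form[OF p(1)] by blast
    note [measurable] = trig_poly_measurable[OF p(1)]
    let ?I = "\<integral>t. (cmod (h t - p t))\<^sup>2 \<partial>period L"
    have intp: "integrable (period L) (\<lambda>t. (cmod (h t - p t))\<^sup>2)"
      using p(2) unfolding l2_dist_def
      by (intro integrableI_bounded) (auto intro: le_less_trans[OF _ ennreal_less_top])
    have "ennreal ?I \<le> ennreal (e / L)"
      using p(2) unfolding l2_dist_def by (subst nn_integral_eq_integral[OF intp, symmetric]) simp_all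
    then have "?I \<le> e / L" using \<open>e / L > 0\<close> by (simp add: ennreal_le_iff)
    moreover have "?I \<ge> H - (\<Sum>n\<in>F. ?a n) / L"
    proof -
      have "?I = H - (\<Sum>n\<in>F. ?a n) / L + L * (\<Sum>n\<in>F. (cmod (c n - fourier_coeff L h n / L))\<^sup>2)"
        unfolding p_eq fourier_distance[OF L assms(2) int F] by (simp add: H_def)
      moreover have "0 \<le> L * (\<Sum>n\<in>F. (cmod (c n - fourier_coeff L h n / L))\<^sup>2)"
        using L by (intro mult_nonneg_nonneg sum_nonneg) auto
      ultimately show ?thesis by linarith
    qed
    ultimately have "H - (\<Sum>n\<in>F. ?a n) / L \<le> e / L" by linarith
    from mult_left_mono[OF this, of L] have "L * H \<le> (\<Sum>n\<in>F. ?a n) + e"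
      using L by (simp add: right_diff_distrib)
    then have "ennreal (L * H) \<le> ennreal ((\<Sum>n\<in>F. ?a n) + e)" by (rule ennreal_leI)
    also have "\<dots> = (\<Sum>n\<in>F. ennreal (?a n)) + ennreal e"
      using e by (simp add: ennreal_plus sum_nonneg)
    also have "\<dots> \<le> (\<integral>\<^sup>+n. ennreal (?a n) \<partial>zcount) + ennreal e"
      unfolding S using F by (intro add_right_mono SUP_upper) simp
    finally show "ennreal (L * H) \<le> (\<integral>\<^sup>+n. ennreal (?a n) \<partial>zcount) + ennreal e" .
  qed
  ultimately show ?thesis
    unfolding H using L H0 by (simp add: ennreal_mult antisym)
qed

section \<open>Reduction of the frame sum to fibres\<close>

lemma measurable_shift_zcount [measurable]:
  "(\<lambda>(t, k). t + real_of_int k / a) \<in> borel_measurable (borel \<Otimes>\<^sub>M zcount)"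
proof -
  have [measurable]: "(\<lambda>k. real_of_int k / a) \<in> borel_measurable zcount" by simp
  show ?thesis unfolding split_beta by measurable
qed

lemma measurable_shift_period [measurable]:
  "(\<lambda>(t, k). t + real_of_int k / a) \<in> borel_measurable (period L \<Otimes>\<^sub>M zcount)"
proof -
  have [measurable]: "(\<lambda>k. real_of_int k / a) \<in> borel_measurable zcount" by simp
  have [measurable]: "(\<lambda>t. t) \<in> borel_measurable (period L)" by (rule measurable_period) simp
  have "(\<lambda>x. fst x) \<in> borel_measurable (period L \<Otimes>\<^sub>M zcount)"
    by (rule measurable_compose[OF measurable_fst]) measurable
  then show ?thesis unfolding split_beta by measurable
qed

text \<open>Every real t lies in exactly one translate of [0, 1/a) by a multiple of 1/a, the one
  with index \<lfloor>a * t\<rfloor>; Tonelli and translation invariance do the rest.\<close>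

lemma nn_integral_periodise:
  assumes a: "a > 0" and [measurable]: "f \<in> borel_measurable borel"
  shows "(\<integral>\<^sup>+t. f t \<partial>lborel) = (\<integral>\<^sup>+t. (\<integral>\<^sup>+k. f (t + of_int k / a) \<partial>zcount) \<partial>period (1 / a))"
proof -
  have one: "(\<integral>\<^sup>+k. indicator {0..<1 / a} (t - of_int k / a) \<partial>zcount) = (1 :: ennreal)" for t
  proof -
    have "indicator {0..<1 / a} (t - of_int k / a) = (indicator {\<lfloor>a * t\<rfloor>} k :: ennreal)" for k :: int
    proof -
      have "t - of_int k / a \<in> {0..<1 / a} \<longleftrightarrow> of_int k \<le> a * t \<and> a * t < of_int k + 1"
      proof -
        have "t - of_int k / a = (a * t - of_int k) / a" using a by (simp add: field_simps)
        then show ?thesis using a by (auto simp: zero_le_divide_iff divide_less_cancel)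
      qed
      also have "\<dots> \<longleftrightarrow> k = \<lfloor>a * t\<rfloor>" by linarith
      finally show ?thesis by (auto simp: indicator_def)
    qed
    then show ?thesis by simp
  qed
  have "(\<integral>\<^sup>+t. (\<integral>\<^sup>+k. f (t + of_int k / a) \<partial>zcount) \<partial>period (1 / a))
      = (\<integral>\<^sup>+t. (\<integral>\<^sup>+k. f (t + of_int k / a) * indicator {0..<1 / a} t \<partial>zcount) \<partial>lborel)"
    by (simp add: nn_integral_restrict_space nn_integral_multc)
  also have "\<dots> = (\<integral>\<^sup>+k. (\<integral>\<^sup>+t. f (t + of_int k / a) * indicator {0..<1 / a} t \<partial>lborel) \<partial>zcount)"
    by (rule nn_integral_count_space_nn_integral) simp_all
  also have "\<dots> = (\<integral>\<^sup>+k. (\<integral>\<^sup>+t. f t * indicator {0..<1 / a} (t - of_int k / a) \<partial>lborel) \<partial>zcount)"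
  proof (rule nn_integral_cong)
    fix k :: int
    show "(\<integral>\<^sup>+t. f (t + of_int k / a) * indicator {0..<1 / a} t \<partial>lborel)
        = (\<integral>\<^sup>+t. f t * indicator {0..<1 / a} (t - of_int k / a) \<partial>lborel)"
      using nn_integral_real_affine[of "\<lambda>t. f t * indicator {0..<1 / a} (t - of_int k / a)" 1 "of_int k / a"]
      by (simp add: add.commute)
  qed
  also have "\<dots> = (\<integral>\<^sup>+t. (\<integral>\<^sup>+k. f t * indicator {0..<1 / a} (t - of_int k / a) \<partial>zcount) \<partial>lborel)"
    by (rule nn_integral_count_space_nn_integral[symmetric]) simp_all
  also have "\<dots> = (\<integral>\<^sup>+t. f t \<partial>lborel)"
    by (simp add: nn_integral_cmult one)
  finally show ?thesis by simp
qed

text \<open>The measure-theoretic form of periodisation: the line is the product of one period with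
  the integers. It lets complex integrals be folded by change of variables and Fubini.\<close>

lemma distr_period_zcount:
  assumes a: "a > 0"
  shows "distr (period (1 / a) \<Otimes>\<^sub>M zcount) lborel (\<lambda>(t, k). t + of_int k / a) = lborel"
proof (rule measure_eqI)
  fix A assume "A \<in> sets (distr (period (1 / a) \<Otimes>\<^sub>M zcount) lborel (\<lambda>(t, k). t + of_int k / a))"
  then have [measurable]: "A \<in> sets borel" by simp
  let ?\<phi> = "\<lambda>(t, k). t + real_of_int k / a"
  let ?D = "distr (period (1 / a) \<Otimes>\<^sub>M zcount) lborel ?\<phi>"
  have "emeasure ?D A = (\<integral>\<^sup>+x. indicator A x \<partial>?D)"
    by (rule nn_integral_indicator[symmetric]) simp
  also have "\<dots> = (\<integral>\<^sup>+z. indicator A (?\<phi> z) \<partial>(period (1 / a) \<Otimes>\<^sub>M zcount))"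
    by (rule nn_integral_distr) simp_all
  also have "\<dots> = (\<integral>\<^sup>+t. (\<integral>\<^sup>+k. indicator A (t + of_int k / a) \<partial>zcount) \<partial>period (1 / a))"
    by (subst sigma_finite_measure.nn_integral_fst[OF sigma_finite_zcount, symmetric]) simp_all
  also have "\<dots> = (\<integral>\<^sup>+t. indicator A t \<partial>lborel)"
    by (rule nn_integral_periodise[OF a, symmetric]) simp
  also have "\<dots> = emeasure lborel A" by simp
  finally show "emeasure ?D A = emeasure lborel A" .
qed simp

lemma integral_periodise:
  fixes f :: "real \<Rightarrow> complex"
  assumes a: "a > 0" and f: "integrable lborel f"
  shows "(\<integral>t. f t \<partial>lborel) = (\<integral>t. (\<integral>k. f (t + of_int k / a) \<partial>zcount) \<partial>period (1 / a))"
proof -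
  interpret M1: finite_measure "period (1 / a)" by (rule finite_measure_period)
  interpret M2: sigma_finite_measure zcount by (rule sigma_finite_zcount)
  interpret pair_sigma_finite "period (1 / a)" zcount ..
  let ?\<phi> = "\<lambda>(t, k). t + real_of_int k / a"
  have [measurable]: "?\<phi> \<in> measurable (period (1 / a) \<Otimes>\<^sub>M zcount) lborel" by simp
  have [measurable]: "f \<in> borel_measurable lborel" using f by auto
  have int: "integrable (period (1 / a) \<Otimes>\<^sub>M zcount) (\<lambda>z. f (?\<phi> z))"
    using f by (subst integrable_distr_eq[symmetric, where N=lborel]) (simp_all add: distr_period_zcount[OF a])
  have "(\<integral>t. f t \<partial>lborel) = (\<integral>t. f t \<partial>distr (period (1 / a) \<Otimes>\<^sub>M zcount) lborel ?\<phi>)"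
    by (simp add: distr_period_zcount[OF a])
  also have "\<dots> = (\<integral>z. f (?\<phi> z) \<partial>(period (1 / a) \<Otimes>\<^sub>M zcount))"
    by (rule integral_distr) simp_all
  also have "\<dots> = (\<integral>t. (\<integral>k. f (t + of_int k / a) \<partial>zcount) \<partial>period (1 / a))"
    using integral_fst'[OF int] by simp
  finally show ?thesis .
qed

section \<open>Restriction of functions to fibres\<close>

abbreviation fibre :: "real \<Rightarrow> (real \<Rightarrow> complex) \<Rightarrow> real \<Rightarrow> int \<Rightarrow> complex" where
  "fibre a f t \<equiv> (\<lambda>k. f (t + of_int k / a))"

lemma measurable_gaussian [measurable]: "gaussian \<in> borel_measurable borel"
  unfolding gaussian_def[abs_def] by measurable

lemma L2_real_measurable: "f \<in> L2_real \<Longrightarrow> f \<in> borel_measurable borel"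
  by (simp add: L2_real_def)

lemma L2_real_nn_integral:
  assumes "f \<in> L2_real"
  shows "(\<integral>\<^sup>+t. ennreal ((cmod (f t))\<^sup>2) \<partial>lborel) = ennreal ((l2_norm f)\<^sup>2)"
proof -
  have "(l2_norm f)\<^sup>2 = (\<integral>t. (cmod (f t))\<^sup>2 \<partial>lborel)"
    by (simp add: l2_norm_def)
  with assms show ?thesis
    by (simp add: L2_real_def nn_integral_eq_integral)
qed

lemma fibre_norm:
  assumes "a > 0" "f \<in> L2_real"
  shows "(\<integral>\<^sup>+t. (\<integral>\<^sup>+k. ennreal ((cmod (fibre a f t k))\<^sup>2) \<partial>zcount) \<partial>period (1 / a)) = ennreal ((l2_norm f)\<^sup>2)"
proof -
  have [measurable]: "f \<in> borel_measurable borel" by (rule L2_real_measurable[OF assms(2)])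
  show ?thesis
    unfolding L2_real_nn_integral[OF assms(2), symmetric]
    by (rule nn_integral_periodise[OF assms(1), symmetric]) simp
qed

lemma measurable_fibre_norm:
  assumes "f \<in> L2_real"
  shows "(\<lambda>t. \<integral>\<^sup>+k. ennreal ((cmod (fibre a f t k))\<^sup>2) \<partial>zcount) \<in> borel_measurable (period L)"
proof -
  have [measurable]: "f \<in> borel_measurable borel" by (rule L2_real_measurable[OF assms])
  have "(\<lambda>z. ennreal ((cmod (f ((\<lambda>(t, k). t + real_of_int k / a) z)))\<^sup>2))
      \<in> borel_measurable (period L \<Otimes>\<^sub>M zcount)"
    by measurable
  from sigma_finite_measure.borel_measurable_nn_integral_fst[OF sigma_finite_zcount this]
  show ?thesis by simp
qed

text \<open>The left inverse acts on square-summable sequences, so the lower estimate is available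
  on almost every fibre only, which suffices for integration in t.\<close>

lemma fibre_AE_finite:
  assumes "a > 0" "f \<in> L2_real"
  shows "AE t in period (1 / a). (\<integral>\<^sup>+k. ennreal ((cmod (fibre a f t k))\<^sup>2) \<partial>zcount) < \<infinity>"
proof -
  have "AE t in period (1 / a). (\<integral>\<^sup>+k. ennreal ((cmod (fibre a f t k))\<^sup>2) \<partial>zcount) \<noteq> \<infinity>"
    by (intro nn_integral_PInf_AE measurable_fibre_norm) (simp_all add: fibre_norm[OF assms] assms)
  then show ?thesis by (auto simp: less_top)
qed

lemma measurable_fibre_sample:
  assumes [measurable]: "f \<in> borel_measurable borel"
  shows "(\<lambda>t. fibre_sample a t (fibre a f t) m) \<in> borel_measurable borel"
proof -
  have "(\<lambda>z. f ((\<lambda>(t, k). t + real_of_int k / a) z)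
      * gaussian ((\<lambda>(t, k). t + real_of_int k / a) z - a * of_int m)) \<in> borel_measurable (borel \<Otimes>\<^sub>M zcount)"
    by measurable
  then have "(\<lambda>(t, k). f (t + of_int k / a) * gaussian (t + of_int k / a - a * of_int m))
      \<in> borel_measurable (borel \<Otimes>\<^sub>M zcount)"
    by (simp add: split_beta)
  from sigma_finite_measure.borel_measurable_lebesgue_integral[OF sigma_finite_zcount this]
  show ?thesis by (simp add: fibre_sample_def)
qed

lemma measurable_fibre_sample_norm:
  assumes "f \<in> L2_real"
  shows "(\<lambda>t. \<integral>\<^sup>+m. ennreal ((cmod (fibre_sample a t (fibre a f t) m))\<^sup>2) \<partial>zcount)
    \<in> borel_measurable (period L)"
proof -
  have "(\<lambda>(t, m). fibre_sample a t (fibre a f t) m) \<in> borel_measurable (period L \<Otimes>\<^sub>M zcount)"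
    unfolding split_beta
    by (rule measurable_compose_countable'[where g=snd and I=UNIV
          and f="\<lambda>m z. fibre_sample a (fst z) (fibre a f (fst z)) m"])
       (auto intro!: measurable_compose[OF measurable_fst] measurable_period
          measurable_fibre_sample L2_real_measurable[OF assms])
  then have "(\<lambda>z. ennreal ((cmod ((\<lambda>(t, m). fibre_sample a t (fibre a f t) m) z))\<^sup>2))
      \<in> borel_measurable (period L \<Otimes>\<^sub>M zcount)"
    by measurable
  from sigma_finite_measure.borel_measurable_nn_integral_fst[OF sigma_finite_zcount this]
  show ?thesis by simp
qed

text \<open>Folding onto a period of length 1 reduces integrability to the lattice sums already
  estimated, since the square of a number in [0, 1] is at most the number itself.\<close>

lemma gaussian_L2: "integrable lborel (\<lambda>t. (cmod (gaussian (t + x)))\<^sup>2)"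
proof (rule integrableI_bounded)
  have "(\<integral>\<^sup>+t. ennreal (norm ((cmod (gaussian (t + x)))\<^sup>2)) \<partial>lborel)
      = (\<integral>\<^sup>+t. (\<integral>\<^sup>+k. ennreal ((cmod (gaussian (t + of_int k / 1 + x)))\<^sup>2) \<partial>zcount) \<partial>period (1 / 1))"
    by (subst nn_integral_periodise[where a=1]) simp_all
  also have "\<dots> \<le> (\<integral>\<^sup>+t. ennreal 9 \<partial>period (1 / 1))"
  proof (intro nn_integral_mono)
    fix t
    have "(\<integral>\<^sup>+k. ennreal ((cmod (gaussian (t + of_int k / 1 + x)))\<^sup>2) \<partial>zcount)
        \<le> (\<integral>\<^sup>+k. ennreal (cmod (gaussian ((t + x) + 1 * of_int k))) \<partial>zcount)"
      by (intro nn_integral_mono ennreal_leI)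
         (simp add: cmod_gaussian power2_eq_square mult_le_one mult_left_le add_ac)
    also have "\<dots> \<le> ennreal (1 + 8 / 1)" by (rule gaussian_samples_le) simp
    finally show "(\<integral>\<^sup>+k. ennreal ((cmod (gaussian (t + of_int k / 1 + x)))\<^sup>2) \<partial>zcount) \<le> ennreal 9"
      by simp
  qed
  also have "\<dots> < \<infinity>"
    by (simp add: space_restrict_space emeasure_period ennreal_mult_less_top)
  finally show "(\<integral>\<^sup>+t. ennreal (norm ((cmod (gaussian (t + x)))\<^sup>2)) \<partial>lborel) < \<infinity>" .
qed measurable

lemma fchar_periodic:
  assumes "a > 0"
  shows "fchar (1 / a) n (t + of_int k / a) = fchar (1 / a) n t"
proof -
  have "fchar (1 / a) n (t + of_int k / a) = fchar (1 / a) n t * cis (2 * pi * of_int (n * k))"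
    using assms by (simp add: fchar_def cis_mult algebra_simps)
  also have "cis (2 * pi * of_int (n * k)) = 1"
    by (rule cis_multiple_2pi) simp
  finally show ?thesis by simp
qed

text \<open>Modulation by a multiple of a has period 1/a. Folding the inner product onto one period
  therefore leaves the character outside the inner sum, and that sum is the fibre sample.\<close>

lemma l2_inner_tf_shift:
  assumes a: "a > 0" and f: "f \<in> L2_real"
  shows "l2_inner f (tf_shift (a * of_int m, a * of_int n) gaussian)
    = fourier_coeff (1 / a) (\<lambda>t. fibre_sample a t (fibre a f t) m) n"
proof -
  have [measurable]: "f \<in> borel_measurable borel" by (rule L2_real_measurable[OF f])
  let ?F = "\<lambda>t. f t * gaussian (t - a * of_int m) * fchar (1 / a) (- n) t"
  have int: "integrable lborel ?F"
  proof (rule Bochner_Integration.integrable_bound)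
    show "integrable lborel (\<lambda>t. f t * gaussian (t - a * of_int m))"
      using f gaussian_L2[of "- (a * of_int m)"]
      by (intro integrable_mult_L2) (auto simp: L2_real_def)
  qed (auto simp: norm_mult)
  have "l2_inner f (tf_shift (a * of_int m, a * of_int n) gaussian) = (\<integral>t. ?F t \<partial>lborel)"
    unfolding l2_inner_def
  proof (intro Bochner_Integration.integral_cong refl)
    fix t
    have "cnj (exp (2 * of_real pi * \<i> * of_real (a * of_int n) * of_real t)) = fchar (1 / a) (- n) t"
      by (simp add: fchar_def cis_conv_exp exp_cnj mult_ac)
    moreover have "cnj (gaussian x) = gaussian x" for x by (simp add: gaussian_def)
    ultimately show "f t * cnj (tf_shift (a * of_int m, a * of_int n) gaussian t) = ?F t"
      by (simp only: tf_shift_def split complex_cnj_mult) (simp add: mult_ac)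
  qed
  also have "\<dots> = (\<integral>t. (\<integral>k. ?F (t + of_int k / a) \<partial>zcount) \<partial>period (1 / a))"
    by (rule integral_periodise[OF a int])
  also have "\<dots> = fourier_coeff (1 / a) (\<lambda>t. fibre_sample a t (fibre a f t) m) n"
    by (simp add: fourier_coeff_def fibre_sample_def fchar_periodic[OF a])
  finally show ?thesis .
qed

lemma frame_sum_square_lattice:
  assumes a: "a > 0"
  shows "frame_sum g (square_lattice a) f
    = (\<integral>\<^sup>+m. (\<integral>\<^sup>+n. ennreal ((cmod (l2_inner f (tf_shift (a * of_int m, a * of_int n) g)))\<^sup>2) \<partial>zcount) \<partial>zcount)"
proof -
  let ?\<phi> = "\<lambda>(m :: int, n :: int). (a * of_int m, a * of_int n)"
  have inj: "inj ?\<phi>" using a by (auto simp: inj_def)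
  have img: "square_lattice a = range ?\<phi>" by (auto simp: square_lattice_def)
  have bij: "bij_betw ?\<phi> UNIV (square_lattice a)"
    using inj by (simp add: bij_betw_def img)
  have inf: "infinite (square_lattice a)"
    using bij_betw_finite[OF bij] by (simp add: finite_prod infinite_UNIV_int)
  have cnt: "countable (square_lattice a)" unfolding img by simp
  show ?thesis
    unfolding frame_sum_def infsum_ennreal_eq_nn_integral[OF cnt inf] nn_integral_bij_count_space[OF bij, symmetric]
    by (subst nn_integral_fst_count_space[symmetric]) simp
qed

text \<open>For fixed m, summing over the modulations is Parseval on a period of length 1/a. The
  finite energy that Parseval asks of each sample function is supplied by the upper fibre
  estimate.\<close>

theorem frame_sum_fibres:
  assumes a: "1 / 2 < a" "a \<le> 1" and f: "f \<in> L2_real"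
  shows "frame_sum gaussian (square_lattice a) f = ennreal (1 / a)
    * (\<integral>\<^sup>+t. (\<integral>\<^sup>+m. ennreal ((cmod (fibre_sample a t (fibre a f t) m))\<^sup>2) \<partial>zcount) \<partial>period (1 / a))"
proof -
  have a0: "a > 0" using a by simp
  have [measurable]: "f \<in> borel_measurable borel" by (rule L2_real_measurable[OF f])
  let ?S = "\<lambda>m t. fibre_sample a t (fibre a f t) m"
  let ?I = "\<lambda>m. \<integral>\<^sup>+t. ennreal ((cmod (?S m t))\<^sup>2) \<partial>period (1 / a)"
  have meas: "?S m \<in> borel_measurable borel" for m by (rule measurable_fibre_sample) simp
  have swap: "(\<integral>\<^sup>+m. ?I m \<partial>zcount)
      = (\<integral>\<^sup>+t. (\<integral>\<^sup>+m. ennreal ((cmod (?S m t))\<^sup>2) \<partial>zcount) \<partial>period (1 / a))"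
    using meas by (intro nn_integral_count_space_nn_integral[symmetric]) measurable
  have "?I m < \<infinity>" for m
  proof -
    have "?I m \<le> (\<integral>\<^sup>+m. ?I m \<partial>zcount)"
      by (rule nn_integral_ge_point) simp
    also have "\<dots> \<le> (\<integral>\<^sup>+t. ennreal 153 * (\<integral>\<^sup>+k. ennreal ((cmod (fibre a f t k))\<^sup>2) \<partial>zcount) \<partial>period (1 / a))"
      unfolding swap by (intro nn_integral_mono fibre_sample_upper a)
    also have "\<dots> = ennreal 153 * ennreal ((l2_norm f)\<^sup>2)"
      by (simp add: nn_integral_cmult measurable_fibre_norm[OF f] fibre_norm[OF a0 f])
    also have "\<dots> < \<infinity>" by (simp add: ennreal_mult_less_top)
    finally show ?thesis .
  qed
  note pars = parseval[OF _ meas this]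
  have "frame_sum gaussian (square_lattice a) f = (\<integral>\<^sup>+m. ennreal (1 / a) * ?I m \<partial>zcount)"
    unfolding frame_sum_square_lattice[OF a0] l2_inner_tf_shift[OF a0 f]
    using a0 by (intro nn_integral_cong pars) simp
  also have "\<dots> = ennreal (1 / a) * (\<integral>\<^sup>+m. ?I m \<partial>zcount)"
    by (rule nn_integral_cmult) simp
  finally show ?thesis unfolding swap .
qed

section \<open>Frame bounds\<close>

text \<open>306 = 2 * 153, with 1/a < 2 bounding the Parseval factor.\<close>

lemma upper_bound_gaussian:
  assumes a: "1 / 2 < a" "a < 1"
  shows "is_upper_bound gaussian (square_lattice a) 306"
  unfolding is_upper_bound_def
proof (intro conjI ballI)
  fix f assume f: "f \<in> L2_real"
  have a0: "a > 0" "a \<le> 1" using a by simp_all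
  have "frame_sum gaussian (square_lattice a) f
      \<le> ennreal (1 / a) * (\<integral>\<^sup>+t. ennreal 153 * (\<integral>\<^sup>+k. ennreal ((cmod (fibre a f t k))\<^sup>2) \<partial>zcount) \<partial>period (1 / a))"
    unfolding frame_sum_fibres[OF a(1) a0(2) f]
    by (intro mult_left_mono nn_integral_mono fibre_sample_upper a a0) simp
  also have "\<dots> = ennreal (1 / a) * (ennreal 153 * ennreal ((l2_norm f)\<^sup>2))"
    by (simp add: nn_integral_cmult measurable_fibre_norm f fibre_norm[OF a0(1) f])
  also have "\<dots> = ennreal (1 / a * (153 * (l2_norm f)\<^sup>2))"
    using a0 by (subst ennreal_mult, simp, simp, subst ennreal_mult) simp_all
  also have "\<dots> \<le> ennreal (306 * (l2_norm f)\<^sup>2)"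
  proof (rule ennreal_leI)
    have "1 / a \<le> 2" using a by (simp add: field_simps)
    then show "1 / a * (153 * (l2_norm f)\<^sup>2) \<le> 306 * (l2_norm f)\<^sup>2"
      using mult_right_mono[of "1 / a" 2 "153 * (l2_norm f)\<^sup>2"] by simp
  qed
  finally show "frame_sum gaussian (square_lattice a) f \<le> ennreal (306 * (l2_norm f)\<^sup>2)" .
qed simp

definition lower_const :: real where
  "lower_const = dual_const\<^sup>2 / (25 * dual_amp\<^sup>2)"

lemma lower_const_pos: "lower_const > 0"
  using dual_const_neg dual_amp_pos by (simp add: lower_const_def)

lemma lower_bound_gaussian:
  assumes a: "1 / 2 < a" "a < 1"
  shows "is_lower_bound gaussian (square_lattice a) (lower_const * (1 - a\<^sup>2))"
  unfolding is_lower_bound_def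
proof (intro conjI ballI)
  have a0: "a > 0" "a \<le> 1" using a by simp_all
  have e: "0 < 1 - a\<^sup>2" using a by (simp add: power2_less_1_iff abs_if)
  then show "0 < lower_const * (1 - a\<^sup>2)" using lower_const_pos by simp
  fix f assume f: "f \<in> L2_real"
  note [measurable] = L2_real_measurable[OF f] measurable_fibre_norm[OF f, of a "1 / a"]
  let ?C = "25 * dual_amp\<^sup>2" and ?D = "dual_const\<^sup>2 * (1 - a\<^sup>2)"
  let ?J = "\<integral>\<^sup>+t. (\<integral>\<^sup>+m. ennreal ((cmod (fibre_sample a t (fibre a f t) m))\<^sup>2) \<partial>zcount) \<partial>period (1 / a)"
  have C: "?C > 0" using dual_amp_pos by simp
  have "ennreal ?D * ennreal ((l2_norm f)\<^sup>2)
      = (\<integral>\<^sup>+t. ennreal ?D * (\<integral>\<^sup>+k. ennreal ((cmod (fibre a f t k))\<^sup>2) \<partial>zcount) \<partial>period (1 / a))"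
    by (simp add: nn_integral_cmult fibre_norm[OF a0(1) f])
  also have "\<dots> \<le> (\<integral>\<^sup>+t. ennreal ?C
      * (\<integral>\<^sup>+m. ennreal ((cmod (fibre_sample a t (fibre a f t) m))\<^sup>2) \<partial>zcount) \<partial>period (1 / a))"
    using fibre_AE_finite[OF a0(1) f]
    by (intro nn_integral_mono_AE) (auto elim!: eventually_mono intro!: fibre_sample_lower[OF a0(1) a(2)])
  also have "\<dots> = ennreal ?C * ?J"
    by (rule nn_integral_cmult) (rule measurable_fibre_sample_norm[OF f])
  also have "\<dots> \<le> ennreal ?C * (ennreal (1 / a) * ?J)"
  proof (intro mult_left_mono)
    have "ennreal 1 \<le> ennreal (1 / a)" using a by (intro ennreal_leI) simp
    then have "1 * ?J \<le> ennreal (1 / a) * ?J" by (intro mult_right_mono) simp_all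
    then show "?J \<le> ennreal (1 / a) * ?J" by simp
  qed simp
  also have "\<dots> = ennreal ?C * frame_sum gaussian (square_lattice a) f"
    by (simp add: frame_sum_fibres[OF a(1) a0(2) f])
  finally have "ennreal (1 / ?C) * (ennreal ?D * ennreal ((l2_norm f)\<^sup>2))
      \<le> ennreal (1 / ?C) * (ennreal ?C * frame_sum gaussian (square_lattice a) f)"
    by (intro mult_left_mono) simp_all
  also have "\<dots> = frame_sum gaussian (square_lattice a) f"
    using C by (simp add: mult.assoc[symmetric] flip: ennreal_mult)
  also have "ennreal (1 / ?C) * (ennreal ?D * ennreal ((l2_norm f)\<^sup>2))
      = ennreal (1 / ?C * (?D * (l2_norm f)\<^sup>2))"
    using C e by (subst (1 2) ennreal_mult) auto
  also have "1 / ?C * (?D * (l2_norm f)\<^sup>2) = lower_const * (1 - a\<^sup>2) * (l2_norm f)\<^sup>2"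
    by (simp add: lower_const_def)
  finally show "ennreal (lower_const * (1 - a\<^sup>2) * (l2_norm f)\<^sup>2)
      \<le> frame_sum gaussian (square_lattice a) f" .
qed

text \<open>\<lfloor>a * t\<rfloor> is the index within the fibre and t - \<lfloor>a * t\<rfloor>/a
  its base point in [0, 1/a). Over the window each fibre carries the damped alternating sequence,
  elsewhere it is zero.\<close>

definition near_extremal :: "real \<Rightarrow> real \<Rightarrow> complex" where
  "near_extremal a t = of_real (damped_alternating a \<lfloor>a * t\<rfloor>)
     * indicator {a / 2..a / 2 + a * (1 - a\<^sup>2) / 4} (t - of_int \<lfloor>a * t\<rfloor> / a)"

lemma measurable_near_extremal [measurable]: "near_extremal a \<in> borel_measurable borel"
proof -
  have [measurable]: "(\<lambda>k. damped_alternating a k) \<in> borel_measurable zcount" by simp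
  have [measurable]: "(\<lambda>k::int. real_of_int k) \<in> borel_measurable zcount" by simp
  show ?thesis
    unfolding near_extremal_def[abs_def] by measurable
qed

lemma fibre_near_extremal:
  assumes a: "0 < a" and t: "t \<in> {0..<1 / a}"
  shows "near_extremal a (t + of_int k / a)
    = of_real (damped_alternating a k) * indicator {a / 2..a / 2 + a * (1 - a\<^sup>2) / 4} t"
proof -
  have eq: "a * (t + of_int k / a) = a * t + of_int k" using a by (simp add: field_simps)
  have "\<lfloor>a * t\<rfloor> = 0" using a t by (simp add: floor_eq_iff field_simps)
  then have "\<lfloor>a * (t + of_int k / a)\<rfloor> = k" unfolding eq by simp
  then show ?thesis by (simp add: near_extremal_def)
qed

text \<open>The window length appears both in the norm and in the frame sum and cancels. What
  remains is A times the sequence norm, at least of order e^{-1/2} for e = 1 - a^2, against sampled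
  energy of order e^{1/2}.\<close>

lemma lower_bound_gaussian_le:
  assumes a: "1 / 2 < a" "a < 1" and A: "is_lower_bound gaussian (square_lattice a) A"
  shows "A \<le> 7200 * (252 * pi)\<^sup>2 * exp (8 * pi) * (1 - a\<^sup>2)"
proof -
  define e where "e = 1 - a\<^sup>2"
  define I where "I = {a / 2..a / 2 + a * e / 4}"
  define K where "K = 3600 * (252 * pi)\<^sup>2"
  let ?f = "near_extremal a"
  have a0: "a > 0" "a \<le> 1" using a by simp_all
  have e: "0 < e" "e < 1" using a by (simp_all add: e_def power2_less_1_iff abs_if)
  have I_sub: "I \<subseteq> {0..<1 / a}"
  proof -
    have "a * e / 4 \<le> a / 4" using a0 e by simp
    moreover have "1 < 1 / a" using a by simp
    ultimately have "a / 2 + a * e / 4 < 1 / a" using a by linarith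
    then show ?thesis using a unfolding I_def by (auto intro: le_less_trans)
  qed
  have I_sets [measurable]: "I \<in> sets borel" by (simp add: I_def)
  have I_emeasure: "(\<integral>\<^sup>+t. indicator I t \<partial>period (1 / a)) = ennreal (a * e / 4)"
  proof -
    have "(\<integral>\<^sup>+t. indicator I t \<partial>period (1 / a)) = (\<integral>\<^sup>+t. indicator I t * indicator {0..<1 / a} t \<partial>lborel)"
      by (rule nn_integral_restrict_space) simp
    also have "\<dots> = (\<integral>\<^sup>+t. indicator I t \<partial>lborel)"
      using I_sub by (intro nn_integral_cong) (auto split: split_indicator)
    also have "\<dots> = ennreal (a * e / 4)"
      using a0 e by (simp add: I_def)
    finally show ?thesis .
  qed
  obtain X where X: "(\<integral>\<^sup>+k. ennreal ((damped_alternating a k)\<^sup>2) \<partial>zcount) = ennreal X" "0 \<le> X"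
    using damped_alternating_norm_finite[OF a0(1) a(2)]
    by (cases "\<integral>\<^sup>+k. ennreal ((damped_alternating a k)\<^sup>2) \<partial>zcount") auto
  have X_ge: "exp (- (8 * pi)) / sqrt e \<le> X"
    using damped_alternating_norm_ge[OF a] X by (simp add: e_def)
  have fib: "fibre a ?f t = (\<lambda>k. of_real (damped_alternating a k) * indicator I t)" if "t \<in> {0..<1 / a}" for t
    using fibre_near_extremal[OF a0(1) that] by (simp add: I_def e_def)
  have norm: "(\<integral>\<^sup>+t. ennreal ((cmod (?f t))\<^sup>2) \<partial>lborel) = ennreal (a * e / 4 * X)"
  proof -
    have "(\<integral>\<^sup>+t. ennreal ((cmod (?f t))\<^sup>2) \<partial>lborel)
        = (\<integral>\<^sup>+t. (\<integral>\<^sup>+k. ennreal ((cmod (?f (t + of_int k / a)))\<^sup>2) \<partial>zcount) \<partial>period (1 / a))"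
      by (rule nn_integral_periodise[OF a0(1)]) simp
    also have "\<dots> = (\<integral>\<^sup>+t. indicator I t * ennreal X \<partial>period (1 / a))"
    proof (rule nn_integral_cong)
      fix t assume "t \<in> space (period (1 / a))"
      then have t: "t \<in> {0..<1 / a}" by (simp add: space_restrict_space)
      show "(\<integral>\<^sup>+k. ennreal ((cmod (?f (t + of_int k / a)))\<^sup>2) \<partial>zcount) = indicator I t * ennreal X"
        using fun_cong[OF fib[OF t]] X(1) by (cases "t \<in> I") (simp_all add: norm_mult)
    qed
    also have "\<dots> = ennreal (a * e / 4) * ennreal X"
      by (simp add: nn_integral_multc I_emeasure)
    also have "\<dots> = ennreal (a * e / 4 * X)"
      using a0 e X by (intro ennreal_mult[symmetric]) auto
    finally show ?thesis .
  qed
  have f: "?f \<in> L2_real"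
    unfolding L2_real_def using norm by (auto intro!: integrableI_bounded)
  have nf: "(l2_norm ?f)\<^sup>2 = a * e / 4 * X"
    using L2_real_nn_integral[OF f] a0 e X unfolding norm by (subst (asm) ennreal_inj) auto
  have "frame_sum gaussian (square_lattice a) ?f
      \<le> ennreal (1 / a) * (\<integral>\<^sup>+t. indicator I t * ennreal (K * sqrt e) \<partial>period (1 / a))"
    unfolding frame_sum_fibres[OF a(1) a0(2) f]
  proof (intro mult_left_mono nn_integral_mono)
    fix t assume "t \<in> space (period (1 / a))"
    then have t: "t \<in> {0..<1 / a}" by (simp add: space_restrict_space)
    show "(\<integral>\<^sup>+m. ennreal ((cmod (fibre_sample a t (fibre a ?f t) m))\<^sup>2) \<partial>zcount)
        \<le> indicator I t * ennreal (K * sqrt e)"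
    proof (cases "t \<in> I")
      case True
      define s where "s = t / a"
      have ts: "t = a * s" using a0 by (simp add: s_def)
      have s: "1 / 2 \<le> s" "s \<le> 1 / 2 + (1 - a\<^sup>2) / 4"
        using True a0 unfolding I_def s_def e_def by (simp_all add: field_simps)
      have "fibre a ?f t = (\<lambda>k. of_real (damped_alternating a k))"
        using fib[OF t] True by simp
      with fibre_sample_damped_alternating_sum_le[OF a s] True show ?thesis
        unfolding ts by (simp add: K_def e_def)
    next
      case False
      then show ?thesis using fib[OF t] by (simp add: fibre_sample_def)
    qed
  qed simp
  also have "\<dots> = ennreal (1 / a) * (ennreal (a * e / 4) * ennreal (K * sqrt e))"
    by (simp add: nn_integral_multc I_emeasure)
  also have "\<dots> = ennreal (1 / a * (a * e / 4 * (K * sqrt e)))"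
    using a0 e by (subst (1 2) ennreal_mult) (auto simp: K_def)
  also have "1 / a * (a * e / 4 * (K * sqrt e)) = e / 4 * (K * sqrt e)" using a0 by simp
  finally have fs: "frame_sum gaussian (square_lattice a) ?f \<le> ennreal (e / 4 * (K * sqrt e))" .
  have "A > 0" and Af: "ennreal (A * (l2_norm ?f)\<^sup>2) \<le> frame_sum gaussian (square_lattice a) ?f"
    using A f by (auto simp: is_lower_bound_def)
  from order_trans[OF Af fs] have "A * (a * e / 4 * X) \<le> e / 4 * (K * sqrt e)"
    unfolding nf using e by (subst (asm) ennreal_le_iff) (auto simp: K_def)
  then have "e / 4 * (A * (a * X)) \<le> e / 4 * (K * sqrt e)"
    by (simp add: mult_ac)
  then have "A * (a * X) \<le> K * sqrt e"
    using e by (subst (asm) mult_le_cancel_left_pos) simp_all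
  moreover have "A * (1 / 2 * (exp (- (8 * pi)) / sqrt e)) \<le> A * (a * X)"
    using \<open>A > 0\<close> a X_ge e by (intro mult_left_mono mult_mono) auto
  ultimately have "A * (1 / 2 * (exp (- (8 * pi)) / sqrt e)) \<le> K * sqrt e" by linarith
  \<comment> \<open>The multiplier clears the left side to A; its factor sqrt e joins the one on the
    right to give 1 - a^2, and the 2, from a > 1/2, turns 3600 into 7200.\<close>
  then have "A * (1 / 2 * (exp (- (8 * pi)) / sqrt e)) * (2 * exp (8 * pi) * sqrt e)
      \<le> K * sqrt e * (2 * exp (8 * pi) * sqrt e)"
    using e by (intro mult_right_mono) auto
  also have "A * (1 / 2 * (exp (- (8 * pi)) / sqrt e)) * (2 * exp (8 * pi) * sqrt e) = A"
    using e by (simp add: exp_minus field_simps)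
  also have "K * sqrt e * (2 * exp (8 * pi) * sqrt e) = 7200 * (252 * pi)\<^sup>2 * exp (8 * pi) * (sqrt e * sqrt e)"
    by (simp add: K_def)
  also have "sqrt e * sqrt e = 1 - a\<^sup>2" using e by (simp add: e_def)
  finally show ?thesis .
qed

text \<open>One term of the frame sum is enough: the inner product of the indicator of [0, 1], of
  norm 1, with the unshifted Gaussian is at least e^{-pi}.\<close>

lemma upper_bound_gaussian_ge:
  assumes a: "a > 0" and B: "is_upper_bound gaussian (square_lattice a) B"
  shows "exp (- (2 * pi)) \<le> B"
proof -
  let ?f = "\<lambda>t::real. indicator {0..1} t :: complex"
  have sq: "(cmod (?f t))\<^sup>2 = indicator {0..1} t" for t by (simp add: indicator_def)
  have "integrable lborel (\<lambda>t. (cmod (?f t))\<^sup>2)" unfolding sq by simp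
  then have f: "?f \<in> L2_real" by (simp add: L2_real_def)
  have nf: "(l2_norm ?f)\<^sup>2 = 1"
    unfolding l2_norm_def sq by simp
  have int: "integrable lborel (\<lambda>t. indicator {0..1} t * exp (- pi * t\<^sup>2))"
  proof -
    have "continuous_on {0..1} (\<lambda>t::real. exp (- pi * t\<^sup>2))"
      by (intro continuous_intros)
    from borel_integrable_atLeastAtMost'[OF this] show ?thesis
      by (simp add: set_integrable_def)
  qed
  have "l2_inner ?f (tf_shift (a * of_int 0, a * of_int 0) gaussian)
      = (\<integral>t. of_real (indicator {0..1} t * exp (- pi * t\<^sup>2)) \<partial>lborel)"
    unfolding l2_inner_def
    by (intro Bochner_Integration.integral_cong refl) (simp add: tf_shift_def gaussian_def indicator_def)
  also have "\<dots> = of_real (\<integral>t. indicator {0..1} t * exp (- pi * t\<^sup>2) \<partial>lborel)"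
    by (rule integral_complex_of_real)
  finally have inner: "l2_inner ?f (tf_shift (a * of_int 0, a * of_int 0) gaussian)
      = of_real (\<integral>t. indicator {0..1} t * exp (- pi * t\<^sup>2) \<partial>lborel)" .
  have "exp (- pi) = (\<integral>t. indicator {0..1} t * exp (- pi) \<partial>(lborel :: real measure))"
    by simp
  also have "\<dots> \<le> (\<integral>t. indicator {0..1} t * exp (- pi * t\<^sup>2) \<partial>lborel)"
  proof (intro integral_mono int)
    show "integrable lborel (\<lambda>t::real. indicator {0..1} t * exp (- pi))" by simp
    fix t :: real
    show "indicator {0..1} t * exp (- pi) \<le> indicator {0..1} t * exp (- pi * t\<^sup>2)"
      by (auto simp: indicator_def power_le_one)
  qed
  finally have "(exp (- pi))\<^sup>2 \<le> (cmod (l2_inner ?f (tf_shift (a * of_int 0, a * of_int 0) gaussian)))\<^sup>2"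
    unfolding inner by (intro power_mono) auto
  then have "ennreal ((exp (- pi))\<^sup>2)
      \<le> ennreal ((cmod (l2_inner ?f (tf_shift (a * of_int 0, a * of_int 0) gaussian)))\<^sup>2)"
    by (rule ennreal_leI)
  also have "\<dots> \<le> (\<integral>\<^sup>+n. ennreal ((cmod (l2_inner ?f (tf_shift (a * of_int 0, a * of_int n) gaussian)))\<^sup>2) \<partial>zcount)"
    by (rule nn_integral_ge_point) simp
  also have "\<dots> \<le> frame_sum gaussian (square_lattice a) ?f"
    unfolding frame_sum_square_lattice[OF a] by (rule nn_integral_ge_point) simp
  also have "\<dots> \<le> ennreal (B * (l2_norm ?f)\<^sup>2)"
    using B f by (simp add: is_upper_bound_def)
  also have "\<dots> = ennreal B" unfolding nf by simp
  finally have "(exp (- pi))\<^sup>2 \<le> B"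
    using B by (subst (asm) ennreal_le_iff) (auto simp: is_upper_bound_def)
  then show ?thesis by (simp flip: exp_of_nat_mult)
qed

text \<open>\<open>GREATEST\<close> has a meaning only if the maximum exists. The supremum is finite
  by C and is itself a lower bound: where the frame sum is finite and the norm positive, each
  inequality bounds A by a fixed quotient, which passes to the supremum.\<close>

lemma lower_frame_bound_optimal:
  assumes A0: "is_lower_bound g \<Lambda> A0" and C: "\<And>A. is_lower_bound g \<Lambda> A \<Longrightarrow> A \<le> C"
  shows "is_lower_bound g \<Lambda> (lower_frame_bound g \<Lambda>)" "A0 \<le> lower_frame_bound g \<Lambda>"
proof -
  define S where "S = Collect (is_lower_bound g \<Lambda>)"
  have bdd: "bdd_above S" and ne: "S \<noteq> {}"
    using A0 C by (auto simp: S_def intro!: bdd_aboveI[where M=C])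
  have le: "A \<le> Sup S" if "is_lower_bound g \<Lambda> A" for A
    using that bdd by (intro cSup_upper) (simp_all add: S_def)
  have "is_lower_bound g \<Lambda> (Sup S)"
    unfolding is_lower_bound_def
  proof (intro conjI ballI)
    show "0 < Sup S" using le[OF A0] A0 by (auto simp: is_lower_bound_def)
    fix f assume f: "f \<in> L2_real"
    show "ennreal (Sup S * (l2_norm f)\<^sup>2) \<le> frame_sum g \<Lambda> f"
    proof (cases "frame_sum g \<Lambda> f")
      case (real r)
      have *: "A * (l2_norm f)\<^sup>2 \<le> r" if "A \<in> S" for A
        using that f real by (auto simp: S_def is_lower_bound_def ennreal_le_iff)
      have "Sup S * (l2_norm f)\<^sup>2 \<le> r"
      proof (cases "(l2_norm f)\<^sup>2 = 0")
        case True then show ?thesis using real by simp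
      next
        case False
        then have pos: "(l2_norm f)\<^sup>2 > 0" by simp
        have "Sup S \<le> r / (l2_norm f)\<^sup>2"
          using * pos by (intro cSup_least ne) (simp add: pos_le_divide_eq)
        then show ?thesis using pos by (simp add: pos_le_divide_eq)
      qed
      then show ?thesis using real by (simp add: ennreal_leI)
    qed simp
  qed
  moreover from this have "lower_frame_bound g \<Lambda> = Sup S"
    unfolding lower_frame_bound_def using le by (intro Greatest_equality)
  ultimately show "is_lower_bound g \<Lambda> (lower_frame_bound g \<Lambda>)" "A0 \<le> lower_frame_bound g \<Lambda>"
    using le[OF A0] by simp_all
qed

text \<open>Dual to the case of the lower bound. The constant c keeps the infimum positive, as
  \<open>is_upper_bound\<close> demands, and B0 makes every frame sum finite.\<close>

lemma upper_frame_bound_optimal: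
  assumes B0: "is_upper_bound g \<Lambda> B0" and c: "c > 0" "\<And>B. is_upper_bound g \<Lambda> B \<Longrightarrow> c \<le> B"
  shows "is_upper_bound g \<Lambda> (upper_frame_bound g \<Lambda>)" "upper_frame_bound g \<Lambda> \<le> B0"
proof -
  define S where "S = Collect (is_upper_bound g \<Lambda>)"
  have bdd: "bdd_below S" and ne: "S \<noteq> {}"
    using B0 c by (auto simp: S_def intro!: bdd_belowI[where m=c])
  have le: "Inf S \<le> B" if "is_upper_bound g \<Lambda> B" for B
    using that bdd by (intro cInf_lower) (simp_all add: S_def)
  have "is_upper_bound g \<Lambda> (Inf S)"
    unfolding is_upper_bound_def
  proof (intro conjI ballI)
    have "c \<le> Inf S" using c ne by (intro cInf_greatest) (auto simp: S_def)
    then show pos_Inf: "0 < Inf S" using c by simp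
    fix f assume f: "f \<in> L2_real"
    have "frame_sum g \<Lambda> f \<le> ennreal (B0 * (l2_norm f)\<^sup>2)"
      using B0 f by (simp add: is_upper_bound_def)
    then obtain r where r: "frame_sum g \<Lambda> f = ennreal r" "0 \<le> r"
      by (cases "frame_sum g \<Lambda> f") (auto simp: top_unique)
    have *: "r \<le> B * (l2_norm f)\<^sup>2" if "B \<in> S" for B
    proof -
      have "0 < B" "ennreal r \<le> ennreal (B * (l2_norm f)\<^sup>2)"
        using that f r by (auto simp: S_def is_upper_bound_def)
      then show ?thesis by (simp add: ennreal_le_iff)
    qed
    have "r \<le> Inf S * (l2_norm f)\<^sup>2"
    proof (cases "(l2_norm f)\<^sup>2 = 0")
      case True then show ?thesis using *[of B0] B0 by (simp add: S_def)
    next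
      case False
      then have pos: "(l2_norm f)\<^sup>2 > 0" by simp
      have "r / (l2_norm f)\<^sup>2 \<le> Inf S"
        using * pos by (intro cInf_greatest ne) (simp add: pos_divide_le_eq)
      then show ?thesis using pos by (simp add: pos_divide_le_eq)
    qed
    then show "frame_sum g \<Lambda> f \<le> ennreal (Inf S * (l2_norm f)\<^sup>2)"
      unfolding r(1) by (rule ennreal_leI)
  qed
  moreover from this have "upper_frame_bound g \<Lambda> = Inf S"
    unfolding upper_frame_bound_def using le by (intro Least_equality)
  ultimately show "is_upper_bound g \<Lambda> (upper_frame_bound g \<Lambda>)" "upper_frame_bound g \<Lambda> \<le> B0"
    using le[OF B0] by simp_all
qed

theorem theorem1p1:
  shows "\<exists>c C :: real. 0 < c \<and> c < C \<and>
    (\<forall>a::real. 1/2 < a \<and> a < 1 \<longrightarrow>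
       gabor_frame gaussian (square_lattice a) \<and>
       c * (1 - a\<^sup>2) \<le> lower_frame_bound gaussian (square_lattice a) \<and>
       lower_frame_bound gaussian (square_lattice a) \<le> C * (1 - a\<^sup>2) \<and>
       c < upper_frame_bound gaussian (square_lattice a) \<and>
       upper_frame_bound gaussian (square_lattice a) < C)"
proof -
  define K where "K = 7200 * (252 * pi)\<^sup>2 * exp (8 * pi)"
  \<comment> \<open>Halving e^{-2 pi}, and taking 307 rather than 306 in C, turns the bounds for the
    upper frame bound into strict ones.\<close>
  define c where "c = min lower_const (exp (- (2 * pi)) / 2)"
  define C where "C = max K 307"
  have c: "0 < c" using lower_const_pos by (simp add: c_def)
  have "exp (- (2 * pi)) < 1" by simp
  then have "c < C" unfolding c_def C_def by linarith
  moreover have "gabor_frame gaussian (square_lattice a) \<and>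
       c * (1 - a\<^sup>2) \<le> lower_frame_bound gaussian (square_lattice a) \<and>
       lower_frame_bound gaussian (square_lattice a) \<le> C * (1 - a\<^sup>2) \<and>
       c < upper_frame_bound gaussian (square_lattice a) \<and>
       upper_frame_bound gaussian (square_lattice a) < C" if a: "1 / 2 < a" "a < 1" for a
  proof -
    have a0: "a > 0" using a by simp
    have e: "0 \<le> 1 - a\<^sup>2" using a by (simp add: power_le_one)
    note lower = lower_bound_gaussian[OF a]
    note lower_le = lower_bound_gaussian_le[OF a]
    note upper = upper_bound_gaussian[OF a]
    note upper_ge = upper_bound_gaussian_ge[OF a0]
    note opt_l = lower_frame_bound_optimal[OF lower lower_le]
    note opt_u = upper_frame_bound_optimal[OF upper exp_gt_zero upper_ge]
    have "gabor_frame gaussian (square_lattice a)"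
      unfolding gabor_frame_def using lower upper by blast
    moreover have "c * (1 - a\<^sup>2) \<le> lower_const * (1 - a\<^sup>2)"
      using e by (intro mult_right_mono) (simp_all add: c_def)
    moreover have "K * (1 - a\<^sup>2) \<le> C * (1 - a\<^sup>2)"
      using e by (intro mult_right_mono) (simp_all add: C_def)
    moreover have "lower_frame_bound gaussian (square_lattice a) \<le> K * (1 - a\<^sup>2)"
      unfolding K_def by (rule lower_le[OF opt_l(1)])
    moreover have "c < exp (- (2 * pi))"
      unfolding c_def using exp_gt_zero[of "- (2 * pi)"] by linarith
    moreover have "exp (- (2 * pi)) \<le> upper_frame_bound gaussian (square_lattice a)"
      by (rule upper_ge[OF opt_u(1)])
    moreover have "306 < C" by (simp add: C_def)
    ultimately show ?thesis using opt_l(2) opt_u(2) by linarith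
  qed
  ultimately show ?thesis using c by blast
qed

end
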